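(* Let $m=p+q$ with $p,q\ge1$, $\mathbb R^m=\mathbb R^p\oplus\mathbb R^q$, $x=u+v$ with $u\in\mathbb R^p$, $v\in\mathbb R^q$, and let $n\in\mathbb N$. Then there is the $\mathrm{Spin}(p)\times\mathrm{Spin}(q)$-invariant decomposition $$\mathcal M_n(\mathbb R^m,\mathbb C_m)=\bigoplus_{s+k+i=n}\tau_M\big(u^s\mathcal M_k(\mathbb R^p,\mathbb C_p)\otimes\mathcal M_i(\mathbb R^q,\mathbb C_q)\big),$$ the sum being over all $s,k,i\in\mathbb N$ with $s+k+i=n$.
   Context: $\mathbb N=\{0,1,2,\dots\}$. $\mathbb C_m$ is the complex Clifford algebra generated by $e_1,\dots,e_m$ with $e_ie_j+e_je_i=-2\delta_{ij}$; $\mathbb C_p$ is the subalgebra generated by $e_1,\dots,e_p$ (a basis of $\mathbb R^p$) and $\mathbb C_q$ the subalgebra generated by $e_{p+1},\dots,e_m$ (a basis of $\mathbb R^q$). Vectors are identified with Clifford algebra elements, e.g. $x=\sum_jx_je_j$. $\mathcal P(\mathbb R^d,\mathbb C_d)$ is the space of $\mathbb C_d$-valued polynomials on $\mathbb R^d$; $\mathcal M(\mathbb R^d,\mathbb C_d)$ is its subspace of monogenic polynomials (annihilated by the Dirac operator $\sum_je_j\partial_{x_j}$ of $\mathbb R^d$ acting from the left) and $\mathcal M_k(\mathbb R^d,\mathbb C_d)$ the subspace of those homogeneous of degree $k$. $P_M$ is the projection of $\mathcal P(\mathbb R^m,\mathbb C_m)$ onto the $s=0$ summand of the Fischer decomposition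 $\mathcal P(\mathbb R^m,\mathbb C_m)=\bigoplus_{s\ge0}x^s\mathcal M(\mathbb R^m,\mathbb C_m)$, and $\tau_M$ is the linear map $\mathcal P(\mathbb R^p,\mathbb C_p)\otimes\mathcal M(\mathbb R^q,\mathbb C_q)\to\mathcal M(\mathbb R^m,\mathbb C_m)$ with $\tau_M(K\otimes G)=P_M(K(u)G(v))$ (product in $\mathbb C_m$). $\mathrm{Spin}(d)$ (products of an even number of unit vectors of $\mathbb R^d$) acts on Clifford-valued polynomials by $L(s)P(x)=sP(s^{-1}xs)$; $\mathrm{Spin}(p)\times\mathrm{Spin}(q)$ acts on $\mathcal M_n(\mathbb R^m,\mathbb C_m)$ through $(s,t)\mapsto L(st)$. *)

theory Defs
  imports "HOL-Analysis.Analysis" "HOL-Library.Poly_Mapping"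
begin

section \<open>The complex Clifford algebra\<close>

text \<open>
  A single algebra on generators \<open>evec j\<close> (\<open>j\<close> a natural number) contains all the Clifford algebras
  needed: for a set \<open>A\<close> of indices, \<open>Cl A\<close> below is the subalgebra generated by the \<open>evec j\<close> with
  \<open>j \<in> A\<close>. An element is given by its finitely many coefficients with respect to the blades
  \<open>e\<^sub>S = e\<^bsub>j1\<^esub> \<cdots> e\<^bsub>jr\<^esub>\<close> for finite sets \<open>S = {j1 < \<dots> < jr}\<close>.
\<close>

typedef cliff =
  "{f :: nat set \<Rightarrow> complex. finite {S. f S \<noteq> 0} \<and> (\<forall>S. f S \<noteq> 0 \<longrightarrow> finite S)}"
  morphisms bcoeff Abs_cliff
  by (rule exI[of _ "\<lambda>_. 0"]) simp

setup_lifting type_definition_cliff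

lemma finite_bcoeff: "finite {S. bcoeff a S \<noteq> 0}"
  and bcoeff_nz_finite: "bcoeff a S \<noteq> 0 \<Longrightarrow> finite S"
  using bcoeff[of a] by auto

lemma cliff_eqI: "(\<And>S. bcoeff a S = bcoeff b S) \<Longrightarrow> a = b"
  by (simp add: bcoeff_inject[symmetric] fun_eq_iff)

text \<open>
  \<open>e\<^sub>S e\<^sub>T = bsign S T e\<^bsub>S \<triangle> T\<^esub>\<close>: one factor \<open>-1\<close> for every transposition (pairs \<open>i > j\<close>) and one for
  every square \<open>e\<^sub>i\<^sup>2 = -1\<close> (pairs \<open>i = j\<close>).
\<close>

definition bsign :: "nat set \<Rightarrow> nat set \<Rightarrow> complex" where
  "bsign S T = (-1) ^ card {(i, j). i \<in> S \<and> j \<in> T \<and> j \<le> i}"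

lemma finite_bsign_pairs:
  assumes "finite S" shows "finite {(i, j). i \<in> S \<and> j \<in> T \<and> j \<le> (i::nat)}"
proof (rule finite_subset)
  show "{(i, j). i \<in> S \<and> j \<in> T \<and> j \<le> i} \<subseteq> (SIGMA i:S. {..i})" by auto
qed (use assms in auto)

lemma minus_one_power_card_sym_diff:
  assumes "finite X" "finite Y"
  shows "(-1 :: complex) ^ card (sym_diff X Y) = (-1) ^ card X * (-1) ^ card Y"
proof -
  have "card X = card (X - Y) + card (X \<inter> Y)" "card Y = card (Y - X) + card (X \<inter> Y)"
    using card_Int_Diff[OF assms(1), of Y] card_Int_Diff[OF assms(2), of X]
    by (simp_all add: Int_commute)
  moreover have "card (sym_diff X Y) = card (X - Y) + card (Y - X)"
    using assms by (intro card_Un_disjoint) auto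
  ultimately show ?thesis
    by (simp add: power_add mult_ac)
qed

lemma bsign_sym_diff_left:
  assumes "finite S" "finite T"
  shows "bsign (sym_diff S T) U = bsign S U * bsign T U"
proof -
  have "{(i, j). i \<in> sym_diff S T \<and> j \<in> U \<and> j \<le> i} =
      sym_diff {(i, j). i \<in> S \<and> j \<in> U \<and> j \<le> i} {(i, j). i \<in> T \<and> j \<in> U \<and> j \<le> i}"
    by auto
  then show ?thesis
    using assms
    by (simp only: bsign_def) (rule minus_one_power_card_sym_diff; rule finite_bsign_pairs)
qed

lemma bsign_sym_diff_right:
  assumes "finite S"
  shows "bsign S (sym_diff T U) = bsign S T * bsign S U"
proof -
  have "{(i, j). i \<in> S \<and> j \<in> sym_diff T U \<and> j \<le> i} =
      sym_diff {(i, j). i \<in> S \<and> j \<in> T \<and> j \<le> i} {(i, j). i \<in> S \<and> j \<in> U \<and> j \<le> i}"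
    by auto
  then show ?thesis
    using assms
    by (simp only: bsign_def) (rule minus_one_power_card_sym_diff; rule finite_bsign_pairs)
qed

lemma bsign_cocycle:
  assumes "finite S" "finite T"
  shows "bsign (sym_diff S T) U * bsign S T = bsign T U * bsign S (sym_diff T U)"
  using assms by (simp add: bsign_sym_diff_left bsign_sym_diff_right)

instantiation cliff :: ring_1
begin

lift_definition zero_cliff :: cliff is "\<lambda>_. 0" by simp

lift_definition one_cliff :: cliff is "\<lambda>S. if S = {} then 1 else 0" by simp

lift_definition plus_cliff :: "cliff \<Rightarrow> cliff \<Rightarrow> cliff" is "\<lambda>f g S. f S + g S"
  subgoal for f g
    by (rule conjI, rule finite_subset[of _ "{S. f S \<noteq> 0} \<union> {S. g S \<noteq> 0}"]) (auto, metis add_0)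
  done

lift_definition uminus_cliff :: "cliff \<Rightarrow> cliff" is "\<lambda>f S. - f S" by simp

lift_definition minus_cliff :: "cliff \<Rightarrow> cliff \<Rightarrow> cliff" is "\<lambda>f g S. f S - g S"
  subgoal for f g
    by (rule conjI, rule finite_subset[of _ "{S. f S \<noteq> 0} \<union> {S. g S \<noteq> 0}"]) (auto, metis)
  done

text \<open>The coefficient at \<open>R\<close> collects the products \<open>e\<^sub>S e\<^sub>T\<close> with \<open>S \<triangle> T = R\<close>, that is \<open>T = S \<triangle> R\<close>.\<close>

lift_definition times_cliff :: "cliff \<Rightarrow> cliff \<Rightarrow> cliff" is
  "\<lambda>f g R. \<Sum>S | f S \<noteq> 0. bsign S (sym_diff S R) * f S * g (sym_diff S R)"
  subgoal premises fg for f g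
  proof -
    have ex: "\<exists>S T. f S \<noteq> 0 \<and> g T \<noteq> 0 \<and> R = sym_diff S T"
      if nz: "(\<Sum>S | f S \<noteq> 0. bsign S (sym_diff S R) * f S * g (sym_diff S R)) \<noteq> 0" for R
    proof -
      obtain S where "f S \<noteq> 0" "g (sym_diff S R) \<noteq> 0"
        using sum.not_neutral_contains_not_neutral[OF nz] by auto
      moreover have "R = sym_diff S (sym_diff S R)" by auto
      ultimately show ?thesis by blast
    qed
    let ?F = "(\<lambda>(S, T). sym_diff S T) ` ({S. f S \<noteq> 0} \<times> {S. g S \<noteq> 0})"
    have "finite ?F" using fg by auto
    moreover have "{R. (\<Sum>S | f S \<noteq> 0. bsign S (sym_diff S R) * f S * g (sym_diff S R)) \<noteq> 0} \<subseteq> ?F"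
    proof
      fix R assume "R \<in> {R. (\<Sum>S | f S \<noteq> 0. bsign S (sym_diff S R) * f S * g (sym_diff S R)) \<noteq> 0}"
      then obtain S T where "f S \<noteq> 0" "g T \<noteq> 0" "R = sym_diff S T" using ex by blast
      then show "R \<in> ?F" by (intro rev_image_eqI[of "(S, T)"]) auto
    qed
    moreover have "finite R"
      if "(\<Sum>S | f S \<noteq> 0. bsign S (sym_diff S R) * f S * g (sym_diff S R)) \<noteq> 0" for R
      using ex[OF that] fg by auto
    ultimately show ?thesis by (blast intro: finite_subset)
  qed
  done

lemma bcoeff_times_superset:
  assumes "finite F" "{S. bcoeff a S \<noteq> 0} \<subseteq> F"
  shows "bcoeff (a * b) R = (\<Sum>S\<in>F. bsign S (sym_diff S R) * bcoeff a S * bcoeff b (sym_diff S R))"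
  unfolding times_cliff.rep_eq using assms by (intro sum.mono_neutral_left) auto

instance
proof
  fix a b c :: cliff
  show "a + b + c = a + (b + c)" by transfer (simp add: add.assoc)
  show "a + b = b + a" by transfer (simp add: add.commute)
  show "0 + a = a" by transfer simp
  show "- a + a = 0" by transfer simp
  show "a - b = a + - b" by transfer simp
  show "(0::cliff) \<noteq> 1" by transfer (metis zero_neq_one)
  show "a * (b + c) = a * b + a * c"
    by transfer (simp add: distrib_left sum.distrib fun_eq_iff)
  show "1 * a = a"
  proof (rule cliff_eqI)
    show "bcoeff (1 * a) R = bcoeff a R" for R
      by (subst bcoeff_times_superset[of "{{}}"]) (auto simp: one_cliff.rep_eq bsign_def split: if_splits)
  qed
  show "a * 1 = a"
  proof (rule cliff_eqI)
    fix R
    have "bcoeff (a * 1) R =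
      (\<Sum>S | bcoeff a S \<noteq> 0. if S = R then bsign S {} * bcoeff a S else 0)"
      unfolding times_cliff.rep_eq one_cliff.rep_eq by (rule sum.cong) auto
    also have "\<dots> = bcoeff a R"
      using finite_bcoeff[of a] by (auto simp: bsign_def)
    finally show "bcoeff (a * 1) R = bcoeff a R" .
  qed
  show "(a + b) * c = a * c + b * c"
  proof (rule cliff_eqI)
    fix R
    let ?F = "{S. bcoeff a S \<noteq> 0} \<union> {S. bcoeff b S \<noteq> 0}"
    have F: "finite ?F" "{S. bcoeff a S \<noteq> 0} \<subseteq> ?F" "{S. bcoeff b S \<noteq> 0} \<subseteq> ?F"
      "{S. bcoeff (a + b) S \<noteq> 0} \<subseteq> ?F"
      by (auto simp: finite_bcoeff plus_cliff.rep_eq)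
    show "bcoeff ((a + b) * c) R = bcoeff (a * c + b * c) R"
      by (simp add: plus_cliff.rep_eq bcoeff_times_superset[OF F(1) F(2)]
          bcoeff_times_superset[OF F(1) F(3)] bcoeff_times_superset[OF F(1) F(4)]
          algebra_simps sum.distrib)
  qed
  show "a * b * c = a * (b * c)"
  proof (rule cliff_eqI)
    fix R
    let ?A = "{S. bcoeff a S \<noteq> 0}" and ?B = "{S. bcoeff b S \<noteq> 0}"
    let ?F = "(\<lambda>(S, T). sym_diff S T) ` (?A \<times> ?B)"
    have finF: "finite ?F" by (simp add: finite_bcoeff)
    have sub: "{S. bcoeff (a * b) S \<noteq> 0} \<subseteq> ?F"
    proof
      fix Q assume "Q \<in> {S. bcoeff (a * b) S \<noteq> 0}"
      then have nz: "(\<Sum>S\<in>?A. bsign S (sym_diff S Q) * bcoeff a S * bcoeff b (sym_diff S Q)) \<noteq> 0"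
        by (simp add: times_cliff.rep_eq)
      obtain S where "bcoeff a S \<noteq> 0" "bcoeff b (sym_diff S Q) \<noteq> 0"
        using sum.not_neutral_contains_not_neutral[OF nz] by auto
      then show "Q \<in> ?F" by (intro rev_image_eqI[of "(S, sym_diff S Q)"]) auto
    qed
    let ?t = "\<lambda>S T. bsign S T * bcoeff a S * bcoeff b T *
        (bsign (sym_diff S T) (sym_diff (sym_diff S T) R) * bcoeff c (sym_diff (sym_diff S T) R))"
    have inner: "(\<Sum>Q\<in>?F. ?t S (sym_diff S Q)) = (\<Sum>T\<in>?B. ?t S T)" if "S \<in> ?A" for S
    proof -
      have inv: "sym_diff S (sym_diff S T) = T" for T by auto
      have "(\<Sum>Q\<in>?F. ?t S (sym_diff S Q)) = (\<Sum>Q\<in>sym_diff S ` ?B. ?t S (sym_diff S Q))"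
      proof (rule sum.mono_neutral_right[OF finF])
        show "sym_diff S ` ?B \<subseteq> ?F" using that by force
        show "\<forall>Q\<in>?F - sym_diff S ` ?B. ?t S (sym_diff S Q) = 0"
        proof
          fix Q assume Q: "Q \<in> ?F - sym_diff S ` ?B"
          have "sym_diff S Q \<notin> ?B"
          proof
            assume "sym_diff S Q \<in> ?B"
            then have "sym_diff S (sym_diff S Q) \<in> sym_diff S ` ?B" by (rule imageI)
            with Q show False by (simp only: inv) blast
          qed
          then show "?t S (sym_diff S Q) = 0" by simp
        qed
      qed
      also have "\<dots> = (\<Sum>T\<in>?B. ?t S T)"
      proof (subst sum.reindex)
        show "inj_on (sym_diff S) ?B" by (rule inj_on_inverseI[of _ "sym_diff S"]) (rule inv)
        show "sum ((\<lambda>Q. ?t S (sym_diff S Q)) \<circ> sym_diff S) ?B = (\<Sum>T\<in>?B. ?t S T)"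
          by (simp only: o_def inv)
      qed
      finally show ?thesis .
    qed
    have "bcoeff (a * b * c) R = (\<Sum>Q\<in>?F. \<Sum>S\<in>?A. ?t S (sym_diff S Q))"
    proof -
      have inv: "sym_diff S (sym_diff S T) = T" for S T :: "nat set" by auto
      show ?thesis
        by (subst bcoeff_times_superset[OF finF sub])
          (simp only: times_cliff.rep_eq[of a b] inv sum_distrib_left sum_distrib_right mult_ac)
    qed
    also have "\<dots> = (\<Sum>S\<in>?A. \<Sum>Q\<in>?F. ?t S (sym_diff S Q))" by (rule sum.swap)
    also have "\<dots> = (\<Sum>S\<in>?A. \<Sum>T\<in>?B. ?t S T)" by (rule sum.cong[OF refl inner])
    also have "\<dots> = bcoeff (a * (b * c)) R"
    proof -
      have t: "?t S T = bsign S (sym_diff S R) * bcoeff a S *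
          (bsign T (sym_diff T (sym_diff S R)) * bcoeff b T * bcoeff c (sym_diff T (sym_diff S R)))"
        if "S \<in> ?A" "T \<in> ?B" for S T
      proof -
        let ?U = "sym_diff (sym_diff S T) R"
        have 1: "sym_diff T (sym_diff S R) = ?U" "sym_diff S R = sym_diff T ?U" by auto
        have "finite S" "finite T" using that by (auto intro: bcoeff_nz_finite)
        note c = bsign_cocycle[OF this, of ?U]
        have "?t S T = (bsign (sym_diff S T) ?U * bsign S T) * (bcoeff a S * bcoeff b T * bcoeff c ?U)"
          by (simp only: mult_ac)
        also have "\<dots> = (bsign T ?U * bsign S (sym_diff S R)) * (bcoeff a S * bcoeff b T * bcoeff c ?U)"
          by (simp only: c 1(2)[symmetric])
        finally show ?thesis by (simp only: 1(1) mult_ac)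
      qed
      show ?thesis
        unfolding times_cliff.rep_eq[of a "b * c"] times_cliff.rep_eq[of b c] sum_distrib_left
        by (intro sum.cong refl t)
    qed
    finally show "bcoeff (a * b * c) R = bcoeff (a * (b * c)) R" .
  qed
qed

end

lift_definition blade :: "nat set \<Rightarrow> cliff" is
  "\<lambda>S T. if finite S \<and> T = S then 1 else 0"
  subgoal for S by (auto intro: finite_subset[of _ "{S}"])
  done

abbreviation evec :: "nat \<Rightarrow> cliff" where "evec j \<equiv> blade {j}"

lift_definition scalar :: "complex \<Rightarrow> cliff" is "\<lambda>c S. if S = {} then c else 0"
  by (auto intro: finite_subset[of _ "{{}}"])

lemma blade_empty: "blade {} = 1"
  by transfer auto

lemma scalar_times_bcoeff: "bcoeff (scalar c * a) R = c * bcoeff a R"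
  by (subst bcoeff_times_superset[of "{{}}"]) (auto simp: scalar.rep_eq bsign_def split: if_splits)

lemma scalar_0 [simp]: "scalar 0 = 0" and scalar_1 [simp]: "scalar 1 = 1"
  and scalar_add: "scalar (c + d) = scalar c + scalar d"
  and scalar_uminus: "scalar (- c) = - scalar c"
  by (transfer; auto)+

lemma scalar_mult: "scalar (c * d) = scalar c * scalar d"
  by (rule cliff_eqI) (simp add: scalar_times_bcoeff scalar.rep_eq)

lemma scalar_commute: "a * scalar c = scalar c * a"
proof (rule cliff_eqI)
  fix R
  have "bcoeff (a * scalar c) R =
      (\<Sum>S | bcoeff a S \<noteq> 0. if S = R then bsign S {} * bcoeff a S * c else 0)"
    unfolding times_cliff.rep_eq scalar.rep_eq by (rule sum.cong) auto
  also have "\<dots> = bcoeff a R * c"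
    using finite_bcoeff[of a] by (auto simp: bsign_def)
  finally show "bcoeff (a * scalar c) R = bcoeff (scalar c * a) R"
    by (simp add: scalar_times_bcoeff mult.commute)
qed

lemma blade_mult:
  assumes "finite S" "finite T"
  shows "blade S * blade T = scalar (bsign S T) * blade (sym_diff S T)"
proof (rule cliff_eqI)
  fix R
  have "sym_diff S R = T \<longleftrightarrow> R = sym_diff S T" by auto
  then show "bcoeff (blade S * blade T) R = bcoeff (scalar (bsign S T) * blade (sym_diff S T)) R"
    using assms
    by (subst bcoeff_times_superset[of "{S}"])
      (auto simp: scalar_times_bcoeff blade.rep_eq split: if_splits)
qed

lemma evec_anticommute: "evec i * evec j + evec j * evec i = (if i = j then - 2 else 0)"
proof -
  have *: "bsign {i} {j} = (if j \<le> i then - 1 else 1)" for i j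
  proof -
    have "{(a, b). a \<in> {i} \<and> b \<in> {j} \<and> b \<le> a} = (if j \<le> i then {(i, j)} else {})" by auto
    then show ?thesis by (simp add: bsign_def)
  qed
  show ?thesis
  proof (cases "i = j")
    case True
    then show ?thesis by (simp add: blade_mult * scalar_uminus blade_empty)
  next
    case False
    moreover have "sym_diff {i} {j} = sym_diff {j} {i}" by auto
    ultimately show ?thesis by (auto simp: blade_mult * scalar_uminus simp del: Diff_insert0)
  qed
qed

lemma blade_insert_greater:
  assumes "finite S" "\<And>i. i \<in> S \<Longrightarrow> i < j"
  shows "blade (insert j S) = blade S * evec j"
proof -
  have "{(i, k). i \<in> S \<and> k \<in> {j} \<and> k \<le> i} = {}" "sym_diff S {j} = insert j S"
    using assms(2) by force+
  then show ?thesis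
    using assms(1) by (simp only: blade_mult bsign_def finite.intros) simp
qed

definition Cl :: "nat set \<Rightarrow> cliff set" where
  "Cl A = {a. \<forall>S. bcoeff a S \<noteq> 0 \<longrightarrow> S \<subseteq> A}"

definition cvec :: "nat set \<Rightarrow> (nat \<Rightarrow> complex) \<Rightarrow> cliff" where
  "cvec A x = (\<Sum>j\<in>A. scalar (x j) * evec j)"

definition cliff_inv :: "cliff \<Rightarrow> cliff" where
  "cliff_inv a = (THE b. a * b = 1 \<and> b * a = 1)"

definition unit_vectors :: "nat set \<Rightarrow> cliff set" where
  "unit_vectors A = {cvec A (\<lambda>j. complex_of_real (x j)) |x. (\<Sum>j\<in>A. (x j)\<^sup>2) = 1}"

definition Spin :: "nat set \<Rightarrow> cliff set" where
  "Spin A = {prod_list ws |ws. even (length ws) \<and> set ws \<subseteq> unit_vectors A}"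


section \<open>Clifford-valued polynomials\<close>

text \<open>
  Polynomials in commuting variables \<open>X\<^sub>j\<close> with Clifford coefficients; a monomial is a finitely
  supported exponent function. The variables commute with the coefficients. The variables
  \<open>X\<^sub>j\<close> with \<open>j \<in> A\<close> are the coordinates on the Euclidean space with basis \<open>evec j\<close>, \<open>j \<in> A\<close>; as the
  reals are infinite, these formal polynomials are the same as polynomial functions, with values
  given by \<open>peval\<close>.
\<close>

type_synonym cpoly = "(nat \<Rightarrow>\<^sub>0 nat) \<Rightarrow>\<^sub>0 cliff"

abbreviation Const :: "cliff \<Rightarrow> cpoly" where
  "Const a \<equiv> Poly_Mapping.single 0 a"

definition Var :: "nat \<Rightarrow> cpoly" where
  "Var j = Poly_Mapping.single (Poly_Mapping.single j 1) 1"

definition peval :: "cpoly \<Rightarrow> (nat \<Rightarrow> complex) \<Rightarrow> cliff" where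
  "peval P x = (\<Sum>\<alpha>\<in>Poly_Mapping.keys P.
     Poly_Mapping.lookup P \<alpha> *
     scalar (\<Prod>j\<in>Poly_Mapping.keys \<alpha>. x j ^ Poly_Mapping.lookup \<alpha> j))"

definition pscale :: "complex \<Rightarrow> cpoly \<Rightarrow> cpoly" where
  "pscale c P = Const (scalar c) * P"

global_interpretation cpoly: vector_space pscale
  by unfold_locales
    (simp_all add: pscale_def distrib_left distrib_right scalar_add single_add scalar_mult
      mult_single mult.assoc[symmetric])

definition mdegree :: "(nat \<Rightarrow>\<^sub>0 nat) \<Rightarrow> nat" where
  "mdegree \<alpha> = (\<Sum>j\<in>Poly_Mapping.keys \<alpha>. Poly_Mapping.lookup \<alpha> j)"

definition polys :: "nat set \<Rightarrow> cpoly set" where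
  "polys A = {P. \<forall>\<alpha>\<in>Poly_Mapping.keys P.
     Poly_Mapping.keys \<alpha> \<subseteq> A \<and> Poly_Mapping.lookup P \<alpha> \<in> Cl A}"

definition homogeneous :: "nat \<Rightarrow> cpoly \<Rightarrow> bool" where
  "homogeneous k P \<longleftrightarrow> (\<forall>\<alpha>\<in>Poly_Mapping.keys P. mdegree \<alpha> = k)"

text \<open>Monomials not containing \<open>X\<^sub>j\<close> contribute the coefficient \<open>0\<close> here.\<close>

definition pdiff :: "nat \<Rightarrow> cpoly \<Rightarrow> cpoly" where
  "pdiff j P = (\<Sum>\<alpha>\<in>Poly_Mapping.keys P.
     Poly_Mapping.single (\<alpha> - Poly_Mapping.single j 1)
       (of_nat (Poly_Mapping.lookup \<alpha> j) * Poly_Mapping.lookup P \<alpha>))"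

definition dirac :: "nat set \<Rightarrow> cpoly \<Rightarrow> cpoly" where
  "dirac A P = (\<Sum>j\<in>A. Const (evec j) * pdiff j P)"

definition monogenics :: "nat set \<Rightarrow> cpoly set" where
  "monogenics A = {P \<in> polys A. dirac A P = 0}"

definition monogenics_deg :: "nat set \<Rightarrow> nat \<Rightarrow> cpoly set" where
  "monogenics_deg A k = {P \<in> monogenics A. homogeneous k P}"

text \<open>The vector variable, that is, the polynomial \<open>x \<mapsto> x\<close> with values in the Clifford algebra.\<close>

definition vecvar :: "nat set \<Rightarrow> cpoly" where
  "vecvar A = (\<Sum>j\<in>A. Const (evec j) * Var j)"

text \<open>The component \<open>M\<^sub>0\<close> of \<open>P\<close> in its Fischer decomposition \<open>P = \<Sum>\<^sub>s x\<^sup>s M\<^sub>s\<close>.\<close>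

definition P_M :: "nat set \<Rightarrow> cpoly \<Rightarrow> cpoly" where
  "P_M A P = (THE M0. \<exists>M. (\<forall>s. M s \<in> monogenics A) \<and> finite {s. M s \<noteq> 0} \<and>
     P = (\<Sum>s | M s \<noteq> 0. vecvar A ^ s * M s) \<and> M0 = M 0)"


section \<open>Tensor products of spaces of polynomials\<close>

text \<open>
  The tensor product over the complex numbers, as the free vector space on pairs modulo the span
  of the bilinearity relations.
\<close>

type_synonym ctensor_free = "(cpoly \<times> cpoly) \<Rightarrow>\<^sub>0 complex"

definition fscale :: "complex \<Rightarrow> ctensor_free \<Rightarrow> ctensor_free" where
  "fscale c t = Poly_Mapping.map ((*) c) t"

lemma lookup_fscale [simp]: "Poly_Mapping.lookup (fscale c t) x = c * Poly_Mapping.lookup t x"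
  unfolding fscale_def by transfer (simp add: when_def)

global_interpretation ctensor_free: vector_space fscale
  by unfold_locales (auto intro!: poly_mapping_eqI simp: lookup_add algebra_simps)

abbreviation free_pair :: "cpoly \<Rightarrow> cpoly \<Rightarrow> ctensor_free" where
  "free_pair K G \<equiv> Poly_Mapping.single (K, G) 1"

definition bilinear_relations :: "ctensor_free set" where
  "bilinear_relations =
     {free_pair (K + K') G - free_pair K G - free_pair K' G |K K' G. True} \<union>
     {free_pair K (G + G') - free_pair K G - free_pair K G' |K G G'. True} \<union>
     {free_pair (pscale c K) G - fscale c (free_pair K G) |c K G. True} \<union>
     {free_pair K (pscale c G) - fscale c (free_pair K G) |c K G. True}"

definition tensor_eq :: "ctensor_free \<Rightarrow> ctensor_free \<Rightarrow> bool" where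
  "tensor_eq t t' \<longleftrightarrow> t - t' \<in> ctensor_free.span bilinear_relations"

quotient_type ctensor = ctensor_free / tensor_eq
proof (rule equivpI)
  show "reflp tensor_eq"
    by (simp add: reflp_def tensor_eq_def ctensor_free.span_zero)
  show "symp tensor_eq"
    unfolding symp_def tensor_eq_def using ctensor_free.span_neg by fastforce
  show "transp tensor_eq"
    unfolding transp_def tensor_eq_def
  proof (intro allI impI)
    fix x y z
    assume "x - y \<in> ctensor_free.span bilinear_relations" "y - z \<in> ctensor_free.span bilinear_relations"
    from ctensor_free.span_add[OF this] show "x - z \<in> ctensor_free.span bilinear_relations" by simp
  qed
qed

text \<open>The tensor product of two subspaces, inside the tensor product of the whole spaces.\<close>

definition tensor_prod :: "cpoly set \<Rightarrow> cpoly set \<Rightarrow> ctensor set" (infixr "\<otimes>\<^sub>C" 70) where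
  "U \<otimes>\<^sub>C V = abs_ctensor ` {t. Poly_Mapping.keys t \<subseteq> U \<times> V}"

definition free_mult :: "ctensor_free \<Rightarrow> cpoly" where
  "free_mult t = (\<Sum>(K, G)\<in>Poly_Mapping.keys t. pscale (Poly_Mapping.lookup t (K, G)) (K * G))"

lemma free_mult_superset:
  assumes "finite F" "Poly_Mapping.keys t \<subseteq> F"
  shows "free_mult t = (\<Sum>(K, G)\<in>F. pscale (Poly_Mapping.lookup t (K, G)) (K * G))"
  unfolding free_mult_def using assms
  by (intro sum.mono_neutral_left) (auto simp: in_keys_iff)

lemma free_mult_add: "free_mult (t + t') = free_mult t + free_mult t'"
proof -
  let ?F = "Poly_Mapping.keys t \<union> Poly_Mapping.keys t'"
  have "Poly_Mapping.keys (t + t') \<subseteq> ?F" by (rule keys_add)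
  then show ?thesis
    by (simp add: free_mult_superset[of ?F] lookup_add cpoly.scale_left_distrib
        sum.distrib case_prod_unfold)
qed

lemma free_mult_fscale: "free_mult (fscale c t) = pscale c (free_mult t)"
proof -
  have "Poly_Mapping.keys (fscale c t) \<subseteq> Poly_Mapping.keys t" by (auto simp: in_keys_iff)
  then show ?thesis
    by (simp add: free_mult_superset[of "Poly_Mapping.keys t"] cpoly.scale_sum_right
        case_prod_unfold)
qed

lemma free_mult_pair: "free_mult (free_pair K G) = K * G"
  by (simp add: free_mult_def)

lemma free_mult_diff: "free_mult (t - t') = free_mult t - free_mult t'"
  using free_mult_add[of "t - t'" t'] by simp

lemma pscale_mult_left: "pscale c K * G = pscale c (K * G)"
  by (simp add: pscale_def mult.assoc)

lemma poly_mapping_add_induct [case_names zero single_plus]: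
  fixes P :: "'a \<Rightarrow>\<^sub>0 'b::comm_monoid_add"
  assumes "Q 0" "\<And>\<alpha> a P. Q P \<Longrightarrow> Q (P + Poly_Mapping.single \<alpha> a)"
  shows "Q P"
proof (induction P rule: update_induct)
  case const
  show ?case by (rule assms(1))
next
  case (update f a b)
  have "Poly_Mapping.update a b f = f + Poly_Mapping.single a b"
    using update by (intro poly_mapping_eqI)
      (auto simp: lookup_update lookup_add lookup_single in_keys_iff when_def)
  then show ?case using assms(2) update by simp
qed

lemma Const_scalar_commute: "P * Const (scalar c) = Const (scalar c) * (P :: cpoly)"
  by (induction P rule: poly_mapping_add_induct)
    (simp_all add: distrib_left distrib_right mult_single scalar_commute)

lemma pscale_mult_right: "K * pscale c G = pscale c (K * G)"
  by (simp add: pscale_def mult.assoc[symmetric] Const_scalar_commute)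

lift_definition tensor_mult :: "ctensor \<Rightarrow> cpoly" is free_mult
proof -
  fix t t' assume "tensor_eq t t'"
  then have "t - t' \<in> ctensor_free.span bilinear_relations" by (simp add: tensor_eq_def)
  then have "free_mult (t - t') = 0"
  proof (induction rule: ctensor_free.span_induct_alt)
    case base
    show ?case by (simp add: free_mult_def)
  next
    case (step c x y)
    then have "free_mult x = 0"
      by (auto simp: bilinear_relations_def free_mult_diff free_mult_pair free_mult_fscale
          distrib_left distrib_right pscale_mult_left pscale_mult_right)
    with step show ?case by (simp add: free_mult_add free_mult_fscale)
  qed
  then show "free_mult t = free_mult t'" by (simp add: free_mult_diff)
qed

text \<open>Thus \<open>tensor_mult\<close> is the linear map with \<open>K \<otimes> G \<mapsto> K G\<close>, and \<open>tau_M\<close> maps \<open>K \<otimes> G\<close> to \<open>P_M (K G)\<close>.\<close>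

definition tau_M :: "nat set \<Rightarrow> ctensor \<Rightarrow> cpoly" where
  "tau_M A t = P_M A (tensor_mult t)"


section \<open>The action of the spin group\<close>

text \<open>
  Substitution of polynomials for the variables. It is only used for scalar-valued \<open>y j\<close>, which
  commute, so that the order of the factors does not matter.
\<close>

definition psubst :: "(nat \<Rightarrow> cpoly) \<Rightarrow> cpoly \<Rightarrow> cpoly" where
  "psubst y P = (\<Sum>\<alpha>\<in>Poly_Mapping.keys P. Const (Poly_Mapping.lookup P \<alpha>) *
     prod_list (map (\<lambda>j. y j ^ Poly_Mapping.lookup \<alpha> j)
       (sorted_list_of_set (Poly_Mapping.keys \<alpha>))))"

text \<open>
  \<open>L(s)P(x) = s P(s\<^sup>-\<^sup>1 x s)\<close> on the space with coordinates indexed by \<open>A\<close>: the coordinate \<open>x\<^sub>j\<close> is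
  replaced by the coefficient of \<open>evec j\<close> in \<open>s\<^sup>-\<^sup>1 x s = \<Sum>\<^sub>k x\<^sub>k s\<^sup>-\<^sup>1 e\<^sub>k s\<close> (see \<open>peval_L_act\<close>).
\<close>

definition L_act :: "nat set \<Rightarrow> cliff \<Rightarrow> cpoly \<Rightarrow> cpoly" where
  "L_act A s P = Const s *
     psubst (\<lambda>j. \<Sum>k\<in>A. pscale (bcoeff (cliff_inv s * evec k * s) {j}) (Var k)) P"

lemma peval_superset:
  assumes "finite F" "Poly_Mapping.keys P \<subseteq> F"
  shows "peval P x = (\<Sum>\<alpha>\<in>F. Poly_Mapping.lookup P \<alpha> *
     scalar (\<Prod>j\<in>Poly_Mapping.keys \<alpha>. x j ^ Poly_Mapping.lookup \<alpha> j))"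
  unfolding peval_def using assms by (intro sum.mono_neutral_left) (auto simp: in_keys_iff)

lemma peval_0 [simp]: "peval 0 x = 0"
  by (simp add: peval_def)

lemma peval_add: "peval (P + Q) x = peval P x + peval Q x"
proof -
  let ?F = "Poly_Mapping.keys P \<union> Poly_Mapping.keys Q"
  have "Poly_Mapping.keys (P + Q) \<subseteq> ?F" by (rule keys_add)
  then show ?thesis
    by (simp add: peval_superset[of ?F] lookup_add distrib_right sum.distrib)
qed

lemma peval_sum: "peval (\<Sum>i\<in>I. f i) x = (\<Sum>i\<in>I. peval (f i) x)"
  by (induction I rule: infinite_finite_induct) (simp_all add: peval_add)

lemma peval_single:
  "peval (Poly_Mapping.single \<alpha> a) x =
     a * scalar (\<Prod>j\<in>Poly_Mapping.keys \<alpha>. x j ^ Poly_Mapping.lookup \<alpha> j)"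
  by (subst peval_superset[of "{\<alpha>}"]) auto

lemma peval_Const [simp]: "peval (Const a) x = a"
  by (simp add: peval_single)

lemma peval_1 [simp]: "peval 1 x = 1"
  using peval_Const[of 1 x] by simp

lemma peval_Var [simp]: "peval (Var j) x = scalar (x j)"
  by (simp add: Var_def peval_single)

lemma monomial_value_add:
  "(\<Prod>j\<in>Poly_Mapping.keys (\<alpha> + \<beta>). x j ^ Poly_Mapping.lookup (\<alpha> + \<beta>) j) =
   (\<Prod>j\<in>Poly_Mapping.keys \<alpha>. x j ^ Poly_Mapping.lookup \<alpha> j) *
   (\<Prod>j\<in>Poly_Mapping.keys \<beta>. (x j :: complex) ^ Poly_Mapping.lookup \<beta> j)"
proof -
  let ?F = "Poly_Mapping.keys \<alpha> \<union> Poly_Mapping.keys \<beta>"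
  have *: "(\<Prod>j\<in>Poly_Mapping.keys \<gamma>. x j ^ Poly_Mapping.lookup \<gamma> j) =
      (\<Prod>j\<in>?F. x j ^ Poly_Mapping.lookup \<gamma> j)" if "Poly_Mapping.keys \<gamma> \<subseteq> ?F" for \<gamma>
    using that by (intro prod.mono_neutral_left) (auto simp: in_keys_iff)
  show ?thesis
    by (subst *[OF keys_add]) (simp add: *[of \<alpha>] *[of \<beta>] lookup_add power_add prod.distrib)
qed

lemma peval_mult: "peval (P * Q) x = peval P x * peval Q x"
proof (induction P rule: poly_mapping_add_induct)
  case zero
  show ?case by simp
next
  case (single_plus \<alpha> a P)
  have "peval (Poly_Mapping.single \<alpha> a * Q) x = peval (Poly_Mapping.single \<alpha> a) x * peval Q x"
  proof (induction Q rule: poly_mapping_add_induct)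
    case zero
    show ?case by simp
  next
    case (single_plus \<beta> b Q)
    have "a * b * (scalar c * scalar d) = a * scalar c * (b * scalar d)" for c d
      by (metis scalar_commute mult.assoc)
    then show ?case
      using single_plus
      by (simp add: distrib_left peval_add mult_single peval_single monomial_value_add scalar_mult)
  qed
  with single_plus show ?case by (simp add: distrib_right peval_add)
qed

lemma peval_pscale: "peval (pscale c P) x = scalar c * peval P x"
  by (simp add: pscale_def peval_mult)

lemma peval_power: "peval (P ^ n) x = peval P x ^ n"
  by (induction n) (simp_all add: peval_mult)

lemma scalar_power: "scalar (c ^ n) = scalar c ^ n"
  by (induction n) (simp_all add: scalar_mult)

lemma scalar_sum: "scalar (\<Sum>i\<in>I. f i) = (\<Sum>i\<in>I. scalar (f i))"
  by (induction I rule: infinite_finite_induct) (simp_all add: scalar_add)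

lemma bcoeff_sum: "bcoeff (\<Sum>i\<in>I. f i) S = (\<Sum>i\<in>I. bcoeff (f i) S)"
  by (induction I rule: infinite_finite_induct) (simp_all add: zero_cliff.rep_eq plus_cliff.rep_eq)

lemma peval_prod_list: "peval (prod_list Ps) x = prod_list (map (\<lambda>P. peval P x) Ps)"
  by (induction Ps) (simp_all add: peval_mult)

lemma scalar_prod_list: "scalar (prod_list cs) = prod_list (map scalar cs)"
  by (induction cs) (simp_all add: scalar_mult)

lemma peval_psubst:
  assumes "\<And>j. peval (y j) x = scalar (z j)"
  shows "peval (psubst y P) x = peval P z"
proof -
  have "prod_list (map (\<lambda>j. scalar (z j) ^ Poly_Mapping.lookup \<alpha> j)
       (sorted_list_of_set (Poly_Mapping.keys \<alpha>))) =
     scalar (\<Prod>j\<in>Poly_Mapping.keys \<alpha>. z j ^ Poly_Mapping.lookup \<alpha> j)" for \<alpha>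
  proof -
    have "(\<Prod>j\<in>Poly_Mapping.keys \<alpha>. z j ^ Poly_Mapping.lookup \<alpha> j) =
      prod_list (map (\<lambda>j. z j ^ Poly_Mapping.lookup \<alpha> j)
        (sorted_list_of_set (Poly_Mapping.keys \<alpha>)))"
      using prod.distinct_set_conv_list[of "sorted_list_of_set (Poly_Mapping.keys \<alpha>)"
          "\<lambda>j. z j ^ Poly_Mapping.lookup \<alpha> j"] by simp
    then show ?thesis by (simp add: scalar_prod_list scalar_power o_def)
  qed
  then show ?thesis
    by (simp add: psubst_def peval_sum peval_mult peval_prod_list peval_power assms o_def
        peval_def[of P])
qed

lemma peval_vecvar: "peval (vecvar A) x = cvec A x"
  by (simp add: vecvar_def cvec_def peval_sum peval_mult scalar_commute)

lemma peval_L_act: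
  "peval (L_act A s P) x =
     s * peval P (\<lambda>j. bcoeff (cliff_inv s * cvec A x * s) {j})"
proof -
  have "peval (\<Sum>k\<in>A. pscale (bcoeff (cliff_inv s * evec k * s) {j}) (Var k)) x =
      scalar (bcoeff (cliff_inv s * cvec A x * s) {j})" for j
  proof -
    have "cliff_inv s * cvec A x * s = (\<Sum>k\<in>A. scalar (x k) * (cliff_inv s * evec k * s))"
      unfolding cvec_def sum_distrib_left sum_distrib_right
      by (intro sum.cong refl) (metis scalar_commute mult.assoc)
    then show ?thesis
      by (simp add: peval_sum peval_pscale bcoeff_sum scalar_times_bcoeff scalar_sum
          scalar_mult[symmetric] mult.commute)
  qed
  then show ?thesis
    unfolding L_act_def by (simp add: peval_mult peval_psubst)
qed


section \<open>The decomposition\<close>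

definition direct_sum :: "cpoly set \<Rightarrow> 'i set \<Rightarrow> ('i \<Rightarrow> cpoly set) \<Rightarrow> bool" where
  "direct_sum V I W \<longleftrightarrow>
     finite I \<and> cpoly.subspace V \<and> (\<forall>i\<in>I. cpoly.subspace (W i) \<and> W i \<subseteq> V) \<and>
     (\<forall>P\<in>V. \<exists>!w. w \<in> Pi\<^sub>E I W \<and> P = (\<Sum>i\<in>I. w i))"

definition tau_summand :: "nat \<Rightarrow> nat \<Rightarrow> nat \<times> nat \<times> nat \<Rightarrow> cpoly set" where
  "tau_summand p q = (\<lambda>(s, k, i). tau_M {1..p + q} `
     ((\<lambda>K. vecvar {1..p} ^ s * K) ` monogenics_deg {1..p} k
        \<otimes>\<^sub>C monogenics_deg {p + 1..p + q} i))"

end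

theory Submission
  imports Defs
begin

text \<open>
  Write \<open>D\<close> and \<open>x\<close> for the Dirac operator and the vector variable of the whole space, \<open>u\<close>, \<open>v\<close> for
  those of the two factors. Replacing \<open>v\<close> by \<open>x - u\<close> in the Fischer decomposition of the \<open>v\<close>-part shows
  that every polynomial is, modulo multiples of \<open>x\<close>, a combination of products \<open>u\<^sup>s K(u) G(v)\<close> with
  monogenic \<open>K\<close>, \<open>G\<close>. As \<open>P_M\<close> kills multiples of \<open>x\<close> and fixes monogenic polynomials, the summands
  exhaust the monogenic polynomials. Conversely a combination of such products in the kernel of
  \<open>P_M\<close> is some \<open>x Q\<close>, and it is annihilated by \<open>D\<^sub>v\<close>; the part of \<open>x Q\<close> of top degree in \<open>v\<close> comes
  from \<open>v Q\<close> alone, and \<open>D\<^sub>v v\<close> is injective, so \<open>Q = 0\<close>. Finally, elements of the spin group act by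
  operators commuting with \<open>x\<close> and \<open>D\<close>, hence with \<open>P_M\<close>, and an element of \<open>Spin(p)\<close> and
  one of \<open>Spin(q)\<close> act separately on the two factors of a product \<open>K(u) G(v)\<close>.
\<close>

section \<open>Subalgebras of the Clifford algebra\<close>

text \<open>The Fischer decomposition rests on one relation: on polynomials of degree
  \<open>k\<close> in the variables from \<open>V\<close>, \<open>D v + v D\<close> is the scalar
  \<open>- (2 k + card V)\<close>. Splitting off a monogenic part thus means solving
  \<open>D (v Q) = D P\<close>, which is done by induction on the degree. The same relation makes
  \<open>Q \<mapsto> D (v Q)\<close> injective, even if further variables are present; this gives
  the uniqueness behind \<open>P_M\<close>, the independence of the powers of \<open>u\<close> and
  the injectivity of \<open>P_M\<close> on the products. That the products are independent before
  \<open>P_M\<close> is applied is a separate point: \<open>s\<close> is recovered from the power of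
  \<open>u\<close>, \<open>i\<close> from the degree in \<open>v\<close>, and \<open>k\<close> is
  then \<open>n - s - i\<close>. Noncommutativity enters twice. Moving \<open>v\<close> or
  \<open>D_v\<close> past \<open>K(u)\<close> changes \<open>K\<close> by signs only, in the same
  way for every generator of the other block, so degrees survive. And \<open>L(a b)\<close> splits
  because an even product of vectors of one block commutes with the generators of the other.\<close>

lemma Cl_0 [simp]: "0 \<in> Cl A"
  by (simp add: Cl_def zero_cliff.rep_eq)

lemma Cl_blade: "S \<subseteq> A \<Longrightarrow> blade S \<in> Cl A"
  by (auto simp: Cl_def blade.rep_eq split: if_splits)

lemma Cl_scalar [simp]: "scalar c \<in> Cl A"
  by (auto simp: Cl_def scalar.rep_eq split: if_splits)

lemma Cl_1 [simp]: "1 \<in> Cl A"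
  using Cl_scalar[of 1 A] by simp

lemma Cl_add: "a \<in> Cl A \<Longrightarrow> b \<in> Cl A \<Longrightarrow> a + b \<in> Cl A"
  unfolding Cl_def by (auto simp: plus_cliff.rep_eq) (metis add_0 subsetD)

lemma Cl_mult:
  assumes "a \<in> Cl A" "b \<in> Cl A"
  shows "a * b \<in> Cl A"
  unfolding Cl_def
proof (intro CollectI allI impI)
  fix R
  assume "bcoeff (a * b) R \<noteq> 0"
  then have nz: "(\<Sum>S | bcoeff a S \<noteq> 0. bsign S (sym_diff S R) * bcoeff a S * bcoeff b (sym_diff S R)) \<noteq> 0"
    by (simp add: times_cliff.rep_eq)
  obtain S where "bcoeff a S \<noteq> 0" "bcoeff b (sym_diff S R) \<noteq> 0"
    using sum.not_neutral_contains_not_neutral[OF nz] by auto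
  then have "S \<subseteq> A" "sym_diff S R \<subseteq> A"
    using assms by (auto simp: Cl_def)
  then show "R \<subseteq> A" by blast
qed

lemma Cl_sum: "(\<And>i. i \<in> I \<Longrightarrow> f i \<in> Cl A) \<Longrightarrow> sum f I \<in> Cl A"
  by (induction I rule: infinite_finite_induct) (auto intro: Cl_add)

lemma Cl_mono: "A \<subseteq> B \<Longrightarrow> Cl A \<subseteq> Cl B"
  by (auto simp: Cl_def)

lemma scalar_of_nat: "scalar (of_nat n) = of_nat n"
  by (induction n) (simp_all add: scalar_add)

lemma cliff_eq_sum_blades: "a = (\<Sum>S | bcoeff a S \<noteq> 0. scalar (bcoeff a S) * blade S)"
proof (rule cliff_eqI)
  fix R
  have "bcoeff (\<Sum>S | bcoeff a S \<noteq> 0. scalar (bcoeff a S) * blade S) R =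
      (\<Sum>S | bcoeff a S \<noteq> 0. if S = R then bcoeff a S else 0)"
    unfolding bcoeff_sum scalar_times_bcoeff blade.rep_eq
    by (intro sum.cong refl) (auto dest: bcoeff_nz_finite)
  also have "\<dots> = bcoeff a R"
    using finite_bcoeff[of a] by auto
  finally show "bcoeff a R = bcoeff (\<Sum>S | bcoeff a S \<noteq> 0. scalar (bcoeff a S) * blade S) R" ..
qed

lemma Cl_induct [consumes 1, case_names blade add]:
  assumes "a \<in> Cl A"
    and "\<And>c S. finite S \<Longrightarrow> S \<subseteq> A \<Longrightarrow> Q (scalar c * blade S)"
    and "\<And>a b. a \<in> Cl A \<Longrightarrow> b \<in> Cl A \<Longrightarrow> Q a \<Longrightarrow> Q b \<Longrightarrow> Q (a + b)"
  shows "Q a"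
proof -
  have S: "finite S \<and> S \<subseteq> A" if "bcoeff a S \<noteq> 0" for S
    using assms(1) that by (auto simp: Cl_def dest: bcoeff_nz_finite)
  have "F \<subseteq> {S. bcoeff a S \<noteq> 0} \<Longrightarrow> Q (\<Sum>S\<in>F. scalar (bcoeff a S) * blade S)"
    if "finite F" for F
    using that
  proof (induction F)
    case empty
    show ?case using assms(2)[of "{}" 0] by simp
  next
    case (insert R F)
    then have "Q (scalar (bcoeff a R) * blade R)"
      using assms(2) S by blast
    moreover have "(\<Sum>S\<in>F. scalar (bcoeff a S) * blade S) \<in> Cl A" "scalar (bcoeff a R) * blade R \<in> Cl A"
      using insert.prems S by (auto intro!: Cl_sum Cl_mult Cl_blade)
    ultimately show ?case
      using insert by (auto intro!: assms(3))
  qed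
  from this[of "{S. bcoeff a S \<noteq> 0}"] show ?thesis
    using cliff_eq_sum_blades[of a] by (simp add: finite_bcoeff)
qed

text \<open>One sign for each generator that \<open>evec j\<close> passes. In terms of
  \<open>bsign\<close>, one order counts the elements of \<open>S\<close> below \<open>j\<close> and
  the other those above \<open>j\<close>; as \<open>j\<close> is not in \<open>S\<close>, the two
  counts add up to \<open>card S\<close>.\<close>

lemma blade_commute_evec:
  assumes "finite S" "j \<notin> S"
  shows "evec j * blade S = scalar ((-1) ^ card S) * (blade S * evec j)"
proof -
  have 1: "{(i, k). i \<in> {j} \<and> k \<in> S \<and> k \<le> i} = Pair j ` {k \<in> S. k < j}"
    using assms(2) by (auto simp: le_less)
  have 2: "{(i, k). i \<in> S \<and> k \<in> {j} \<and> k \<le> i} = (\<lambda>i. (i, j)) ` {k \<in> S. j < k}"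
    using assms(2) by (auto simp: le_less)
  have c1: "bsign {j} S = (-1) ^ card {k \<in> S. k < j}"
    unfolding bsign_def 1 by (subst card_image) (auto simp: inj_on_def)
  have c2: "bsign S {j} = (-1) ^ card {k \<in> S. j < k}"
    unfolding bsign_def 2 by (subst card_image) (auto simp: inj_on_def)
  have "k < j \<or> j < k" if "k \<in> S" for k
    using assms(2) that by (metis nat_neq_iff)
  then have "S = {k \<in> S. k < j} \<union> {k \<in> S. j < k}" by auto
  then have "card S = card ({k \<in> S. k < j} \<union> {k \<in> S. j < k})" by simp
  also have "\<dots> = card {k \<in> S. k < j} + card {k \<in> S. j < k}"
    using assms(1) by (intro card_Un_disjoint) auto
  finally have "bsign {j} S = (-1) ^ card S * bsign S {j}"
    by (simp add: c1 c2 power_add flip: power_mult_distrib)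
  moreover have "sym_diff {j} S = sym_diff S {j}" by auto
  ultimately show ?thesis
    using assms(1) by (simp only: blade_mult finite.intros scalar_mult mult.assoc)
qed

lemma evec_square: "evec i * evec i = - 1"
proof -
  have "{(a, b). a \<in> {i} \<and> b \<in> {i} \<and> b \<le> a} = {(i, i)}" by auto
  then have "bsign {i} {i} = - 1" by (simp add: bsign_def)
  then show ?thesis by (simp add: blade_mult blade_empty scalar_uminus)
qed

lemma Const_sum: "(\<Sum>i\<in>I. Const (f i)) = Const (sum f I)"
  by (induction I rule: infinite_finite_induct) (simp_all add: single_add)

lemma Const_times: "Const a * Const b = Const (a * b)"
  by (simp add: mult_single)

lemma Const_evec_square: "Const (evec j) * Const (evec j) = - 1"
  by (simp add: mult_single evec_square) (metis single_one single_uminus)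

text \<open>On a blade, passing to \<open>a'\<close> is the grade involution, a sign depending only
  on the size of the blade. Hence one \<open>a'\<close> serves all \<open>j\<close> outside
  \<open>A\<close> and can be pulled out of sums over \<open>j\<close>.\<close>

lemma Cl_commute_evec:
  assumes "a \<in> Cl A"
  shows "\<exists>a'\<in>Cl A. \<forall>j. j \<notin> A \<longrightarrow> evec j * a = a' * evec j"
  using assms
proof (induction rule: Cl_induct)
  case (blade c S)
  have "evec j * (scalar c * blade S) = scalar (c * (-1) ^ card S) * blade S * evec j"
    if "j \<notin> A" for j
  proof -
    have "j \<notin> S" using that blade by auto
    have "evec j * (scalar c * blade S) = scalar c * (evec j * blade S)"
      by (metis scalar_commute mult.assoc)
    also have "\<dots> = scalar (c * (-1) ^ card S) * blade S * evec j"
      using blade_commute_evec[OF blade(1) \<open>j \<notin> S\<close>] by (simp add: mult.assoc scalar_mult)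
    finally show ?thesis .
  qed
  then show ?case
    using blade by (intro bexI[of _ "scalar (c * (-1) ^ card S) * blade S"]) (auto intro: Cl_mult Cl_blade)
next
  case (add a b)
  then obtain a' b' where "a' \<in> Cl A" "b' \<in> Cl A"
    "\<And>j. j \<notin> A \<Longrightarrow> evec j * a = a' * evec j" "\<And>j. j \<notin> A \<Longrightarrow> evec j * b = b' * evec j"
    by metis
  then show ?case
    by (intro bexI[of _ "a' + b'"]) (auto intro: Cl_add simp: distrib_left distrib_right)
qed

lemma commute_Cl:
  assumes "a \<in> Cl A" and "\<And>j. j \<in> A \<Longrightarrow> b * evec j = evec j * b"
  shows "b * a = a * b"
  using assms(1)
proof (induction rule: Cl_induct)
  case (blade c S)
  \<comment> \<open>Adding generators in increasing order makes each larger blade a product without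
    a sign.\<close>
  have "b * blade S = blade S * b"
    using blade(1,2)
  proof (induction S rule: finite_linorder_max_induct)
    case empty
    show ?case by (simp add: blade_empty)
  next
    case (insert j S)
    then have "blade (insert j S) = blade S * evec j"
      by (intro blade_insert_greater) auto
    then show ?case
      using insert assms(2)[of j] by (metis insert_subset mult.assoc)
  qed
  then show ?case by (metis mult.assoc scalar_commute)
qed (simp add: distrib_left distrib_right)

text \<open>This is why products of elements of the two subalgebras span the whole algebra:
  reordering the generators costs an invertible sign, which \<open>c\<close> absorbs.\<close>

lemma blade_split:
  assumes "finite S" "S \<subseteq> U \<union> V" "U \<inter> V = {}"
  shows "\<exists>c. blade S = scalar c * (blade (S \<inter> U) * blade (S \<inter> V))"
proof -
  have "sym_diff (S \<inter> U) (S \<inter> V) = S" using assms by auto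
  then have "blade (S \<inter> U) * blade (S \<inter> V) = scalar (bsign (S \<inter> U) (S \<inter> V)) * blade S"
    using assms by (simp add: blade_mult)
  then have "scalar (1 / bsign (S \<inter> U) (S \<inter> V)) * (blade (S \<inter> U) * blade (S \<inter> V)) = blade S"
    by (simp flip: mult.assoc scalar_mult) (simp add: bsign_def)
  then show ?thesis by metis
qed

section \<open>Clifford-valued polynomials on a coordinate subspace\<close>

lemma poly_mapping_eq_sum_single:
  "P = (\<Sum>\<alpha>\<in>Poly_Mapping.keys P. Poly_Mapping.single \<alpha> (Poly_Mapping.lookup P \<alpha>))"
proof (rule poly_mapping_eqI)
  fix \<beta>
  show "Poly_Mapping.lookup P \<beta> = Poly_Mapping.lookup
      (\<Sum>\<alpha>\<in>Poly_Mapping.keys P. Poly_Mapping.single \<alpha> (Poly_Mapping.lookup P \<alpha>)) \<beta>"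
    by (simp add: lookup_sum lookup_single when_def in_keys_iff)
qed

lemma polys_iff:
  "P \<in> polys A \<longleftrightarrow> (\<forall>\<alpha>. Poly_Mapping.lookup P \<alpha> \<in> Cl A \<and>
     (Poly_Mapping.lookup P \<alpha> \<noteq> 0 \<longrightarrow> Poly_Mapping.keys \<alpha> \<subseteq> A))"
  unfolding polys_def by (auto simp: in_keys_iff)

lemma polys_0 [simp]: "0 \<in> polys A"
  by (simp add: polys_iff)

lemma polys_add: "P \<in> polys A \<Longrightarrow> Q \<in> polys A \<Longrightarrow> P + Q \<in> polys A"
  unfolding polys_iff lookup_add by (metis Cl_add add_0)

lemma polys_sum: "(\<And>i. i \<in> I \<Longrightarrow> f i \<in> polys A) \<Longrightarrow> sum f I \<in> polys A"
  by (induction I rule: infinite_finite_induct) (auto intro: polys_add)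

lemma polys_single: "Poly_Mapping.keys \<alpha> \<subseteq> A \<Longrightarrow> a \<in> Cl A \<Longrightarrow> Poly_Mapping.single \<alpha> a \<in> polys A"
  by (auto simp: polys_def)

lemma polys_Const: "a \<in> Cl A \<Longrightarrow> Const a \<in> polys A"
  by (rule polys_single) auto

lemma polys_Var: "j \<in> A \<Longrightarrow> Var j \<in> polys A"
  by (auto simp: Var_def intro: polys_single)

lemma polys_1 [simp]: "1 \<in> polys A"
  using polys_Const[of 1 A] by simp

lemma polys_mono: "A \<subseteq> B \<Longrightarrow> polys A \<subseteq> polys B"
  using Cl_mono unfolding polys_def by blast

lemma polys_induct [consumes 1, case_names single add]:
  assumes "P \<in> polys A"
    and "\<And>\<alpha> a. Poly_Mapping.keys \<alpha> \<subseteq> A \<Longrightarrow> a \<in> Cl A \<Longrightarrow> Q (Poly_Mapping.single \<alpha> a)"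
    and "\<And>P P'. P \<in> polys A \<Longrightarrow> P' \<in> polys A \<Longrightarrow> Q P \<Longrightarrow> Q P' \<Longrightarrow> Q (P + P')"
  shows "Q P"
proof -
  have "F \<subseteq> Poly_Mapping.keys P \<Longrightarrow>
      Q (\<Sum>\<alpha>\<in>F. Poly_Mapping.single \<alpha> (Poly_Mapping.lookup P \<alpha>))" if "finite F" for F
    using that
  proof (induction F)
    case empty
    show ?case using assms(2)[of 0 0] by simp
  next
    case (insert \<beta> F)
    have s: "Poly_Mapping.keys \<alpha> \<subseteq> A" "Poly_Mapping.lookup P \<alpha> \<in> Cl A" if "\<alpha> \<in> insert \<beta> F" for \<alpha>
      using assms(1) insert.prems that by (auto simp: polys_def)
    have "(\<Sum>\<alpha>\<in>F. Poly_Mapping.single \<alpha> (Poly_Mapping.lookup P \<alpha>)) \<in> polys A"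
      using s by (auto intro!: polys_sum polys_single)
    then show ?case
      using insert s by (auto intro!: assms(2,3) polys_single)
  qed
  from this[of "Poly_Mapping.keys P"] show ?thesis
    using poly_mapping_eq_sum_single[of P] by simp
qed

lemma polys_mult:
  assumes "P \<in> polys A" "Q \<in> polys A"
  shows "P * Q \<in> polys A"
  using assms(1)
proof (induction rule: polys_induct)
  case (single \<alpha> a)
  from assms(2) show ?case
  proof (induction rule: polys_induct)
    case (single \<beta> b)
    then show ?case
      using \<open>Poly_Mapping.keys \<alpha> \<subseteq> A\<close> \<open>a \<in> Cl A\<close> keys_add[of \<alpha> \<beta>]
      by (auto simp: mult_single intro!: polys_single Cl_mult)
  qed (simp add: distrib_left polys_add)
qed (simp add: distrib_right polys_add)

lemma polys_pscale: "P \<in> polys A \<Longrightarrow> pscale c P \<in> polys A"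
  by (simp add: pscale_def polys_mult polys_Const)

lemma polys_uminus: "P \<in> polys A \<Longrightarrow> - P \<in> polys A"
  using polys_pscale[of P A "-1"] by (simp add: cpoly.scale_minus_left)

lemma polys_diff: "P \<in> polys A \<Longrightarrow> Q \<in> polys A \<Longrightarrow> P - Q \<in> polys A"
  using polys_add[OF _ polys_uminus] by fastforce

lemma polys_power: "P \<in> polys A \<Longrightarrow> P ^ n \<in> polys A"
  by (induction n) (auto intro: polys_mult)

lemma polys_vecvar: "A \<subseteq> B \<Longrightarrow> vecvar A \<in> polys B"
  unfolding vecvar_def by (auto intro!: polys_sum polys_mult polys_Const polys_Var Cl_blade)

text \<open>Meant for substitutions and derivations, which are determined by their values on
  constants and variables.\<close>

lemma polys_ring_induct [consumes 1, case_names Const Var add mult]: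
  assumes "P \<in> polys A"
    and "\<And>a. a \<in> Cl A \<Longrightarrow> Q (Const a)" and "\<And>j. j \<in> A \<Longrightarrow> Q (Var j)"
    and "\<And>P P'. P \<in> polys A \<Longrightarrow> P' \<in> polys A \<Longrightarrow> Q P \<Longrightarrow> Q P' \<Longrightarrow> Q (P + P')"
    and "\<And>P P'. P \<in> polys A \<Longrightarrow> P' \<in> polys A \<Longrightarrow> Q P \<Longrightarrow> Q P' \<Longrightarrow> Q (P * P')"
  shows "Q P"
  using assms(1)
proof (induction rule: polys_induct)
  case (single \<alpha> a)
  have "Poly_Mapping.keys \<alpha> \<subseteq> A \<longrightarrow> Q (Poly_Mapping.single \<alpha> a)"
  proof (induction \<alpha> rule: poly_mapping_add_induct)
    case zero
    show ?case using assms(2) single by simp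
  next
    case (single_plus j n \<alpha>)
    show ?case
    proof
      assume *: "Poly_Mapping.keys (\<alpha> + Poly_Mapping.single j n) \<subseteq> A"
      have sub: "Poly_Mapping.keys \<alpha> \<subseteq> A"
        using * by (force simp: in_keys_iff lookup_add)
      show "Q (Poly_Mapping.single (\<alpha> + Poly_Mapping.single j n) a)"
      proof (cases "n = 0")
        case True
        then show ?thesis using single_plus sub by simp
      next
        case False
        then have j: "j \<in> A" using * by (force simp: in_keys_iff lookup_add)
        \<comment> \<open>The power of the variable is built one factor at a time, as only single
          variables are generators. Membership in \<open>polys A\<close> is carried along because
          the product rule asks for it.\<close>
        have "Q (Poly_Mapping.single (\<alpha> + Poly_Mapping.single j k) a) \<and>
            Poly_Mapping.single (\<alpha> + Poly_Mapping.single j k) a \<in> polys A" for k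
        proof (induction k)
          case 0
          then show ?case using single_plus sub single(2) by (simp add: polys_single)
        next
          case (Suc k)
          have "Poly_Mapping.single (\<alpha> + Poly_Mapping.single j (Suc k)) a =
              Poly_Mapping.single (\<alpha> + Poly_Mapping.single j k) a * Var j"
            by (simp add: Var_def mult_single add.assoc single_add[symmetric])
          then show ?case
            using Suc j assms(3,5) by (simp add: polys_Var polys_mult)
        qed
        then show ?thesis by blast
      qed
    qed
  qed
  then show ?case using single by blast
qed (use assms(4) in auto)

section \<open>Partial derivatives and the Dirac operator\<close>

lemma pdiff_superset:
  assumes "finite F" "Poly_Mapping.keys P \<subseteq> F"
  shows "pdiff j P = (\<Sum>\<alpha>\<in>F. Poly_Mapping.single (\<alpha> - Poly_Mapping.single j 1)
     (of_nat (Poly_Mapping.lookup \<alpha> j) * Poly_Mapping.lookup P \<alpha>))"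
  unfolding pdiff_def using assms by (intro sum.mono_neutral_left) (auto simp: in_keys_iff)

lemma pdiff_0 [simp]: "pdiff j 0 = 0"
  by (simp add: pdiff_def)

lemma pdiff_single:
  "pdiff j (Poly_Mapping.single \<alpha> a) =
     Poly_Mapping.single (\<alpha> - Poly_Mapping.single j 1) (of_nat (Poly_Mapping.lookup \<alpha> j) * a)"
  by (subst pdiff_superset[of "{\<alpha>}"]) auto

lemma pdiff_add: "pdiff j (P + Q) = pdiff j P + pdiff j Q"
proof -
  let ?F = "Poly_Mapping.keys P \<union> Poly_Mapping.keys Q"
  have "Poly_Mapping.keys (P + Q) \<subseteq> ?F" by (rule keys_add)
  then show ?thesis
    by (simp add: pdiff_superset[of ?F] lookup_add distrib_left single_add sum.distrib)
qed

lemma pdiff_sum: "pdiff j (\<Sum>i\<in>I. f i) = (\<Sum>i\<in>I. pdiff j (f i))"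
  by (induction I rule: infinite_finite_induct) (simp_all add: pdiff_add)

lemma pdiff_Const [simp]: "pdiff j (Const a) = 0"
  by (simp add: pdiff_single)

lemma pdiff_1 [simp]: "pdiff j 1 = 0"
  using pdiff_Const[of j 1] by simp

lemma pdiff_Var: "pdiff i (Var j) = (if i = j then 1 else 0)"
  by (auto simp: Var_def pdiff_single lookup_single when_def)

lemma pdiff_mult: "pdiff j (P * Q) = pdiff j P * Q + P * pdiff j Q"
proof (induction P rule: poly_mapping_add_induct)
  case zero
  show ?case by simp
next
  case (single_plus \<alpha> a P)
  have "pdiff j (Poly_Mapping.single \<alpha> a * Q) =
      pdiff j (Poly_Mapping.single \<alpha> a) * Q + Poly_Mapping.single \<alpha> a * pdiff j Q"
  proof (induction Q rule: poly_mapping_add_induct)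
    case zero
    show ?case by simp
  next
    case (single_plus \<beta> b Q)
    \<comment> \<open>Subtraction of exponents is truncated, so it need not move past
      \<open>\<delta>\<close> when the variable is absent from \<open>\<gamma>\<close>; in that case
      the coefficient \<open>of_nat 0\<close> makes both sides vanish.\<close>
    have shift: "Poly_Mapping.single (\<gamma> + \<delta> - Poly_Mapping.single j 1) (of_nat (Poly_Mapping.lookup \<gamma> j) * c) =
        Poly_Mapping.single ((\<gamma> - Poly_Mapping.single j 1) + \<delta>) (of_nat (Poly_Mapping.lookup \<gamma> j) * c)"
      for \<gamma> \<delta> :: "nat \<Rightarrow>\<^sub>0 nat" and c :: cliff
    proof (cases "Poly_Mapping.lookup \<gamma> j = 0")
      case False
      then have "\<gamma> + \<delta> - Poly_Mapping.single j 1 = (\<gamma> - Poly_Mapping.single j 1) + \<delta>"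
        by (intro poly_mapping_eqI) (auto simp: lookup_add lookup_minus lookup_single when_def)
      then show ?thesis by simp
    qed simp
    have comm: "a * (of_nat n * b) = of_nat n * (a * b)" for n
      by (metis mult.assoc mult_of_nat_commute)
    have "pdiff j (Poly_Mapping.single \<alpha> a * Poly_Mapping.single \<beta> b) =
      pdiff j (Poly_Mapping.single \<alpha> a) * Poly_Mapping.single \<beta> b +
      Poly_Mapping.single \<alpha> a * pdiff j (Poly_Mapping.single \<beta> b)"
      using shift[of \<alpha> \<beta> "a * b"] shift[of \<beta> \<alpha> "a * b"]
      by (simp add: pdiff_single mult_single lookup_add distrib_right single_add comm mult.assoc add.commute)
    with single_plus show ?case by (simp add: distrib_left pdiff_add algebra_simps)
  qed
  with single_plus show ?case by (simp add: distrib_right pdiff_add algebra_simps)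
qed

lemma pdiff_pscale: "pdiff j (pscale c P) = pscale c (pdiff j P)"
  by (simp add: pscale_def pdiff_mult)

lemma pdiff_Const_mult: "pdiff j (Const a * P) = Const a * pdiff j P"
  by (simp add: pdiff_mult)

lemma pdiff_eq_0:
  assumes "P \<in> polys A" "j \<notin> A"
  shows "pdiff j P = 0"
  using assms(1)
proof (induction rule: polys_induct)
  case (single \<alpha> a)
  then have "Poly_Mapping.lookup \<alpha> j = 0" using assms(2) by (auto simp: in_keys_iff)
  then show ?case by (simp add: pdiff_single)
qed (simp add: pdiff_add)

lemma pdiff_vecvar:
  assumes "finite A"
  shows "pdiff j (vecvar A) = (if j \<in> A then Const (evec j) else 0)"
proof -
  have "pdiff j (vecvar A) = (\<Sum>i\<in>A. if i = j then Const (evec j) else 0)"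
    unfolding vecvar_def pdiff_sum pdiff_Const_mult pdiff_Var by (intro sum.cong) auto
  then show ?thesis using assms by simp
qed

lemma polys_pdiff:
  assumes "P \<in> polys A"
  shows "pdiff j P \<in> polys A"
  using assms
proof (induction rule: polys_ring_induct)
  case (Var i)
  then show ?case by (simp add: pdiff_Var)
qed (auto simp: pdiff_add pdiff_mult intro: polys_add polys_mult)

lemma polys_dirac: "P \<in> polys A \<Longrightarrow> B \<subseteq> A \<Longrightarrow> dirac B P \<in> polys A"
  unfolding dirac_def by (auto intro!: polys_sum polys_mult polys_Const Cl_blade polys_pdiff)

lemma dirac_0 [simp]: "dirac A 0 = 0"
  by (simp add: dirac_def)

lemma dirac_add: "dirac A (P + Q) = dirac A P + dirac A Q"
  by (simp add: dirac_def pdiff_add distrib_left sum.distrib)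

lemma dirac_pscale: "dirac A (pscale c P) = pscale c (dirac A P)"
  by (simp add: dirac_def pdiff_pscale pscale_mult_right cpoly.scale_sum_right)

lemma dirac_uminus: "dirac A (- P) = - dirac A P"
  using dirac_pscale[of A "-1" P] by (simp add: cpoly.scale_minus_left)

lemma dirac_diff: "dirac A (P - Q) = dirac A P - dirac A Q"
  using dirac_add[of A P "- Q"] by (simp add: dirac_uminus)

lemma dirac_sum: "dirac A (\<Sum>i\<in>I. f i) = (\<Sum>i\<in>I. dirac A (f i))"
  by (induction I rule: infinite_finite_induct) (simp_all add: dirac_add)

lemma Var_commute: "Var j * P = P * Var j"
  by (induction P rule: poly_mapping_add_induct)
    (simp_all add: Var_def distrib_left distrib_right mult_single add.commute)

lemma vecvar_Un:
  "finite A \<Longrightarrow> finite B \<Longrightarrow> A \<inter> B = {} \<Longrightarrow> vecvar (A \<union> B) = vecvar A + vecvar B"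
  by (simp add: vecvar_def sum.union_disjoint)

text \<open>\<open>Cl_commute_evec\<close> is applied to every coefficient. The clause on zero
  coefficients says that no new monomials appear, so that \<open>P'\<close> inherits homogeneity
  from \<open>P\<close>.\<close>

lemma polys_commute_vecvar:
  assumes "P \<in> polys A" "A \<inter> B = {}"
  shows "\<exists>P'\<in>polys A. (\<forall>\<alpha>. Poly_Mapping.lookup P \<alpha> = 0 \<longrightarrow> Poly_Mapping.lookup P' \<alpha> = 0) \<and>
    (\<forall>j\<in>B. Const (evec j) * P = P' * Const (evec j))"
proof -
  have "\<exists>a'. a' \<in> Cl A \<and> (\<forall>j. j \<notin> A \<longrightarrow> evec j * a = a' * evec j) \<and> (a = 0 \<longrightarrow> a' = 0)"
    if "a \<in> Cl A" for a
    using Cl_commute_evec[OF that] by (cases "a = 0") (auto intro: exI[of _ 0])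
  then obtain f where f: "f a \<in> Cl A" "j \<notin> A \<Longrightarrow> evec j * a = f a * evec j" "a = 0 \<Longrightarrow> f a = 0"
    if "a \<in> Cl A" for a j
    by metis
  let ?P' = "\<Sum>\<alpha>\<in>Poly_Mapping.keys P. Poly_Mapping.single \<alpha> (f (Poly_Mapping.lookup P \<alpha>))"
  have P: "Poly_Mapping.keys \<alpha> \<subseteq> A" "Poly_Mapping.lookup P \<alpha> \<in> Cl A" if "\<alpha> \<in> Poly_Mapping.keys P" for \<alpha>
    using assms(1) that by (auto simp: polys_def)
  show ?thesis
  proof (intro bexI[of _ ?P'] conjI allI impI ballI)
    fix \<alpha> assume "Poly_Mapping.lookup P \<alpha> = 0"
    then show "Poly_Mapping.lookup ?P' \<alpha> = 0"
      by (simp add: lookup_sum lookup_single when_def in_keys_iff)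
  next
    fix j assume "j \<in> B"
    then have "j \<notin> A" using assms(2) by auto
    have "Const (evec j) * P =
        Const (evec j) * (\<Sum>\<alpha>\<in>Poly_Mapping.keys P. Poly_Mapping.single \<alpha> (Poly_Mapping.lookup P \<alpha>))"
      using poly_mapping_eq_sum_single[of P] by simp
    also have "\<dots> = ?P' * Const (evec j)"
      unfolding sum_distrib_left sum_distrib_right mult_single
      using P f(2) \<open>j \<notin> A\<close> by (intro sum.cong refl) simp
    finally show "Const (evec j) * P = ?P' * Const (evec j)" .
  next
    show "?P' \<in> polys A" using P f(1) by (auto intro!: polys_sum polys_single)
  qed
qed

section \<open>Degrees\<close>

text \<open>A common setting for the total degree and for the degree in only some of the variables.\<close>

definition additive_deg :: "((nat \<Rightarrow>\<^sub>0 nat) \<Rightarrow> nat) \<Rightarrow> bool" where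
  "additive_deg d \<longleftrightarrow> (\<forall>\<alpha> \<beta>. d (\<alpha> + \<beta>) = d \<alpha> + d \<beta>)"

text \<open>A set of admissible degrees covers homogeneity \<open>{k}\<close>, bounds
  \<open>{..<b}\<close> and complements \<open>- {i}\<close> at once; for the empty set the
  condition becomes \<open>P = 0\<close>.\<close>

definition deg_in :: "((nat \<Rightarrow>\<^sub>0 nat) \<Rightarrow> nat) \<Rightarrow> nat set \<Rightarrow> cpoly \<Rightarrow> bool" where
  "deg_in d S P \<longleftrightarrow> (\<forall>\<alpha>\<in>Poly_Mapping.keys P. d \<alpha> \<in> S)"

definition hdeg :: "nat set \<Rightarrow> (nat \<Rightarrow>\<^sub>0 nat) \<Rightarrow> nat" where
  "hdeg V \<alpha> = (\<Sum>j\<in>V. Poly_Mapping.lookup \<alpha> j)"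

lemma mdegree_superset: "finite F \<Longrightarrow> Poly_Mapping.keys \<alpha> \<subseteq> F \<Longrightarrow> mdegree \<alpha> = hdeg F \<alpha>"
  unfolding mdegree_def hdeg_def by (intro sum.mono_neutral_left) (auto simp: in_keys_iff)

lemma additive_hdeg [simp]: "additive_deg (hdeg V)"
  by (simp add: additive_deg_def hdeg_def lookup_add sum.distrib)

lemma additive_mdegree [simp]: "additive_deg mdegree"
  unfolding additive_deg_def
proof (intro allI)
  fix \<alpha> \<beta> :: "nat \<Rightarrow>\<^sub>0 nat"
  let ?F = "Poly_Mapping.keys \<alpha> \<union> Poly_Mapping.keys \<beta>"
  have "Poly_Mapping.keys (\<alpha> + \<beta>) \<subseteq> ?F" by (rule keys_add)
  then show "mdegree (\<alpha> + \<beta>) = mdegree \<alpha> + mdegree \<beta>"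
    using additive_hdeg[of ?F] by (simp add: mdegree_superset[of ?F] additive_deg_def)
qed

lemma hdeg_single: "finite V \<Longrightarrow> hdeg V (Poly_Mapping.single j (Suc 0)) = (if j \<in> V then 1 else 0)"
  by (simp add: hdeg_def lookup_single when_def)

lemma mdegree_single: "mdegree (Poly_Mapping.single j (Suc 0)) = 1"
  by (simp add: mdegree_def)

lemma homogeneous_iff: "homogeneous k P \<longleftrightarrow> deg_in mdegree {k} P"
  by (simp add: homogeneous_def deg_in_def)

lemma polys_homogeneous_iff:
  "finite V \<Longrightarrow> P \<in> polys V \<Longrightarrow> homogeneous k P \<longleftrightarrow> deg_in (hdeg V) {k} P"
  unfolding homogeneous_iff deg_in_def polys_def by (auto simp: mdegree_superset)

lemma deg_in_0 [simp]: "deg_in d S 0"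
  by (simp add: deg_in_def)

lemma deg_in_empty [simp]: "deg_in d {} P \<longleftrightarrow> P = 0"
  by (auto simp: deg_in_def)

lemma deg_in_mono: "deg_in d S P \<Longrightarrow> S \<subseteq> T \<Longrightarrow> deg_in d T P"
  by (auto simp: deg_in_def)

lemma deg_in_single: "d \<alpha> \<in> S \<Longrightarrow> deg_in d S (Poly_Mapping.single \<alpha> a)"
  by (auto simp: deg_in_def)

lemma deg_in_add: "deg_in d S P \<Longrightarrow> deg_in d S Q \<Longrightarrow> deg_in d S (P + Q)"
  using keys_add[of P Q] by (auto simp: deg_in_def)

lemma deg_in_uminus: "deg_in d S P \<Longrightarrow> deg_in d S (- P)"
  by (auto simp: deg_in_def in_keys_iff)

lemma deg_in_diff: "deg_in d S P \<Longrightarrow> deg_in d S Q \<Longrightarrow> deg_in d S (P - Q)"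
  using keys_diff[of P Q] by (auto simp: deg_in_def)

lemma deg_in_sum: "(\<And>i. i \<in> I \<Longrightarrow> deg_in d S (f i)) \<Longrightarrow> deg_in d S (sum f I)"
  by (induction I rule: infinite_finite_induct) (auto intro: deg_in_add)

lemma deg_in_mult:
  assumes "additive_deg d" "deg_in d S P" "deg_in d T Q" "\<And>s t. s \<in> S \<Longrightarrow> t \<in> T \<Longrightarrow> s + t \<in> R"
  shows "deg_in d R (P * Q)"
  unfolding deg_in_def
proof
  fix \<gamma> assume "\<gamma> \<in> Poly_Mapping.keys (P * Q)"
  then obtain \<alpha> \<beta> where "\<alpha> \<in> Poly_Mapping.keys P" "\<beta> \<in> Poly_Mapping.keys Q" "\<gamma> = \<alpha> + \<beta>"
    using keys_mult[of P Q] by blast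
  then show "d \<gamma> \<in> R" using assms by (simp add: deg_in_def additive_deg_def)
qed

lemma deg_in_Const: "additive_deg d \<Longrightarrow> deg_in d {0} (Const a)"
  unfolding additive_deg_def by (rule deg_in_single) (metis add_cancel_right_left singletonI add_0)

lemma deg_in_Const_mult: "additive_deg d \<Longrightarrow> deg_in d S P \<Longrightarrow> deg_in d S (Const a * P)"
  by (rule deg_in_mult[OF _ deg_in_Const]) auto

lemma deg_in_pscale: "additive_deg d \<Longrightarrow> deg_in d S P \<Longrightarrow> deg_in d S (pscale c P)"
  unfolding pscale_def by (rule deg_in_Const_mult)

lemma deg_in_Var: "deg_in d {d (Poly_Mapping.single j 1)} (Var j)"
  unfolding Var_def by (rule deg_in_single) simp

lemma deg_in_power:
  assumes "additive_deg d" "deg_in d {k} P"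
  shows "deg_in d {n * k} (P ^ n)"
proof (induction n)
  case 0
  show ?case using deg_in_Const[OF assms(1), of 1] by simp
next
  case (Suc n)
  then show ?case using assms by (auto intro: deg_in_mult)
qed

lemma deg_in_vecvar:
  assumes "additive_deg d" "\<And>j. j \<in> A \<Longrightarrow> d (Poly_Mapping.single j 1) = c"
  shows "deg_in d {c} (vecvar A)"
  unfolding vecvar_def using assms deg_in_Var[of d]
  by (intro deg_in_sum deg_in_Const_mult) auto

text \<open>Shifting \<open>S\<close> by a preimage instead of a truncated subtraction keeps the
  bound sharp: for \<open>S = {0}\<close> and a variable of degree 1 the preimage is empty, so the
  derivative is 0.\<close>

lemma deg_in_pdiff:
  assumes "additive_deg d" "deg_in d S P"
  shows "deg_in d {k. k + d (Poly_Mapping.single j 1) \<in> S} (pdiff j P)"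
  unfolding pdiff_def
proof (rule deg_in_sum)
  fix \<alpha> assume \<alpha>: "\<alpha> \<in> Poly_Mapping.keys P"
  show "deg_in d {k. k + d (Poly_Mapping.single j 1) \<in> S} (Poly_Mapping.single (\<alpha> - Poly_Mapping.single j 1)
          (of_nat (Poly_Mapping.lookup \<alpha> j) * Poly_Mapping.lookup P \<alpha>))"
  proof (cases "Poly_Mapping.lookup \<alpha> j = 0")
    case False
    then have "(\<alpha> - Poly_Mapping.single j 1) + Poly_Mapping.single j 1 = \<alpha>"
      by (intro poly_mapping_eqI) (auto simp: lookup_add lookup_minus lookup_single when_def)
    then have "d (\<alpha> - Poly_Mapping.single j 1) + d (Poly_Mapping.single j 1) = d \<alpha>"
      using assms(1) unfolding additive_deg_def by metis
    then show ?thesis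
      using assms(2) \<alpha> by (intro deg_in_single) (simp add: deg_in_def)
  qed simp
qed

lemma deg_in_dirac:
  assumes "additive_deg d" "deg_in d S P" "\<And>j. j \<in> A \<Longrightarrow> d (Poly_Mapping.single j 1) = c"
  shows "deg_in d {k. k + c \<in> S} (dirac A P)"
  unfolding dirac_def using deg_in_pdiff[OF assms(1,2)] assms(1,3)
  by (intro deg_in_sum deg_in_Const_mult) auto

lemma deg_in_disjoint: "deg_in d S P \<Longrightarrow> deg_in d T P \<Longrightarrow> S \<inter> T = {} \<Longrightarrow> P = 0"
  by (auto simp: deg_in_def simp flip: keys_eq_empty)

lemma deg_in_split:
  assumes "deg_in d (S \<union> T) P"
  shows "\<exists>P1 P2. P = P1 + P2 \<and> deg_in d S P1 \<and> deg_in d T P2"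
proof -
  let ?f = "\<lambda>\<alpha>. Poly_Mapping.single \<alpha> (Poly_Mapping.lookup P \<alpha>)"
  let ?K = "Poly_Mapping.keys P"
  have "P = sum ?f ?K" by (rule poly_mapping_eq_sum_single)
  also have "\<dots> = sum ?f {\<alpha>\<in>?K. d \<alpha> \<in> S} + sum ?f {\<alpha>\<in>?K. d \<alpha> \<notin> S}"
    by (subst sum.union_disjoint[symmetric]) (auto intro: sum.cong)
  finally have "P = sum ?f {\<alpha>\<in>?K. d \<alpha> \<in> S} + sum ?f {\<alpha>\<in>?K. d \<alpha> \<notin> S}" .
  moreover have "deg_in d S (sum ?f {\<alpha>\<in>?K. d \<alpha> \<in> S})" "deg_in d T (sum ?f {\<alpha>\<in>?K. d \<alpha> \<notin> S})"
    using assms by (intro deg_in_sum deg_in_single; force simp: deg_in_def)+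
  ultimately show ?thesis by blast
qed

lemma deg_in_bounded: "\<exists>b. deg_in d {..<b} P"
proof -
  have "d \<alpha> \<le> sum d (Poly_Mapping.keys P)" if "\<alpha> \<in> Poly_Mapping.keys P" for \<alpha>
    using that by (intro member_le_sum) auto
  then show ?thesis
    by (intro exI[of _ "Suc (sum d (Poly_Mapping.keys P))"]) (auto simp: deg_in_def le_imp_less_Suc)
qed

lemma sum_distinct_degrees_eq_0:
  assumes "finite I" "\<And>i. i \<in> I \<Longrightarrow> deg_in d {i} (f i)" "sum f I = 0" "i \<in> I"
  shows "f i = 0"
proof (rule deg_in_disjoint)
  have "f i = - sum f (I - {i})"
    using assms by (simp add: sum.remove eq_neg_iff_add_eq_0)
  moreover have "deg_in d (- {i}) (sum f (I - {i}))"
    by (intro deg_in_sum deg_in_mono[OF assms(2)]) auto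
  ultimately show "deg_in d (- {i}) (f i)" by (simp add: deg_in_uminus)
qed (use assms(2)[OF assms(4)] in auto)

section \<open>The Fischer decomposition\<close>

lemma pscale_single: "pscale c (Poly_Mapping.single \<alpha> a) = Poly_Mapping.single \<alpha> (scalar c * a)"
  by (simp add: pscale_def mult_single)

lemma euler:
  assumes "finite V" "deg_in (hdeg V) {k} P"
  shows "(\<Sum>j\<in>V. Var j * pdiff j P) = pscale (of_nat k) P"
proof -
  let ?K = "Poly_Mapping.keys P"
  have *: "Var j * Poly_Mapping.single (\<alpha> - Poly_Mapping.single j 1) (of_nat (Poly_Mapping.lookup \<alpha> j) * a) =
      Poly_Mapping.single \<alpha> (of_nat (Poly_Mapping.lookup \<alpha> j) * a)" for \<alpha> j a
  proof (cases "Poly_Mapping.lookup \<alpha> j = 0")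
    case False
    then have "Poly_Mapping.single j 1 + (\<alpha> - Poly_Mapping.single j 1) = \<alpha>"
      by (intro poly_mapping_eqI) (auto simp: lookup_add lookup_minus lookup_single when_def)
    then show ?thesis by (simp add: Var_def mult_single)
  qed simp
  have **: "(\<Sum>i\<in>I. Poly_Mapping.single \<alpha> (g i)) = Poly_Mapping.single \<alpha> (sum g I)" for I \<alpha> and g :: "nat \<Rightarrow> cliff"
    by (induction I rule: infinite_finite_induct) (simp_all add: single_add)
  have "(\<Sum>j\<in>V. Var j * pdiff j P) =
      (\<Sum>j\<in>V. \<Sum>\<alpha>\<in>?K. Poly_Mapping.single \<alpha> (of_nat (Poly_Mapping.lookup \<alpha> j) * Poly_Mapping.lookup P \<alpha>))"
    by (simp only: pdiff_def sum_distrib_left *)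
  also have "\<dots> = (\<Sum>\<alpha>\<in>?K. Poly_Mapping.single \<alpha> (of_nat (hdeg V \<alpha>) * Poly_Mapping.lookup P \<alpha>))"
    by (subst sum.swap) (simp add: ** hdeg_def flip: sum_distrib_right)
  also have "\<dots> = (\<Sum>\<alpha>\<in>?K. pscale (of_nat k) (Poly_Mapping.single \<alpha> (Poly_Mapping.lookup P \<alpha>)))"
    using assms(2) by (intro sum.cong refl) (simp add: deg_in_def pscale_single scalar_of_nat)
  also have "\<dots> = pscale (of_nat k) P"
    using poly_mapping_eq_sum_single[of P] by (simp flip: cpoly.scale_sum_right)
  finally show ?thesis .
qed

lemma evec_vecvar:
  assumes "finite V" "i \<in> V"
  shows "Const (evec i) * vecvar V = - (vecvar V * Const (evec i)) - 2 * Var i"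
proof -
  have "Const (evec i) * vecvar V + vecvar V * Const (evec i) =
      (\<Sum>j\<in>V. Const (evec i * evec j + evec j * evec i) * Var j)"
  proof -
    have "Const (evec i) * (Const (evec j) * Var j) + Const (evec j) * Var j * Const (evec i) =
        Const (evec i * evec j + evec j * evec i) * Var j" for j
      by (simp add: single_add distrib_right mult.assoc Var_commute flip: mult_single[of 0 _ 0, simplified])
    then show ?thesis
      unfolding vecvar_def sum_distrib_left sum_distrib_right by (simp flip: sum.distrib)
  qed
  also have "\<dots> = (\<Sum>j\<in>V. if j = i then - 2 * Var i else 0)"
  proof -
    have "Const (- 2) = (- 2 :: cpoly)"
      by (metis single_numeral single_uminus)
    then show ?thesis by (intro sum.cong refl) (auto simp: evec_anticommute)
  qed
  also have "\<dots> = - 2 * Var i" using assms by simp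
  finally show ?thesis by (simp add: algebra_simps eq_neg_iff_add_eq_0)
qed

text \<open>The relation \<open>D v + v D = - 2 E - card V\<close> with the Euler operator
  \<open>E\<close>, which acts as \<open>k\<close> here. Only the degree in \<open>V\<close> is
  prescribed, so \<open>P\<close> may contain further variables. The term \<open>card V\<close>
  comes from the squares of the generators, \<open>2 E\<close> from
  \<open>evec_vecvar\<close>.\<close>

lemma dirac_vecvar:
  assumes "finite V" "deg_in (hdeg V) {k} P"
  shows "dirac V (vecvar V * P) = - pscale (of_nat (2 * k + card V)) P - vecvar V * dirac V P"
proof -
  have sq: "Const (evec i) * (Const (evec i) * P) = - P" for i
    unfolding mult.assoc[symmetric] Const_evec_square by simp
  have "dirac V (vecvar V * P) =
      (\<Sum>i\<in>V. Const (evec i) * (Const (evec i) * P) + Const (evec i) * vecvar V * pdiff i P)"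
    unfolding dirac_def using assms(1)
    by (intro sum.cong refl) (simp add: pdiff_mult pdiff_vecvar distrib_left mult.assoc)
  also have "\<dots> = (\<Sum>i\<in>V. - P - vecvar V * (Const (evec i) * pdiff i P) - 2 * (Var i * pdiff i P))"
  proof (intro sum.cong refl)
    fix i assume "i \<in> V"
    note evec_vecvar[OF assms(1) this]
    then have "Const (evec i) * vecvar V * pdiff i P =
        (- (vecvar V * Const (evec i)) - 2 * Var i) * pdiff i P" by (simp only:)
    also have "\<dots> = - (vecvar V * (Const (evec i) * pdiff i P)) - 2 * (Var i * pdiff i P)"
      by (simp only: left_diff_distrib mult_minus_left mult.assoc)
    finally show "Const (evec i) * (Const (evec i) * P) + Const (evec i) * vecvar V * pdiff i P =
        - P - vecvar V * (Const (evec i) * pdiff i P) - 2 * (Var i * pdiff i P)"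
      by (simp only: sq diff_conv_add_uminus add.assoc)
  qed
  also have "\<dots> = - (of_nat (card V) * P) - vecvar V * dirac V P - 2 * pscale (of_nat k) P"
    by (simp add: sum_subtractf dirac_def sum_distrib_left flip: euler[OF assms])
  also have "\<dots> = - pscale (of_nat (2 * k + card V)) P - vecvar V * dirac V P"
  proof -
    have "of_nat n * P = pscale (of_nat n) P" for n
      by (induction n) (simp_all add: distrib_right cpoly.scale_left_distrib)
    moreover have "2 * pscale (of_nat k) P = pscale (of_nat (2 * k)) P"
      by (simp only: mult_2 of_nat_add cpoly.scale_left_distrib)
    moreover have "- X - Y - Z = - (Z + X) - Y" for X Y Z :: cpoly by simp
    ultimately show ?thesis by (simp only: of_nat_add cpoly.scale_left_distrib)
  qed
  finally show ?thesis .
qed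

lemma deg_in_hdeg_vecvar: "finite V \<Longrightarrow> deg_in (hdeg V) {1} (vecvar V)"
  by (rule deg_in_vecvar) (auto simp: hdeg_single)

lemma deg_in_hdeg_dirac:
  "finite V \<Longrightarrow> deg_in (hdeg V) {Suc k} P \<Longrightarrow> deg_in (hdeg V) {k} (dirac V P)"
  using deg_in_dirac[of "hdeg V" "{Suc k}" P V 1] by (simp add: hdeg_single)

lemma dirac_deg_0: "finite V \<Longrightarrow> deg_in (hdeg V) {0} P \<Longrightarrow> dirac V P = 0"
  using deg_in_dirac[of "hdeg V" "{0}" P V 1] by (simp add: hdeg_single)

text \<open>
  The operator \<open>v D\<close> has no eigenvalue \<open>r\<close> in the range given here, in degree \<open>k\<close>. Applying \<open>D\<close> to
  \<open>r Q = v D Q\<close>, with \<open>Q\<close> of degree \<open>k + 1\<close>, gives the same equation for \<open>D Q\<close>, with \<open>- (r + 2 k + card V)\<close> in place of \<open>r\<close>,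
  which is again in that range for the degree of \<open>D Q\<close>.
\<close>

lemma vecvar_dirac_eigenvalue:
  assumes "finite V" "V \<noteq> {}" "r > 0 \<or> r \<le> - int (2 * k + card V)"
    and "deg_in (hdeg V) {k} Q" "pscale (of_int r) Q = vecvar V * dirac V Q"
  shows "Q = 0"
  using assms(3-5)
proof (induction k arbitrary: r Q)
  case 0
  then have "pscale (of_int r) Q = 0" using assms(1) by (simp add: dirac_deg_0)
  moreover have "r \<noteq> 0" using 0 assms(1,2) by (auto simp: card_gt_0_iff)
  ultimately show ?case by simp
next
  case (Suc k)
  let ?R = "dirac V Q" and ?r = "- (r + int (2 * k + card V))"
  have R: "deg_in (hdeg V) {k} ?R" using Suc.prems assms(1) by (simp add: deg_in_hdeg_dirac)
  have "pscale (of_int r) ?R = dirac V (vecvar V * ?R)"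
    using Suc.prems by (simp flip: dirac_pscale)
  also have "\<dots> = - pscale (of_nat (2 * k + card V)) ?R - vecvar V * dirac V ?R"
    by (rule dirac_vecvar[OF assms(1) R])
  finally have "vecvar V * dirac V ?R = - pscale (of_int r) ?R - pscale (of_nat (2 * k + card V)) ?R"
    by (simp only:) simp
  moreover have "of_int ?r = - of_int r - (of_nat (2 * k + card V) :: complex)" by simp
  ultimately have "pscale (of_int ?r) ?R = vecvar V * dirac V ?R"
    by (simp only: cpoly.scale_left_diff_distrib cpoly.scale_minus_left)
  moreover have "?r > 0 \<or> ?r \<le> - int (2 * k + card V)" using Suc.prems(1) by auto
  ultimately have "?R = 0" using Suc.IH R by blast
  moreover have "r \<noteq> 0" using Suc.prems(1) by auto
  ultimately show ?case using Suc.prems(3) by simp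
qed

text \<open>Surjectivity, by the shift of \<open>r\<close> used for the eigenvalues. If
  \<open>Q\<close> is a solution, then \<open>R = D Q\<close> solves an equation of the same kind in
  degree one lower, with right-hand side \<open>- D P\<close>. Conversely such an \<open>R\<close>
  is taken from the induction hypothesis, \<open>Q\<close> is defined by
  \<open>r Q = P + v R\<close>, and \<open>D Q = R\<close> is verified.\<close>

lemma vecvar_dirac_solve:
  assumes "finite V" "V \<noteq> {}" "r > 0 \<or> r \<le> - int (2 * k + card V)"
    and "deg_in (hdeg V) {k} P" "P \<in> polys V"
  shows "\<exists>Q\<in>polys V. deg_in (hdeg V) {k} Q \<and> pscale (of_int r) Q - vecvar V * dirac V Q = P"
  using assms(3-5)
proof (induction k arbitrary: r P)
  case 0
  let ?Q = "pscale (1 / of_int r) P"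
  \<comment> \<open>In degree 0 the second alternative reads \<open>r \<le> - card V\<close>, which
    excludes 0 because \<open>V\<close> is nonempty.\<close>
  have "r \<noteq> 0" using 0 assms(1,2) by (auto simp: card_gt_0_iff)
  moreover have "dirac V ?Q = 0" using 0 assms(1) by (simp add: dirac_pscale dirac_deg_0)
  ultimately show ?case
    using 0 by (intro bexI[of _ ?Q]) (auto intro: deg_in_pscale polys_pscale)
next
  case (Suc k)
  let ?n = "2 * k + card V"
  let ?r = "- (r + int ?n)"
  \<comment> \<open>The shift exchanges the two halves of the range: \<open>r > 0\<close> gives
    \<open>?r < - ?n\<close>, and \<open>r \<le> - (?n + 2)\<close> gives
    \<open>?r \<ge> 2\<close>.\<close>
  have "?r > 0 \<or> ?r \<le> - int ?n" "r \<noteq> 0" using Suc.prems(1) by auto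
  moreover have "deg_in (hdeg V) {k} (- dirac V P)" "- dirac V P \<in> polys V"
    using Suc.prems assms(1) by (auto intro!: deg_in_uminus deg_in_hdeg_dirac polys_uminus polys_dirac)
  ultimately obtain R where R: "R \<in> polys V" "deg_in (hdeg V) {k} R"
    "pscale (of_int ?r) R - vecvar V * dirac V R = - dirac V P"
    using Suc.IH by blast
  define Q where "Q = pscale (1 / of_int r) (P + vecvar V * R)"
  have rQ: "pscale (of_int r) Q = P + vecvar V * R"
    using \<open>r \<noteq> 0\<close> by (simp add: Q_def)
  have "pscale (of_int r) (dirac V Q) = dirac V P + (- pscale (of_nat ?n) R - vecvar V * dirac V R)"
    unfolding dirac_pscale[symmetric] rQ dirac_add dirac_vecvar[OF assms(1) R(2)] ..
  also have "\<dots> = pscale (of_int r) R"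
  proof -
    have "dirac V P = vecvar V * dirac V R - pscale (of_int ?r) R"
      using R(3) by (metis minus_diff_eq minus_minus)
    also have "pscale (of_int ?r) R = - pscale (of_int r) R - pscale (of_nat ?n) R"
    proof -
      have "of_int ?r = - of_int r - (of_nat ?n :: complex)" by simp
      then show ?thesis by (simp only: cpoly.scale_left_diff_distrib cpoly.scale_minus_left)
    qed
    finally show ?thesis by (simp only:) (simp add: algebra_simps)
  qed
  finally have "dirac V Q = R" using \<open>r \<noteq> 0\<close> by simp
  moreover have "Q \<in> polys V"
    unfolding Q_def using Suc.prems R by (intro polys_pscale polys_add polys_mult polys_vecvar) auto
  moreover have "deg_in (hdeg V) {Suc k} Q"
    unfolding Q_def using Suc.prems R deg_in_hdeg_vecvar[OF assms(1)]
    by (intro deg_in_pscale deg_in_add) (auto intro: deg_in_mult)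
  ultimately show ?case using rQ by (intro bexI[of _ Q]) auto
qed

text \<open>By \<open>dirac_vecvar\<close>, the hypothesis is the eigenvalue equation with
  \<open>r = - (2 k + card V)\<close>, the endpoint of the excluded range.\<close>

lemma dirac_vecvar_eq_0:
  assumes "finite V" "V \<noteq> {}" "deg_in (hdeg V) {k} Q" "dirac V (vecvar V * Q) = 0"
  shows "Q = 0"
proof (rule vecvar_dirac_eigenvalue[OF assms(1,2) _ assms(3)])
  show "pscale (of_int (- int (2 * k + card V))) Q = vecvar V * dirac V Q"
    using dirac_vecvar[OF assms(1,3)] assms(4) by (simp add: cpoly.scale_minus_left algebra_simps)
qed simp

text \<open>The part of top degree in the variables from \<open>V\<close> reduces this to the homogeneous case.\<close>

lemma dirac_vecvar_Un_eq_0: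
  assumes "finite U" "finite V" "V \<noteq> {}" "U \<inter> V = {}" "dirac V (vecvar (U \<union> V) * Q) = 0"
  shows "Q = 0"
proof -
  have dU: "deg_in (hdeg V) {0} (vecvar U)"
    using assms by (intro deg_in_vecvar) (auto simp: hdeg_single)
  have dV: "deg_in (hdeg V) {1} (vecvar V)"
    using assms by (intro deg_in_hdeg_vecvar)
  have D: "deg_in (hdeg V) {..<b} (dirac V P)" if "deg_in (hdeg V) {..<Suc b} P" for b P
    using deg_in_dirac[OF _ that, of V 1] assms by (simp add: hdeg_single lessThan_def)
  have "Q = 0" if "deg_in (hdeg V) {..<b} Q" "dirac V (vecvar (U \<union> V) * Q) = 0" for b Q
    using that
  proof (induction b arbitrary: Q)
    case (Suc b)
    have "deg_in (hdeg V) ({b} \<union> {..<b}) Q"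
      using Suc.prems(1) by (auto elim: deg_in_mono)
    then obtain Q1 Q2 where Q: "Q = Q1 + Q2" "deg_in (hdeg V) {b} Q1" "deg_in (hdeg V) {..<b} Q2"
      using deg_in_split by blast
    \<comment> \<open>The bracketed terms have degree at most \<open>b\<close> in \<open>V\<close>,
      hence less than \<open>b\<close> after \<open>D_v\<close>, whereas \<open>D_v (v Q1)\<close>
      has degree exactly \<open>b\<close>. Equality forces both to vanish.\<close>
    have "vecvar (U \<union> V) * Q = vecvar V * Q1 - (- (vecvar U * Q1) - vecvar (U \<union> V) * Q2)"
      using assms by (simp add: Q(1) vecvar_Un algebra_simps)
    then have "dirac V (vecvar V * Q1) = dirac V (- (vecvar U * Q1) - vecvar (U \<union> V) * Q2)"
      using Suc.prems(2) by (simp only: dirac_diff right_minus_eq)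
    moreover have "deg_in (hdeg V) {..<b} (dirac V (- (vecvar U * Q1) - vecvar (U \<union> V) * Q2))"
    proof (intro D deg_in_diff deg_in_uminus)
      show "deg_in (hdeg V) {..<Suc b} (vecvar U * Q1)"
        by (rule deg_in_mult[OF _ dU Q(2)]) auto
      have "deg_in (hdeg V) {0, 1} (vecvar (U \<union> V))"
        using assms dU dV by (auto simp: vecvar_Un intro: deg_in_add elim: deg_in_mono)
      then show "deg_in (hdeg V) {..<Suc b} (vecvar (U \<union> V) * Q2)"
        by (rule deg_in_mult[OF additive_hdeg _ Q(3)]) auto
    qed
    moreover have "deg_in (hdeg V) {b} (dirac V (vecvar V * Q1))"
    proof (rule deg_in_hdeg_dirac[OF assms(2)])
      show "deg_in (hdeg V) {Suc b} (vecvar V * Q1)"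
        by (rule deg_in_mult[OF _ dV Q(2)]) auto
    qed
    ultimately have "dirac V (vecvar V * Q1) = 0"
      using deg_in_disjoint[of "hdeg V" "{..<b}" _ "{b}"] by auto
    then have "Q1 = 0" using dirac_vecvar_eq_0[OF assms(2,3) Q(2)] by blast
    then show ?case using Suc Q by simp
  qed simp
  then show ?thesis using deg_in_bounded assms(5) by blast
qed

section \<open>Existence of the Fischer decomposition and the projection \<open>P_M\<close>\<close>

lemma subspace_monogenics: "cpoly.subspace (monogenics A)"
  by (simp add: cpoly.subspace_def monogenics_def polys_add polys_pscale dirac_add dirac_pscale)

lemma subspace_monogenics_deg: "cpoly.subspace (monogenics_deg A k)"
  using subspace_monogenics[of A]
  by (auto simp: cpoly.subspace_def monogenics_deg_def homogeneous_iff deg_in_add deg_in_pscale)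

text \<open>\<open>Q\<close> is chosen with \<open>D (v Q) = D P\<close>, so that
  \<open>P - v Q\<close> is monogenic; by \<open>dirac_vecvar\<close> this is the equation of
  \<open>vecvar_dirac_solve\<close> with \<open>r = - (2 l + card V)\<close>. In degree 0 everything
  is monogenic, and \<open>Q = 0\<close> stands in for the missing degree
  \<open>k - 1\<close>.\<close>

lemma monogenic_split:
  assumes "finite V" "V \<noteq> {}" "P \<in> polys V" "homogeneous k P"
  shows "\<exists>M\<in>monogenics_deg V k. \<exists>Q\<in>polys V. P = M + vecvar V * Q \<and>
    (case k of 0 \<Rightarrow> Q = 0 | Suc l \<Rightarrow> homogeneous l Q)"
proof (cases k)
  case 0
  then have "dirac V P = 0" using assms by (simp add: polys_homogeneous_iff dirac_deg_0)
  then show ?thesis using 0 assms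
    by (intro bexI[of _ P] bexI[of _ 0]) (auto simp: monogenics_deg_def monogenics_def)
next
  case (Suc l)
  have dP: "deg_in (hdeg V) {Suc l} P" using assms Suc by (simp add: polys_homogeneous_iff)
  then have D: "deg_in (hdeg V) {l} (dirac V P)" "dirac V P \<in> polys V"
    using assms by (auto intro: deg_in_hdeg_dirac polys_dirac)
  obtain Q where Q: "Q \<in> polys V" "deg_in (hdeg V) {l} Q"
    "pscale (of_int (- int (2 * l + card V))) Q - vecvar V * dirac V Q = dirac V P"
    using vecvar_dirac_solve[OF assms(1,2) _ D, of "- int (2 * l + card V)"] by blast
  have vQ: "vecvar V * Q \<in> polys V" using Q by (intro polys_mult polys_vecvar) auto
  have "deg_in (hdeg V) {k} (vecvar V * Q)"
    by (rule deg_in_mult[OF _ deg_in_hdeg_vecvar Q(2)]) (use Suc assms in auto)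
  then have "homogeneous k (P - vecvar V * Q)"
    using assms vQ Suc dP by (simp add: polys_homogeneous_iff polys_diff deg_in_diff)
  moreover have "dirac V (P - vecvar V * Q) = 0"
  proof -
    have "of_int (- int (2 * l + card V)) = - (of_nat (2 * l + card V) :: complex)" by simp
    then show ?thesis
      unfolding dirac_diff dirac_vecvar[OF assms(1) Q(2)] Q(3)[symmetric]
      by (simp only: cpoly.scale_minus_left) simp
  qed
  ultimately have "P - vecvar V * Q \<in> monogenics_deg V k"
    using assms vQ by (simp add: monogenics_deg_def monogenics_def polys_diff)
  then show ?thesis
    using Q Suc assms by (intro bexI[of _ "P - vecvar V * Q"] bexI[of _ Q]) (auto simp: polys_homogeneous_iff)
qed

text \<open>Iterates \<open>monogenic_split\<close> on a single monomial, which is homogeneous, and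
  adds up. The bound \<open>B\<close> allows two decompositions to be extended to a common range of
  \<open>s\<close>.\<close>

lemma fischer_decomposition:
  assumes "finite A" "A \<noteq> {}" "P \<in> polys A"
  shows "\<exists>M B. (\<forall>s. M s \<in> monogenics A) \<and> (\<forall>s\<ge>B. M s = 0) \<and> P = (\<Sum>s<B. vecvar A ^ s * M s)"
  using assms(3)
proof (induction rule: polys_induct)
  case (single \<alpha> a)
  have "\<exists>M B. (\<forall>s. M s \<in> monogenics A) \<and> (\<forall>s\<ge>B. M s = 0) \<and> P = (\<Sum>s<B. vecvar A ^ s * M s)"
    if "P \<in> polys A" "homogeneous k P" for k P
    using that
  proof (induction k arbitrary: P)
    case 0
    then have "P \<in> monogenics A"
      using monogenic_split[OF assms(1,2) 0] by (auto simp: monogenics_deg_def)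
    then show ?case
      using subspace_monogenics
      by (intro exI[of _ "\<lambda>s. if s = 0 then P else 0"] exI[of _ 1]) (auto simp: cpoly.subspace_0)
  next
    case (Suc k)
    obtain M0 Q where Q: "M0 \<in> monogenics_deg A (Suc k)" "Q \<in> polys A" "homogeneous k Q" "P = M0 + vecvar A * Q"
      using monogenic_split[OF assms(1,2) Suc.prems] by auto
    obtain N B where N: "\<And>s. N s \<in> monogenics A" "\<And>s. s \<ge> B \<Longrightarrow> N s = 0"
      "Q = (\<Sum>s<B. vecvar A ^ s * N s)"
      using Suc.IH[OF Q(2,3)] by blast
    have "P = (\<Sum>s<Suc B. vecvar A ^ s * case_nat M0 N s)"
      unfolding sum.lessThan_Suc_shift Q(4) N(3) by (simp add: sum_distrib_left mult.assoc)
    then show ?case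
      using N Q(1) by (intro exI[of _ "case_nat M0 N"] exI[of _ "Suc B"])
        (auto simp: monogenics_deg_def split: nat.splits)
  qed
  moreover have "homogeneous (mdegree \<alpha>) (Poly_Mapping.single \<alpha> a)"
    by (simp add: homogeneous_def)
  ultimately show ?case using single polys_single by blast
next
  case (add P P')
  obtain M B where M: "\<And>s. M s \<in> monogenics A" "\<And>s. s \<ge> B \<Longrightarrow> M s = 0"
      "P = (\<Sum>s<B. vecvar A ^ s * M s)" using add.IH(1) by blast
  obtain M' B' where M': "\<And>s. M' s \<in> monogenics A" "\<And>s. s \<ge> B' \<Longrightarrow> M' s = 0"
      "P' = (\<Sum>s<B'. vecvar A ^ s * M' s)" using add.IH(2) by blast
  have "P = (\<Sum>s<max B B'. vecvar A ^ s * M s)"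
    unfolding M(3) using M(2) by (intro sum.mono_neutral_left) auto
  moreover have "P' = (\<Sum>s<max B B'. vecvar A ^ s * M' s)"
    unfolding M'(3) using M'(2) by (intro sum.mono_neutral_left) auto
  ultimately have "P + P' = (\<Sum>s<max B B'. vecvar A ^ s * (M s + M' s))"
    by (simp add: distrib_left sum.distrib)
  then show ?case
    using M M' subspace_monogenics
    by (intro exI[of _ "\<lambda>s. M s + M' s"] exI[of _ "max B B'"]) (auto intro: cpoly.subspace_add)
qed

text \<open>The working characterisation of \<open>P_M\<close>: any monogenic polynomial congruent
  to \<open>P\<close> modulo left multiples of \<open>x\<close> is the projection. Two candidates
  differ by a monogenic \<open>x Q'\<close>, and \<open>D x\<close> is injective.\<close>

lemma P_M_eqI:
  assumes "finite A" "A \<noteq> {}" "M0 \<in> monogenics A" "Q \<in> polys A" "P = M0 + vecvar A * Q"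
  shows "P_M A P = M0"
  unfolding P_M_def
proof (rule the_equality)
  obtain N B where N: "\<And>s. N s \<in> monogenics A" "\<And>s. s \<ge> B \<Longrightarrow> N s = 0"
    "Q = (\<Sum>s<B. vecvar A ^ s * N s)"
    using fischer_decomposition[OF assms(1,2,4)] by blast
  \<comment> \<open>Multiplying the decomposition of \<open>Q\<close> by \<open>x\<close> shifts its
    components by one and frees index 0 for \<open>M0\<close>.\<close>
  let ?M = "case_nat M0 N"
  have sub: "{s. ?M s \<noteq> 0} \<subseteq> {..<Suc B}"
  proof
    fix s assume "s \<in> {s. ?M s \<noteq> 0}"
    then show "s \<in> {..<Suc B}" using N(2)[of "s - 1"] by (cases s) (auto simp: not_le[symmetric])
  qed
  have "P = (\<Sum>s<Suc B. vecvar A ^ s * ?M s)"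
    unfolding sum.lessThan_Suc_shift assms(5) N(3) by (simp add: sum_distrib_left mult.assoc)
  also have "\<dots> = (\<Sum>s | ?M s \<noteq> 0. vecvar A ^ s * ?M s)"
    using sub by (intro sum.mono_neutral_right) auto
  finally show "\<exists>M. (\<forall>s. M s \<in> monogenics A) \<and> finite {s. M s \<noteq> 0} \<and>
      P = (\<Sum>s | M s \<noteq> 0. vecvar A ^ s * M s) \<and> M0 = M 0"
    using N(1) assms(3) finite_subset[OF sub] by (intro exI[of _ ?M]) (auto split: nat.splits)
next
  fix M0'
  assume "\<exists>M. (\<forall>s. M s \<in> monogenics A) \<and> finite {s. M s \<noteq> 0} \<and>
      P = (\<Sum>s | M s \<noteq> 0. vecvar A ^ s * M s) \<and> M0' = M 0"
  then obtain M where M: "\<And>s. M s \<in> monogenics A" "finite {s. M s \<noteq> 0}"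
    "P = (\<Sum>s | M s \<noteq> 0. vecvar A ^ s * M s)" "M0' = M 0" by blast
  obtain B where B: "{s. M s \<noteq> 0} \<subseteq> {..<B}"
    using M(2) finite_nat_iff_bounded by blast
  then have "P = (\<Sum>s<Suc B. vecvar A ^ s * M s)"
    unfolding M(3) by (intro sum.mono_neutral_left) auto
  also have "\<dots> = M0' + vecvar A * (\<Sum>s<B. vecvar A ^ s * M (Suc s))"
    unfolding sum.lessThan_Suc_shift M(4) by (simp add: sum_distrib_left mult.assoc)
  finally have eq: "M0 - M0' = vecvar A * ((\<Sum>s<B. vecvar A ^ s * M (Suc s)) - Q)"
    by (simp add: assms(5) algebra_simps)
  have "dirac A (M0 - M0') = 0"
    using assms(3) M(1)[of 0] by (simp add: monogenics_def dirac_diff M(4))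
  \<comment> \<open>With \<open>U = {}\<close> the injectivity statement needs no homogeneity of its
    argument.\<close>
  then have "(\<Sum>s<B. vecvar A ^ s * M (Suc s)) - Q = 0"
    unfolding eq using dirac_vecvar_Un_eq_0[of "{}" A, unfolded Un_empty_left] assms(1,2) by blast
  then show "M0' = M0" using eq by simp
qed

lemma P_M_decompose:
  assumes "finite A" "A \<noteq> {}" "P \<in> polys A"
  shows "P_M A P \<in> monogenics A" and "\<exists>Q\<in>polys A. P = P_M A P + vecvar A * Q"
proof -
  obtain M B where M: "\<And>s. M s \<in> monogenics A" "\<And>s. s \<ge> B \<Longrightarrow> M s = 0"
    "P = (\<Sum>s<B. vecvar A ^ s * M s)"
    using fischer_decomposition[OF assms] by blast
  let ?Q = "\<Sum>s<B. vecvar A ^ s * M (Suc s)"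
  have "P = (\<Sum>s<Suc B. vecvar A ^ s * M s)" using M by simp
  also have "\<dots> = M 0 + vecvar A * ?Q"
    unfolding sum.lessThan_Suc_shift by (simp add: sum_distrib_left mult.assoc)
  finally have eq: "P = M 0 + vecvar A * ?Q" .
  have Q: "?Q \<in> polys A"
    using M(1) by (intro polys_sum polys_mult polys_power polys_vecvar) (auto simp: monogenics_def)
  have "P_M A P = M 0" by (rule P_M_eqI[OF assms(1,2) M(1) Q eq])
  then show "P_M A P \<in> monogenics A" "\<exists>Q\<in>polys A. P = P_M A P + vecvar A * Q"
    using M(1) Q eq by auto
qed

lemma P_M_monogenic:
  "finite A \<Longrightarrow> A \<noteq> {} \<Longrightarrow> M \<in> monogenics A \<Longrightarrow> P_M A M = M"
  by (rule P_M_eqI[of _ _ 0]) auto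

lemma P_M_add:
  assumes "finite A" "A \<noteq> {}" "P \<in> polys A" "P' \<in> polys A"
  shows "P_M A (P + P') = P_M A P + P_M A P'"
proof -
  obtain Q Q' where "Q \<in> polys A" "P = P_M A P + vecvar A * Q"
    "Q' \<in> polys A" "P' = P_M A P' + vecvar A * Q'"
    using P_M_decompose(2) assms by metis
  moreover have "(M + x) + (M' + x') = (M + M') + (x + x')" for M M' x x' :: cpoly
    by (simp only: add_ac)
  ultimately have "P + P' = P_M A P + P_M A P' + vecvar A * (Q + Q')"
    by (metis distrib_left)
  then show ?thesis
    using assms P_M_decompose(1) \<open>Q \<in> polys A\<close> \<open>Q' \<in> polys A\<close>
    by (intro P_M_eqI[of _ _ "Q + Q'"] cpoly.subspace_add[OF subspace_monogenics] polys_add)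
qed

lemma P_M_pscale:
  assumes "finite A" "A \<noteq> {}" "P \<in> polys A"
  shows "P_M A (pscale c P) = pscale c (P_M A P)"
proof -
  obtain Q where Q: "Q \<in> polys A" "P = P_M A P + vecvar A * Q"
    using P_M_decompose(2) assms by metis
  then have "pscale c P = pscale c (P_M A P) + vecvar A * pscale c Q"
    by (metis cpoly.scale_right_distrib pscale_mult_right)
  then show ?thesis
    using assms P_M_decompose(1) Q
    by (intro P_M_eqI[of _ _ "pscale c Q"] cpoly.subspace_scale[OF subspace_monogenics] polys_pscale)
qed

lemma P_M_sum:
  assumes "finite A" "A \<noteq> {}" "\<And>i. i \<in> I \<Longrightarrow> f i \<in> polys A"
  shows "P_M A (\<Sum>i\<in>I. f i) = (\<Sum>i\<in>I. P_M A (f i))"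
  using assms(3)
proof (induction I rule: infinite_finite_induct)
  case (insert i I)
  then show ?case using assms(1,2) by (simp add: P_M_add polys_sum)
qed (use P_M_monogenic[OF assms(1,2) cpoly.subspace_0[OF subspace_monogenics]] in auto)

lemma P_M_homogeneous:
  assumes "finite A" "A \<noteq> {}" "P \<in> polys A" "homogeneous n P"
  shows "P_M A P \<in> monogenics_deg A n"
proof -
  obtain M Q where "M \<in> monogenics_deg A n" "Q \<in> polys A" "P = M + vecvar A * Q"
    using monogenic_split[OF assms] by blast
  then show ?thesis
    using P_M_eqI[OF assms(1,2), of M Q P] by (auto simp: monogenics_deg_def)
qed

section \<open>Products of monogenic polynomials in separate variables\<close>

text \<open>Computed on representatives in the free space. It replaces the tensor product by the
  linear span of products \<open>K * G\<close> in all that follows.\<close>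

lemma tensor_mult_tensor_prod:
  "tensor_mult ` (X \<otimes>\<^sub>C Y) = cpoly.span ((\<lambda>(K, G). K * G) ` (X \<times> Y))"
proof -
  let ?T = "{t :: ctensor_free. Poly_Mapping.keys t \<subseteq> X \<times> Y}" and ?S = "(\<lambda>(K, G). K * G) ` (X \<times> Y)"
  have "tensor_mult ` (X \<otimes>\<^sub>C Y) = free_mult ` ?T"
    by (simp add: tensor_prod_def image_image tensor_mult.abs_eq)
  also have "\<dots> = cpoly.span ?S"
  proof
    show "free_mult ` ?T \<subseteq> cpoly.span ?S"
    proof
      fix P assume "P \<in> free_mult ` ?T"
      then obtain t where t: "P = free_mult t" "Poly_Mapping.keys t \<subseteq> X \<times> Y" by blast
      have "(case x of (K, G) \<Rightarrow> pscale (Poly_Mapping.lookup t (K, G)) (K * G)) \<in> cpoly.span ?S"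
        if "x \<in> Poly_Mapping.keys t" for x
      proof -
        obtain K G where x: "x = (K, G)" by (cases x)
        then have "K * G \<in> ?S" using that t(2) by force
        then show ?thesis by (simp add: x cpoly.span_scale cpoly.span_base)
      qed
      then show "P \<in> cpoly.span ?S"
        unfolding t(1) free_mult_def by (intro cpoly.span_sum)
    qed
    show "cpoly.span ?S \<subseteq> free_mult ` ?T"
    proof
      fix P assume "P \<in> cpoly.span ?S"
      then show "P \<in> free_mult ` ?T"
      proof (induction rule: cpoly.span_induct_alt)
        case base
        show ?case by (rule image_eqI[of _ _ 0]) (auto simp: free_mult_def)
      next
        case (step c P Q)
        then obtain K G t where *: "P = K * G" "K \<in> X" "G \<in> Y" "Q = free_mult t" "t \<in> ?T" by auto
        have "Poly_Mapping.keys (fscale c (free_pair K G)) \<subseteq> X \<times> Y"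
          using *(2,3) by (auto simp: in_keys_iff lookup_single when_def split: if_splits)
        then have "fscale c (free_pair K G) + t \<in> ?T"
          using *(5) keys_add[of "fscale c (free_pair K G)" t] by blast
        moreover have "pscale c P + Q = free_mult (fscale c (free_pair K G) + t)"
          by (simp add: free_mult_add free_mult_fscale free_mult_pair *)
        ultimately show ?case by blast
      qed
    qed
  qed
  finally show ?thesis .
qed

lemma polys_hdeg_disjoint: "P \<in> polys U \<Longrightarrow> U \<inter> V = {} \<Longrightarrow> deg_in (hdeg V) {0} P"
  by (force simp: deg_in_def polys_def hdeg_def in_keys_iff intro!: sum.neutral)

lemma fischer_span:
  assumes "finite U" "U \<noteq> {}" "P \<in> polys U" "homogeneous a P"
  shows "P \<in> cpoly.span {vecvar U ^ s * K |s k K. s + k = a \<and> K \<in> monogenics_deg U k}"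
  using assms(3,4)
proof (induction a arbitrary: P)
  case 0
  then have "P \<in> monogenics_deg U 0"
    using monogenic_split[OF assms(1,2) 0] by auto
  then show ?case by (intro cpoly.span_base CollectI exI[of _ 0] exI[of _ P]) auto
next
  case (Suc a)
  let ?B = "\<lambda>a. {vecvar U ^ s * K |s k K. s + k = a \<and> K \<in> monogenics_deg U k}"
  obtain M Q where Q: "M \<in> monogenics_deg U (Suc a)" "Q \<in> polys U" "homogeneous a Q" "P = M + vecvar U * Q"
    using monogenic_split[OF assms(1,2) Suc.prems] by auto
  have "Q \<in> cpoly.span (?B a)" using Suc.IH Q by blast
  then have "vecvar U * Q \<in> cpoly.span (?B (Suc a))"
  proof (induction rule: cpoly.span_induct_alt)
    case base
    show ?case by (simp add: cpoly.span_zero)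
  next
    case (step c P Q)
    then obtain s k K where *: "P = vecvar U ^ s * K" "s + k = a" "K \<in> monogenics_deg U k" by blast
    then have "vecvar U * P = vecvar U ^ Suc s * K" "Suc s + k = Suc a" by (simp_all add: mult.assoc)
    then have "vecvar U * P \<in> cpoly.span (?B (Suc a))"
      using *(3) by (intro cpoly.span_base) blast
    then show ?case
      using step by (simp add: distrib_left pscale_mult_right cpoly.span_add cpoly.span_scale)
  qed
  moreover have "M \<in> cpoly.span (?B (Suc a))"
    using Q(1) by (intro cpoly.span_base CollectI exI[of _ 0] exI[of _ "Suc a"] exI[of _ M]) auto
  ultimately show ?case by (simp add: Q(4) cpoly.span_add)
qed

text \<open>Applying \<open>D\<close> removes \<open>Y 0\<close>; injectivity of \<open>D u\<close>
  then kills the remaining sum with one power of \<open>u\<close> taken out, hence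
  \<open>Y 0\<close> as well. The coefficients may involve variables outside \<open>U\<close>, so
  they can later be combinations of \<open>K(u) G(v)\<close>.\<close>

lemma vecvar_powers_independent:
  assumes "finite U" "U \<noteq> {}" "\<And>s. s < N \<Longrightarrow> dirac U (Y s) = 0"
    and "(\<Sum>s<N. vecvar U ^ s * Y s) = 0" "s < N"
  shows "Y s = 0"
  using assms(3-5)
proof (induction N arbitrary: Y s)
  case (Suc N)
  let ?Q = "\<Sum>s<N. vecvar U ^ s * Y (Suc s)"
  have eq: "Y 0 + vecvar U * ?Q = 0"
    using Suc.prems(2) unfolding sum.lessThan_Suc_shift by (simp add: sum_distrib_left mult.assoc)
  then have "dirac U (Y 0) + dirac U (vecvar U * ?Q) = 0"
    by (metis dirac_add dirac_0)
  then have "dirac U (vecvar U * ?Q) = 0" using Suc.prems(1)[of 0] by simp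
  then have "?Q = 0"
    using dirac_vecvar_Un_eq_0[of "{}" U, unfolded Un_empty_left] assms(1,2) by blast
  show ?case
  proof (cases s)
    case 0
    then show ?thesis using eq \<open>?Q = 0\<close> by simp
  next
    case (Suc t)
    have "Y (Suc t) = 0"
      by (rule Suc.IH[OF _ \<open>?Q = 0\<close>]) (use Suc.prems Suc in auto)
    then show ?thesis using Suc by simp
  qed
qed simp

section \<open>Two disjoint blocks of variables and the products
  \<open>u^s K(u) G(v)\<close>\<close>

locale biaxial =
  fixes U V :: "nat set"
  assumes finite_U: "finite U" and finite_V: "finite V"
    and nonempty_U: "U \<noteq> {}" and nonempty_V: "V \<noteq> {}" and disjoint: "U \<inter> V = {}"
begin

abbreviation A where "A \<equiv> U \<union> V"

lemma finite_A: "finite A" and nonempty_A: "A \<noteq> {}"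
  using finite_U finite_V nonempty_U by auto

definition factors :: "nat \<times> nat \<times> nat \<Rightarrow> cpoly set" where
  "factors = (\<lambda>(s, k, i). (\<lambda>(K, G). K * G) `
     (((\<lambda>K. vecvar U ^ s * K) ` monogenics_deg U k) \<times> monogenics_deg V i))"

text \<open>The summand before the projection: \<open>P_M\<close> maps it onto
  \<open>tau_summand\<close> (see \<open>tau_summand_eq\<close>).\<close>

definition summand :: "nat \<times> nat \<times> nat \<Rightarrow> cpoly set" where
  "summand t = cpoly.span (factors t)"

lemma factorsE:
  assumes "P \<in> factors (s, k, i)"
  obtains K G where "P = vecvar U ^ s * K * G" "K \<in> monogenics_deg U k" "G \<in> monogenics_deg V i"
  using assms by (auto simp: factors_def)

lemma polys_U_A: "P \<in> polys U \<Longrightarrow> P \<in> polys A" and polys_V_A: "P \<in> polys V \<Longrightarrow> P \<in> polys A"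
  using polys_mono by blast+

text \<open>The generators in \<open>D_v\<close> stand to the left of \<open>K\<close> and must pass
  it. As the same \<open>K'\<close> arises for each of them,
  \<open>D_v (K G) = K' D_v G\<close>.\<close>

lemma dirac_V_mult:
  assumes "K \<in> polys U" "dirac V G = 0"
  shows "dirac V (K * G) = 0"
proof -
  obtain K' where K': "\<And>j. j \<in> V \<Longrightarrow> Const (evec j) * K = K' * Const (evec j)"
    using polys_commute_vecvar[OF assms(1) disjoint] by blast
  have "Const (evec j) * pdiff j (K * G) = K' * (Const (evec j) * pdiff j G)" if "j \<in> V" for j
  proof -
    have "pdiff j (K * G) = K * pdiff j G"
    proof -
      have "j \<notin> U" using that disjoint by auto
      then show ?thesis using pdiff_eq_0[OF assms(1)] by (simp add: pdiff_mult)
    qed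
    then show ?thesis by (simp only: K'[OF that] flip: mult.assoc)
  qed
  then have "dirac V (K * G) = K' * dirac V G"
    by (simp add: dirac_def sum_distrib_left)
  then show ?thesis using assms(2) by simp
qed

lemma dirac_U_mult:
  assumes "dirac U K = 0" "G \<in> polys V"
  shows "dirac U (K * G) = 0"
proof -
  have "pdiff j (K * G) = pdiff j K * G" if "j \<in> U" for j
  proof -
    have "j \<notin> V" using that disjoint by auto
    then show ?thesis using pdiff_eq_0[OF assms(2)] by (simp add: pdiff_mult)
  qed
  then have "dirac U (K * G) = dirac U K * G"
    by (simp add: dirac_def sum_distrib_right mult.assoc)
  then show ?thesis using assms(1) by simp
qed

lemma deg_in_mdegree_vecvar: "deg_in mdegree {1} (vecvar B)"
  by (rule deg_in_vecvar) (auto simp: mdegree_single)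

text \<open>Collects what the decomposition needs, checked on generators. The first two properties
  place the projection in degree \<open>s + k + i\<close>; the third gives injectivity of
  \<open>P_M\<close>; the last allows \<open>s\<close> and \<open>i\<close> to be recovered.\<close>

lemma summand_props:
  assumes "z \<in> summand (s, k, i)"
  shows "z \<in> polys A" "homogeneous (s + k + i) z" "dirac V z = 0"
    "\<exists>y. z = vecvar U ^ s * y \<and> dirac U y = 0 \<and> deg_in (hdeg V) {i} y"
proof -
  have "z \<in> polys A \<and> homogeneous (s + k + i) z \<and> dirac V z = 0 \<and>
    (\<exists>y. z = vecvar U ^ s * y \<and> dirac U y = 0 \<and> deg_in (hdeg V) {i} y)"
    using assms unfolding summand_def
  proof (induction rule: cpoly.span_induct_alt)
    case base
    show ?case by (auto simp: homogeneous_iff intro!: exI[of _ 0])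
  next
    case (step c P z)
    obtain K G where KG: "P = vecvar U ^ s * K * G" "K \<in> monogenics_deg U k" "G \<in> monogenics_deg V i"
      using step(1) by (rule factorsE)
    obtain y where y: "z = vecvar U ^ s * y" "dirac U y = 0" "deg_in (hdeg V) {i} y"
      using step by blast
    have K: "K \<in> polys U" "dirac U K = 0" "deg_in mdegree {k} K"
      and G: "G \<in> polys V" "dirac V G = 0" "deg_in mdegree {i} G"
      using KG by (auto simp: monogenics_deg_def monogenics_def homogeneous_iff)
    have uK: "vecvar U ^ s * K \<in> polys U"
      using K by (intro polys_mult polys_power polys_vecvar) auto
    have P: "P \<in> polys A" "dirac V P = 0"
      using uK G by (auto simp: KG(1) intro: polys_mult polys_U_A polys_V_A dirac_V_mult)
    have "deg_in mdegree {s} (vecvar U ^ s)"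
      using deg_in_power[OF additive_mdegree deg_in_mdegree_vecvar] by simp
    then have "deg_in mdegree {s + k} (vecvar U ^ s * K)"
      using K(3) by (rule deg_in_mult[OF additive_mdegree]) auto
    then have "deg_in mdegree {s + k + i} P"
      unfolding KG(1) using G(3) by (rule deg_in_mult[OF additive_mdegree]) auto
    then have hom: "homogeneous (s + k + i) (pscale c P + z)"
      using step by (simp add: homogeneous_iff deg_in_add deg_in_pscale)
    have "deg_in (hdeg V) {i} (K * G)"
    proof (rule deg_in_mult[OF additive_hdeg])
      show "deg_in (hdeg V) {0} K" by (rule polys_hdeg_disjoint[OF K(1) disjoint])
      show "deg_in (hdeg V) {i} G"
        using KG(3) polys_homogeneous_iff[OF finite_V G(1)] by (simp add: monogenics_deg_def)
    qed simp
    then have d: "deg_in (hdeg V) {i} (pscale c (K * G) + y)"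
      using y by (simp add: deg_in_add deg_in_pscale)
    have "pscale c P + z = vecvar U ^ s * (pscale c (K * G) + y)"
      by (simp add: KG(1) y(1) distrib_left pscale_mult_right mult.assoc)
    moreover have "dirac U (pscale c (K * G) + y) = 0"
      using K G y by (simp add: dirac_add dirac_pscale dirac_U_mult)
    moreover have "pscale c P + z \<in> polys A" "dirac V (pscale c P + z) = 0"
      using P step by (auto simp: dirac_add dirac_pscale intro: polys_add polys_pscale)
    ultimately show ?case using hom d by blast
  qed
  then show "z \<in> polys A" "homogeneous (s + k + i) z" "dirac V z = 0"
    "\<exists>y. z = vecvar U ^ s * y \<and> dirac U y = 0 \<and> deg_in (hdeg V) {i} y" by auto
qed

lemma finite_triples: "finite {(s, k, i). s + k + i = (n::nat)}"
  by (rule finite_subset[of _ "{..n} \<times> {..n} \<times> {..n}"]) auto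

text \<open>\<open>k\<close> is determined by \<open>s\<close> and \<open>i\<close>; the outer sum
  runs over \<open>s\<close> in order to group by powers of \<open>u\<close>.\<close>

lemma sum_triples:
  "(\<Sum>t\<in>{(s, k, i). s + k + i = (n::nat)}. f t) = (\<Sum>s<Suc n. \<Sum>i<Suc (n - s). f (s, n - s - i, i))"
proof -
  have "(\<Sum>t\<in>{(s, k, i). s + k + i = n}. f t) =
      (\<Sum>(s, i)\<in>(SIGMA s:{..<Suc n}. {..<Suc (n - s)}). f (s, n - s - i, i))"
    by (rule sum.reindex_bij_witness[of _ "\<lambda>(s, i). (s, n - s - i, i)" "\<lambda>(s, k, i). (s, i)"]) auto
  also have "\<dots> = (\<Sum>s<Suc n. \<Sum>i<Suc (n - s). f (s, n - s - i, i))"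
    by (rule sum.Sigma[symmetric]) (rule finite_lessThan ballI)+
  finally show ?thesis .
qed

text \<open>Grouped by powers of \<open>u\<close>, the sum has coefficients in the kernel of
  \<open>D_u\<close>, so these vanish one by one. For fixed \<open>s\<close> the terms have distinct
  degrees \<open>i\<close> in \<open>V\<close>, so they vanish separately too.\<close>

lemma summand_independent:
  assumes "\<And>t. t \<in> {(s, k, i). s + k + i = n} \<Longrightarrow> z t \<in> summand t"
    and "(\<Sum>t\<in>{(s, k, i). s + k + i = n}. z t) = 0"
    and "s + k + i = n"
  shows "z (s, k, i) = 0"
proof -
  \<comment> \<open>The condition on the triple stays inside the existential, so that
    \<open>choice_iff\<close> yields one function \<open>y\<close> of all three indices.\<close>
  have "\<forall>s k i. \<exists>y. s + k + i = n \<longrightarrow>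
      z (s, k, i) = vecvar U ^ s * y \<and> dirac U y = 0 \<and> deg_in (hdeg V) {i} y"
    using summand_props(4)[OF assms(1)] by blast
  then have "\<exists>y. \<forall>s k i. s + k + i = n \<longrightarrow>
      z (s, k, i) = vecvar U ^ s * y s k i \<and> dirac U (y s k i) = 0 \<and> deg_in (hdeg V) {i} (y s k i)"
    by (simp only: choice_iff)
  then obtain y where y: "z (s, k, i) = vecvar U ^ s * y s k i" "dirac U (y s k i) = 0"
    "deg_in (hdeg V) {i} (y s k i)" if "s + k + i = n" for s k i
    by blast
  let ?Y = "\<lambda>s. \<Sum>i<Suc (n - s). y s (n - s - i) i"
  have "(\<Sum>s<Suc n. vecvar U ^ s * ?Y s) = 0"
  proof -
    have "(\<Sum>s<Suc n. vecvar U ^ s * ?Y s) = (\<Sum>s<Suc n. \<Sum>i<Suc (n - s). z (s, n - s - i, i))"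
      unfolding sum_distrib_left
    proof (intro sum.cong refl y(1)[symmetric])
      fix s i assume "s \<in> {..<Suc n}" "i \<in> {..<Suc (n - s)}"
      then show "s + (n - s - i) + i = n" by auto
    qed
    then show ?thesis using assms(2) unfolding sum_triples by simp
  qed
  moreover have "dirac U (?Y s) = 0" if "s < Suc n" for s
    unfolding dirac_sum
  proof (intro sum.neutral ballI y(2))
    fix i assume "i \<in> {..<Suc (n - s)}"
    then show "s + (n - s - i) + i = n" using that by auto
  qed
  ultimately have "?Y s = 0"
    using vecvar_powers_independent[OF finite_U nonempty_U, of "Suc n" ?Y s] assms(3) by auto
  then have "y s (n - s - i) i = 0"
    by (rule sum_distinct_degrees_eq_0[where d = "hdeg V" and f = "\<lambda>i. y s (n - s - i) i", rotated 2])
      (use assms(3) in \<open>auto intro!: y(3)\<close>)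
  then show ?thesis using y(1)[OF assms(3)] assms(3) by auto
qed

text \<open>Replacing \<open>v\<close> by \<open>x - u\<close> lowers the degree in \<open>v\<close>, modulo multiples of \<open>x\<close>.\<close>

lemma spanning_products:
  assumes "K \<in> polys U" "homogeneous a K" "H \<in> polys V" "homogeneous b H"
  shows "\<exists>z\<in>cpoly.span (\<Union>t\<in>{(s, k, i). s + k + i = a + b}. factors t). \<exists>Q\<in>polys A. K * H = z + vecvar A * Q"
  using assms
proof (induction b arbitrary: a K H)
  \<comment> \<open>When the second factor is already monogenic, expanding \<open>K\<close> alone
    suffices; both cases of the induction use this.\<close>
  have KM: "K * M \<in> cpoly.span (\<Union>t\<in>{(s, k, i). s + k + i = a + b}. factors t)"
    if "K \<in> polys U" "homogeneous a K" "M \<in> monogenics_deg V b" for K M a b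
    using fischer_span[OF finite_U nonempty_U that(1,2)]
  proof (induction rule: cpoly.span_induct_alt)
    case base
    show ?case by (simp add: cpoly.span_zero)
  next
    case (step c P Q)
    then obtain s k K where "P = vecvar U ^ s * K" "s + k = a" "K \<in> monogenics_deg U k" by blast
    then have "P * M \<in> (\<Union>t\<in>{(s, k, i). s + k + i = a + b}. factors t)"
      using that(3) by (intro UN_I[of "(s, k, b)"]) (auto simp: factors_def)
    then show ?case
      using step by (simp add: distrib_right pscale_mult_left cpoly.span_add cpoly.span_scale cpoly.span_base)
  qed
  {
    case 0
    then have "H \<in> monogenics_deg V 0"
      using monogenic_split[OF finite_V nonempty_V 0(3,4)] by auto
    then have "K * H \<in> cpoly.span (\<Union>t\<in>{(s, k, i). s + k + i = a + 0}. factors t)"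
      using KM 0 by blast
    then show ?case by (intro bexI[of _ "K * H"] bexI[of _ 0]) auto
  next
    case (Suc b)
    let ?Z = "cpoly.span (\<Union>t\<in>{(s, k, i). s + k + i = a + Suc b}. factors t)"
    obtain M Q where Q: "M \<in> monogenics_deg V (Suc b)" "Q \<in> polys V" "homogeneous b Q" "H = M + vecvar V * Q"
      using monogenic_split[OF finite_V nonempty_V Suc.prems(3,4)] by auto
    obtain K' where K': "K' \<in> polys U" "\<And>\<alpha>. Poly_Mapping.lookup K \<alpha> = 0 \<Longrightarrow> Poly_Mapping.lookup K' \<alpha> = 0"
      "\<And>j. j \<in> V \<Longrightarrow> Const (evec j) * K = K' * Const (evec j)"
      using polys_commute_vecvar[OF Suc.prems(1) disjoint] by blast
    \<comment> \<open>Multiplying \<open>e_j K = K' e_j\<close> by \<open>e_j\<close> on both sides,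
      with \<open>e_j\<close> squaring to \<open>- 1\<close>, gives the mirrored relation and thus
      \<open>K v = v K'\<close>.\<close>
    have "K * Const (evec j) = Const (evec j) * K'" if "j \<in> V" for j
    proof -
      have "Const (evec j) * Const (evec j) * K * Const (evec j) =
          Const (evec j) * (Const (evec j) * K) * Const (evec j)" by (simp only: mult.assoc)
      also have "\<dots> = Const (evec j) * (K' * Const (evec j)) * Const (evec j)"
        by (simp only: K'(3)[OF that])
      also have "\<dots> = Const (evec j) * K' * (Const (evec j) * Const (evec j))"
        by (simp only: mult.assoc)
      finally have "Const (evec j) * Const (evec j) * K * Const (evec j) =
          Const (evec j) * K' * (Const (evec j) * Const (evec j))" .
      then show ?thesis by (simp add: Const_evec_square)
    qed
    then have "K * (Const (evec j) * Var j) = Const (evec j) * Var j * K'" if "j \<in> V" for j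
      using that by (metis mult.assoc Var_commute)
    then have "K * vecvar V = vecvar V * K'"
      by (simp add: vecvar_def sum_distrib_left sum_distrib_right)
    then have KvQ: "K * (vecvar V * Q) = vecvar V * K' * Q" by (metis mult.assoc)
    have "vecvar V * K' = vecvar A * K' - vecvar U * K'"
      by (simp add: vecvar_Un[OF finite_U finite_V disjoint] distrib_right)
    then have "K * (vecvar V * Q) = vecvar A * (K' * Q) - vecvar U * K' * Q"
      by (simp only: KvQ left_diff_distrib mult.assoc)
    then have KH: "K * H = K * M + vecvar A * (K' * Q) - vecvar U * K' * Q"
      by (simp add: Q(4) distrib_left)
    have "homogeneous a K'"
      unfolding homogeneous_def
    proof
      fix \<alpha> assume "\<alpha> \<in> Poly_Mapping.keys K'"
      then have "\<alpha> \<in> Poly_Mapping.keys K" using K'(2)[of \<alpha>] by (auto simp: in_keys_iff)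
      then show "mdegree \<alpha> = a" using Suc.prems(2) by (simp add: homogeneous_def)
    qed
    then have "homogeneous (Suc a) (vecvar U * K')"
      unfolding homogeneous_iff
      by (intro deg_in_mult[OF additive_mdegree deg_in_mdegree_vecvar]) auto
    moreover have "vecvar U * K' \<in> polys U"
      using K' by (intro polys_mult polys_vecvar) auto
    \<comment> \<open>\<open>u K'\<close> has degree \<open>a + 1\<close> and \<open>Q\<close>
      degree \<open>b\<close>: the total degree is unchanged while the \<open>V\<close>-degree has
      dropped. This is why \<open>a\<close> and \<open>K\<close> are arbitrary in the
      induction.\<close>
    ultimately obtain z Q' where z: "z \<in> ?Z" "Q' \<in> polys A" "vecvar U * K' * Q = z + vecvar A * Q'"
      using Suc.IH[of "vecvar U * K'" "Suc a" Q] Q by auto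
    have "K * H = (K * M - z) + vecvar A * (K' * Q - Q')"
      using z(3) by (simp add: KH algebra_simps)
    moreover have "K * M - z \<in> ?Z"
      using KM[OF Suc.prems(1,2) Q(1)] z(1) by (rule cpoly.span_diff)
    moreover have "K' * Q - Q' \<in> polys A"
      using polys_diff[OF polys_mult[OF polys_U_A[OF K'(1)] polys_V_A[OF Q(2)]] z(2)] .
    ultimately show ?case by blast
  }
qed

lemma split_exponent:
  fixes \<alpha> :: "nat \<Rightarrow>\<^sub>0 nat"
  assumes "Poly_Mapping.keys \<alpha> \<subseteq> A"
  shows "\<exists>\<beta> \<gamma>. \<alpha> = \<beta> + \<gamma> \<and> Poly_Mapping.keys \<beta> \<subseteq> U \<and> Poly_Mapping.keys \<gamma> \<subseteq> V"
  using assms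
proof (induction \<alpha> rule: poly_mapping_add_induct)
  case zero
  show ?case by (intro exI[of _ 0]) auto
next
  case (single_plus j n \<alpha>)
  show ?case
  proof (cases "n = 0")
    case False
    have sub: "Poly_Mapping.keys \<alpha> \<subseteq> A" "j \<in> A"
      using single_plus.prems False
      by (auto simp: subset_iff in_keys_iff lookup_add lookup_single when_def split: if_splits)
    then obtain \<beta> \<gamma> where bg: "\<alpha> = \<beta> + \<gamma>" "Poly_Mapping.keys \<beta> \<subseteq> U" "Poly_Mapping.keys \<gamma> \<subseteq> V"
      using single_plus.IH by blast
    have s: "Poly_Mapping.keys (\<delta> + Poly_Mapping.single j n) \<subseteq> B"
      if "Poly_Mapping.keys \<delta> \<subseteq> B" "j \<in> B" for \<delta> B
      using keys_add[of \<delta> "Poly_Mapping.single j n"] that by (auto split: if_splits)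
    show ?thesis
    proof (cases "j \<in> U")
      case True
      then show ?thesis using bg s
        by (intro exI[of _ "\<beta> + Poly_Mapping.single j n"] exI[of _ \<gamma>]) (auto simp: add_ac)
    next
      case False
      then show ?thesis using bg s sub
        by (intro exI[of _ \<beta>] exI[of _ "\<gamma> + Poly_Mapping.single j n"]) (auto simp: add_ac)
    qed
  qed (use single_plus in simp)
qed

text \<open>The polynomials of the required form are a subspace, so a monomial times a blade is
  enough. Such a term splits, up to a scalar, into a \<open>U\<close>-factor and a
  \<open>V\<close>-factor, to which \<open>spanning_products\<close> applies.\<close>

lemma spanning:
  assumes "P \<in> polys A" "homogeneous n P"
  shows "\<exists>z\<in>cpoly.span (\<Union>t\<in>{(s, k, i). s + k + i = n}. factors t). \<exists>Q\<in>polys A. P = z + vecvar A * Q"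
proof -
  define Y where "Y = {P. \<exists>z\<in>cpoly.span (\<Union>t\<in>{(s, k, i). s + k + i = n}. factors t).
    \<exists>Q\<in>polys A. P = z + vecvar A * Q}"
  have Y_0: "0 \<in> Y"
    unfolding Y_def by (intro CollectI bexI[of _ 0]) (auto simp: cpoly.span_zero)
  have Y_add: "P + P' \<in> Y" if PP: "P \<in> Y" "P' \<in> Y" for P P'
  proof -
    obtain z Q z' Q' where "P = z + vecvar A * Q" "P' = z' + vecvar A * Q'" and
      *: "z \<in> cpoly.span (\<Union>t\<in>{(s, k, i). s + k + i = n}. factors t)" "Q \<in> polys A"
      "z' \<in> cpoly.span (\<Union>t\<in>{(s, k, i). s + k + i = n}. factors t)" "Q' \<in> polys A"
      using PP unfolding Y_def by blast
    then have "P + P' = (z + z') + vecvar A * (Q + Q')" by (simp add: algebra_simps)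
    then show ?thesis unfolding Y_def using * cpoly.span_add polys_add by blast
  qed
  have Y_scale: "pscale c P \<in> Y" if P: "P \<in> Y" for c P
  proof -
    obtain z Q where "P = z + vecvar A * Q" and
      *: "z \<in> cpoly.span (\<Union>t\<in>{(s, k, i). s + k + i = n}. factors t)" "Q \<in> polys A"
      using P unfolding Y_def by blast
    then have "pscale c P = pscale c z + vecvar A * pscale c Q"
      by (simp add: cpoly.scale_right_distrib pscale_mult_right)
    then show ?thesis unfolding Y_def using * cpoly.span_scale polys_pscale by blast
  qed
  have Y_single: "Poly_Mapping.single \<alpha> a \<in> Y"
    if \<alpha>: "Poly_Mapping.keys \<alpha> \<subseteq> A" "mdegree \<alpha> = n" and a: "a \<in> Cl A" for \<alpha> a
    using a
  proof (induction rule: Cl_induct)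
    case (blade c S)
    obtain \<beta> \<gamma> where bg: "\<alpha> = \<beta> + \<gamma>" "Poly_Mapping.keys \<beta> \<subseteq> U" "Poly_Mapping.keys \<gamma> \<subseteq> V"
      using split_exponent[OF \<alpha>(1)] by blast
    obtain d where d: "blade S = scalar d * (blade (S \<inter> U) * blade (S \<inter> V))"
      using blade_split[OF blade(1,2) disjoint] by blast
    have eq: "Poly_Mapping.single \<alpha> (scalar c * blade S) =
        pscale (c * d) (Poly_Mapping.single \<beta> (blade (S \<inter> U)) * Poly_Mapping.single \<gamma> (blade (S \<inter> V)))"
      by (simp add: mult_single pscale_single bg(1) d scalar_mult mult.assoc)
    have "mdegree \<beta> + mdegree \<gamma> = n"
      using \<alpha>(2) additive_mdegree by (simp add: bg(1) additive_deg_def)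
    then have "Poly_Mapping.single \<beta> (blade (S \<inter> U)) * Poly_Mapping.single \<gamma> (blade (S \<inter> V)) \<in> Y"
      unfolding Y_def using bg
      by (auto intro!: spanning_products[of _ "mdegree \<beta>" _ "mdegree \<gamma>", simplified] polys_single Cl_blade
          simp: homogeneous_def)
    then show ?case unfolding eq by (rule Y_scale)
  next
    case (add a b)
    then show ?case by (simp add: single_add Y_add)
  qed
  have "sum f I \<in> Y" if "\<And>i. i \<in> I \<Longrightarrow> f i \<in> Y" for f and I :: "(nat \<Rightarrow>\<^sub>0 nat) set"
    using that by (induction I rule: infinite_finite_induct) (auto intro: Y_0 Y_add)
  then have "(\<Sum>\<alpha>\<in>Poly_Mapping.keys P. Poly_Mapping.single \<alpha> (Poly_Mapping.lookup P \<alpha>)) \<in> Y"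
    using assms Y_single by (simp add: polys_def homogeneous_def)
  then show ?thesis
    using poly_mapping_eq_sum_single[of P] unfolding Y_def by simp
qed

lemma span_factors_decompose:
  assumes "finite I" "z \<in> cpoly.span (\<Union>t\<in>I. factors t)"
  shows "\<exists>w. (\<forall>t\<in>I. w t \<in> summand t) \<and> z = (\<Sum>t\<in>I. w t)"
  using assms(2)
proof (induction rule: cpoly.span_induct_alt)
  case base
  show ?case by (intro exI[of _ "\<lambda>_. 0"]) (auto simp: summand_def cpoly.span_zero)
next
  case (step c P z)
  then obtain t0 w where *: "t0 \<in> I" "P \<in> factors t0" "\<forall>t\<in>I. w t \<in> summand t" "z = (\<Sum>t\<in>I. w t)"
    by blast
  let ?w = "\<lambda>t. (if t = t0 then pscale c P else 0) + w t"
  have "pscale c P + z = (\<Sum>t\<in>I. ?w t)"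
    using *(1) assms(1) by (simp add: sum.distrib *(4))
  moreover have "\<forall>t\<in>I. ?w t \<in> summand t"
    using * by (auto simp: summand_def intro: cpoly.span_add cpoly.span_scale cpoly.span_base)
  ultimately show ?case by (intro exI[of _ ?w] conjI)
qed

lemma monogenic_decomposition:
  "direct_sum (monogenics_deg A n) {(s, k, i). s + k + i = n} (\<lambda>t. P_M A ` summand t)"
proof -
  let ?I = "{(s, k, i). s + k + i = n}"
  have polys: "z \<in> polys A" if "z \<in> summand t" for z t
    using summand_props(1) that by (cases t) blast
  have subspace: "cpoly.subspace (P_M A ` summand t)" for t
    unfolding cpoly.subspace_def
  proof (intro conjI ballI allI)
    show "0 \<in> P_M A ` summand t"
      by (rule image_eqI[of _ _ 0])
        (use P_M_monogenic[OF finite_A nonempty_A, of 0] in \<open>auto simp: summand_def cpoly.span_zero monogenics_def\<close>)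
    fix P Q assume "P \<in> P_M A ` summand t" "Q \<in> P_M A ` summand t"
    then obtain y z where yz: "P = P_M A y" "y \<in> summand t" "Q = P_M A z" "z \<in> summand t" by blast
    then have "P + Q = P_M A (y + z)"
      by (simp add: P_M_add[OF finite_A nonempty_A] polys)
    moreover have "y + z \<in> summand t" using yz by (simp add: summand_def cpoly.span_add)
    ultimately show "P + Q \<in> P_M A ` summand t" by blast
  next
    fix c P assume "P \<in> P_M A ` summand t"
    then obtain z where z: "P = P_M A z" "z \<in> summand t" by blast
    then have "pscale c P = P_M A (pscale c z)"
      by (simp add: P_M_pscale[OF finite_A nonempty_A] polys)
    moreover have "pscale c z \<in> summand t" using z by (simp add: summand_def cpoly.span_scale)
    ultimately show "pscale c P \<in> P_M A ` summand t" by blast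
  qed
  have subset: "P_M A ` summand t \<subseteq> monogenics_deg A n" if "t \<in> ?I" for t
    using that summand_props(1,2) P_M_homogeneous[OF finite_A nonempty_A] by fastforce
  have unique: "\<exists>!w. w \<in> Pi\<^sub>E ?I (\<lambda>t. P_M A ` summand t) \<and> P = (\<Sum>t\<in>?I. w t)"
    if P: "P \<in> monogenics_deg A n" for P
  proof (rule ex_ex1I)
    have P': "P \<in> monogenics A" "P \<in> polys A" "homogeneous n P"
      using P by (auto simp: monogenics_deg_def monogenics_def)
    obtain z Q where z: "z \<in> cpoly.span (\<Union>t\<in>?I. factors t)" "Q \<in> polys A" "P = z + vecvar A * Q"
      using spanning[OF P'(2,3)] by blast
    obtain w where w: "\<And>t. t \<in> ?I \<Longrightarrow> w t \<in> summand t" "z = (\<Sum>t\<in>?I. w t)"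
      using span_factors_decompose[OF finite_triples z(1)] by blast
    \<comment> \<open>\<open>z = P + x (- Q)\<close> shows \<open>P\<close> as the monogenic part of
      \<open>z\<close>.\<close>
    have "P_M A z = P"
      by (rule P_M_eqI[OF finite_A nonempty_A P'(1) polys_uminus[OF z(2)]]) (simp add: z(3))
    moreover have "P_M A z = (\<Sum>t\<in>?I. P_M A (w t))"
      unfolding w(2) using w(1) polys by (intro P_M_sum[OF finite_A nonempty_A]) blast
    moreover have "(\<Sum>t\<in>?I. restrict (\<lambda>t. P_M A (w t)) ?I t) = (\<Sum>t\<in>?I. P_M A (w t))"
      by (intro sum.cong refl restrict_apply')
    ultimately have "P = (\<Sum>t\<in>?I. restrict (\<lambda>t. P_M A (w t)) ?I t)" by metis
    moreover have "restrict (\<lambda>t. P_M A (w t)) ?I \<in> Pi\<^sub>E ?I (\<lambda>t. P_M A ` summand t)"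
      using w(1) by (intro restrict_PiE_iff[THEN iffD2] ballI imageI)
    ultimately show "\<exists>w. w \<in> Pi\<^sub>E ?I (\<lambda>t. P_M A ` summand t) \<and> P = (\<Sum>t\<in>?I. w t)" by blast
  next
    fix w w'
    assume w: "w \<in> Pi\<^sub>E ?I (\<lambda>t. P_M A ` summand t) \<and> P = (\<Sum>t\<in>?I. w t)"
      and w': "w' \<in> Pi\<^sub>E ?I (\<lambda>t. P_M A ` summand t) \<and> P = (\<Sum>t\<in>?I. w' t)"
    \<comment> \<open>Both families are lifted through \<open>P_M\<close> and the preimages
      themselves are shown to agree. This proves injectivity of \<open>P_M\<close> on the sum of the
      summands together with directness of that sum.\<close>
    have "\<forall>t\<in>?I. \<exists>z. z \<in> summand t \<and> w t = P_M A z" "\<forall>t\<in>?I. \<exists>z. z \<in> summand t \<and> w' t = P_M A z"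
      using w w' by (blast dest: PiE_mem)+
    then obtain y y' where y: "\<And>t. t \<in> ?I \<Longrightarrow> y t \<in> summand t \<and> w t = P_M A (y t)"
      and y': "\<And>t. t \<in> ?I \<Longrightarrow> y' t \<in> summand t \<and> w' t = P_M A (y' t)"
      by (metis (no_types, lifting) bchoice)
    let ?z = "\<lambda>t. y t - y' t"
    have z: "?z t \<in> summand t" if "t \<in> ?I" for t
      using y[OF that] y'[OF that] by (simp add: summand_def cpoly.span_diff)
    have sums: "(\<Sum>t\<in>?I. y t) \<in> polys A" "(\<Sum>t\<in>?I. y' t) \<in> polys A" "(\<Sum>t\<in>?I. ?z t) \<in> polys A"
      using y y' z polys by (blast intro: polys_sum)+
    have "P_M A (\<Sum>t\<in>?I. y t) = P"
    proof -
      have "P_M A (\<Sum>t\<in>?I. y t) = (\<Sum>t\<in>?I. P_M A (y t))"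
        using y polys by (intro P_M_sum[OF finite_A nonempty_A]) blast
      also have "\<dots> = (\<Sum>t\<in>?I. w t)"
        by (rule sum.cong[OF refl y[THEN conjunct2, symmetric]])
      finally show ?thesis using w by simp
    qed
    moreover have "P_M A (\<Sum>t\<in>?I. y' t) = P"
    proof -
      have "P_M A (\<Sum>t\<in>?I. y' t) = (\<Sum>t\<in>?I. P_M A (y' t))"
        using y' polys by (intro P_M_sum[OF finite_A nonempty_A]) blast
      also have "\<dots> = (\<Sum>t\<in>?I. w' t)"
        by (rule sum.cong[OF refl y'[THEN conjunct2, symmetric]])
      finally show ?thesis using w' by simp
    qed
    moreover have "(\<Sum>t\<in>?I. y t) = (\<Sum>t\<in>?I. ?z t) + (\<Sum>t\<in>?I. y' t)"
      by (simp flip: sum.distrib)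
    ultimately have "P_M A (\<Sum>t\<in>?I. ?z t) = 0"
      using P_M_add[OF finite_A nonempty_A sums(3,2)] by simp
    then obtain Q where Q: "(\<Sum>t\<in>?I. ?z t) = vecvar A * Q"
      using P_M_decompose(2)[OF finite_A nonempty_A sums(3)] by auto
    have "dirac V (\<Sum>t\<in>?I. ?z t) = 0"
      using z summand_props(3) unfolding dirac_sum by (fastforce intro!: sum.neutral)
    then have "Q = 0"
      unfolding Q using dirac_vecvar_Un_eq_0[OF finite_U finite_V nonempty_V disjoint] by blast
    then have "(\<Sum>t\<in>?I. ?z t) = 0" using Q by simp
    then have "?z t = 0" if "t \<in> ?I" for t
      using summand_independent[of n ?z, OF z] that by (cases t) blast
    then have "y t = y' t" if "t \<in> ?I" for t using that by simp
    then have eq: "w t = w' t" if "t \<in> ?I" for t using y[OF that] y'[OF that] that by metis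
    show "w = w'" by (rule PiE_ext[OF conjunct1[OF w] conjunct1[OF w'] eq])
  qed
  show ?thesis
    unfolding direct_sum_def
    by (intro conjI ballI finite_triples subspace_monogenics_deg subspace subset unique)
qed

end

lemma tau_summand_eq:
  "tau_summand p q t = P_M {1..p + q} ` biaxial.summand {1..p} {p + 1..p + q} t" if "p \<ge> 1" "q \<ge> 1"
proof -
  interpret biaxial "{1..p}" "{p + 1..p + q}"
    using that by unfold_locales auto
  obtain s k i where t: "t = (s, k, i)" by (cases t)
  show ?thesis
    unfolding t tau_summand_def prod.case tau_M_def summand_def factors_def tensor_mult_tensor_prod[symmetric]
    by (simp add: image_image)
qed

section \<open>Substitution\<close>

text \<open>The property of the substituted values that makes \<open>psubst\<close> multiplicative
  despite noncommuting coefficients.\<close>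

definition central :: "cpoly \<Rightarrow> bool" where
  "central f \<longleftrightarrow> (\<forall>P. f * P = P * f)"

lemma centralD: "central f \<Longrightarrow> f * P = P * f"
  by (simp add: central_def)

lemma central_1: "central 1"
  by (simp add: central_def)

lemma central_mult: "central f \<Longrightarrow> central g \<Longrightarrow> central (f * g)"
  unfolding central_def by (metis mult.assoc)

lemma central_power: "central f \<Longrightarrow> central (f ^ n)"
  by (induction n) (auto intro: central_1 central_mult)

lemma central_prod_list: "(\<And>f. f \<in> set fs \<Longrightarrow> central f) \<Longrightarrow> central (prod_list fs)"
  by (induction fs) (auto intro: central_1 central_mult)

lemma central_sum: "(\<And>i. i \<in> I \<Longrightarrow> central (f i)) \<Longrightarrow> central (sum f I)"
  by (simp add: central_def sum_distrib_left sum_distrib_right)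

lemma central_pscale_Var: "central (pscale c (Var j))"
  by (simp add: central_def pscale_mult_left pscale_mult_right Var_commute)

definition mval :: "(nat \<Rightarrow> cpoly) \<Rightarrow> (nat \<Rightarrow>\<^sub>0 nat) \<Rightarrow> cpoly" where
  "mval y \<alpha> = prod_list (map (\<lambda>j. y j ^ Poly_Mapping.lookup \<alpha> j)
     (sorted_list_of_set (Poly_Mapping.keys \<alpha>)))"

lemma psubst_eq_mval:
  "psubst y P = (\<Sum>\<alpha>\<in>Poly_Mapping.keys P. Const (Poly_Mapping.lookup P \<alpha>) * mval y \<alpha>)"
  by (simp add: psubst_def mval_def)

lemma prod_list_filter:
  "(\<And>x. x \<in> set xs \<Longrightarrow> \<not> B x \<Longrightarrow> f x = 1) \<Longrightarrow>
    prod_list (map f (filter B xs)) = prod_list (map (f :: _ \<Rightarrow> 'b::monoid_mult) xs)"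
  by (induction xs) auto

text \<open>Writing monomial values over a common range of variables lets those of
  \<open>\<alpha>\<close>, \<open>\<beta>\<close> and \<open>\<alpha> + \<beta>\<close> be compared
  factor by factor.\<close>

lemma mval_upt:
  assumes "Poly_Mapping.keys \<alpha> \<subseteq> {..<N}"
  shows "mval y \<alpha> = prod_list (map (\<lambda>j. y j ^ Poly_Mapping.lookup \<alpha> j) [0..<N])"
proof -
  have "sorted_list_of_set (Poly_Mapping.keys \<alpha>) = filter (\<lambda>j. j \<in> Poly_Mapping.keys \<alpha>) [0..<N]"
    using assms by (intro sorted_distinct_set_unique) (auto intro: sorted_wrt_filter)
  then show ?thesis
    unfolding mval_def by (simp only:) (rule prod_list_filter, simp add: in_keys_iff)
qed

lemma prod_list_map_mult:
  assumes "\<And>j. central (g j)"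
  shows "prod_list (map (\<lambda>j. f j * g j) xs) = prod_list (map f xs) * prod_list (map g xs)"
proof (induction xs)
  case (Cons j xs)
  have "f j * g j * (prod_list (map f xs) * prod_list (map g xs)) =
      f j * (g j * prod_list (map f xs)) * prod_list (map g xs)" by (simp only: mult.assoc)
  also have "\<dots> = f j * (prod_list (map f xs) * g j) * prod_list (map g xs)"
    by (simp only: centralD[OF assms])
  finally show ?case using Cons by (simp add: mult.assoc)
qed simp

lemma mval_add:
  assumes "\<And>j. central (y j)"
  shows "mval y (\<alpha> + \<beta>) = mval y \<alpha> * mval y \<beta>"
proof -
  have "finite (Poly_Mapping.keys \<alpha> \<union> Poly_Mapping.keys \<beta>)" by simp
  then obtain N where N: "Poly_Mapping.keys \<alpha> \<union> Poly_Mapping.keys \<beta> \<subseteq> {..<N}"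
    using finite_nat_iff_bounded by blast
  then have "Poly_Mapping.keys (\<alpha> + \<beta>) \<subseteq> {..<N}" using keys_add[of \<alpha> \<beta>] by blast
  then show ?thesis
    using N by (simp add: mval_upt[of _ N] lookup_add power_add prod_list_map_mult central_power assms)
qed

lemma central_mval: "(\<And>j. central (y j)) \<Longrightarrow> central (mval y \<alpha>)"
  unfolding mval_def by (rule central_prod_list) (auto intro: central_power)

lemma psubst_superset:
  assumes "finite F" "Poly_Mapping.keys P \<subseteq> F"
  shows "psubst y P = (\<Sum>\<alpha>\<in>F. Const (Poly_Mapping.lookup P \<alpha>) * mval y \<alpha>)"
  unfolding psubst_eq_mval using assms by (intro sum.mono_neutral_left) (auto simp: in_keys_iff)

lemma psubst_0 [simp]: "psubst y 0 = 0"
  by (simp add: psubst_eq_mval)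

lemma psubst_single: "psubst y (Poly_Mapping.single \<alpha> a) = Const a * mval y \<alpha>"
  by (subst psubst_superset[of "{\<alpha>}"]) auto

lemma psubst_Const [simp]: "psubst y (Const a) = Const a"
  by (simp add: psubst_single mval_def)

lemma psubst_1 [simp]: "psubst y 1 = 1"
  using psubst_Const[of y 1] by simp

lemma psubst_Var [simp]: "psubst y (Var j) = y j"
  by (simp add: Var_def psubst_single mval_def)

lemma psubst_add: "psubst y (P + Q) = psubst y P + psubst y Q"
proof -
  let ?F = "Poly_Mapping.keys P \<union> Poly_Mapping.keys Q"
  have "Poly_Mapping.keys (P + Q) \<subseteq> ?F" by (rule keys_add)
  then show ?thesis
    by (simp add: psubst_superset[of ?F] lookup_add single_add distrib_right sum.distrib)
qed

lemma psubst_sum: "psubst y (\<Sum>i\<in>I. f i) = (\<Sum>i\<in>I. psubst y (f i))"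
  by (induction I rule: infinite_finite_induct) (simp_all add: psubst_add)

lemma psubst_mult:
  assumes "\<And>j. central (y j)"
  shows "psubst y (P * Q) = psubst y P * psubst y Q"
proof (induction P rule: poly_mapping_add_induct)
  case (single_plus \<alpha> a P)
  have "psubst y (Poly_Mapping.single \<alpha> a * Q) = psubst y (Poly_Mapping.single \<alpha> a) * psubst y Q"
  proof (induction Q rule: poly_mapping_add_induct)
    case (single_plus \<beta> b Q)
    have "Const (a * b) * (mval y \<alpha> * mval y \<beta>) = Const a * (Const b * mval y \<alpha>) * mval y \<beta>"
      by (simp add: mult.assoc flip: mult_single[of 0 a 0 b, simplified])
    also have "\<dots> = Const a * (mval y \<alpha> * Const b) * mval y \<beta>"
      by (simp only: centralD[OF central_mval[OF assms], where P = "Const b"])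
    also have "\<dots> = Const a * mval y \<alpha> * (Const b * mval y \<beta>)"
      by (simp only: mult.assoc)
    finally show ?case
      using single_plus by (simp add: distrib_left psubst_add mult_single psubst_single mval_add assms)
  qed simp
  with single_plus show ?case by (simp add: distrib_right psubst_add)
qed simp

lemma psubst_pscale: "(\<And>j. central (y j)) \<Longrightarrow> psubst y (pscale c P) = pscale c (psubst y P)"
  by (simp add: pscale_def psubst_mult)

lemma psubst_cong:
  assumes "P \<in> polys A" "\<And>j. j \<in> A \<Longrightarrow> y j = z j"
  shows "psubst y P = psubst z P"
proof -
  have "mval y \<alpha> = mval z \<alpha>" if "Poly_Mapping.keys \<alpha> \<subseteq> A" for \<alpha>
    unfolding mval_def using that assms(2) by (intro arg_cong[of _ _ prod_list] map_cong) auto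
  then show ?thesis
    using assms(1) unfolding psubst_eq_mval by (intro sum.cong) (auto simp: polys_def)
qed

lemma polys_psubst:
  assumes "P \<in> polys A" "\<And>j. central (y j)" "\<And>j. j \<in> A \<Longrightarrow> y j \<in> polys A"
  shows "psubst y P \<in> polys A"
  using assms(1)
  by (induction rule: polys_ring_induct)
    (simp_all add: polys_Const assms(2,3) psubst_add psubst_mult polys_add polys_mult)

lemma homogeneous_psubst:
  assumes "homogeneous k P" "\<And>j. homogeneous 1 (y j)"
  shows "homogeneous k (psubst y P)"
proof -
  have y: "deg_in mdegree {e} (y j ^ e)" for j e
    using deg_in_power[OF additive_mdegree, of 1 "y j" e] assms(2) by (simp add: homogeneous_iff)
  have "deg_in mdegree {sum_list (map e xs)} (prod_list (map (\<lambda>j. y j ^ e j) xs))" for e xs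
  proof (induction xs)
    case Nil
    show ?case using deg_in_Const[OF additive_mdegree, of 1] by simp
  next
    case (Cons j xs)
    show ?case
      unfolding list.map prod_list.Cons sum_list.Cons
      by (rule deg_in_mult[OF additive_mdegree y Cons]) simp
  qed
  moreover have "mdegree \<alpha> =
      sum_list (map (Poly_Mapping.lookup \<alpha>) (sorted_list_of_set (Poly_Mapping.keys \<alpha>)))" for \<alpha>
    by (simp add: mdegree_def sum_list_distinct_conv_sum_set)
  ultimately have mval: "deg_in mdegree {mdegree \<alpha>} (mval y \<alpha>)" for \<alpha>
    unfolding mval_def by simp
  have "deg_in mdegree {k} (mval y \<alpha>)" if "\<alpha> \<in> Poly_Mapping.keys P" for \<alpha>
    using mval[of \<alpha>] assms(1) that by (simp add: homogeneous_def)
  then show ?thesis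
    unfolding homogeneous_iff psubst_eq_mval
    by (intro deg_in_sum deg_in_Const_mult additive_mdegree)
qed

section \<open>Rotations\<close>

definition linear_form :: "nat set \<Rightarrow> (nat \<Rightarrow> nat \<Rightarrow> complex) \<Rightarrow> nat \<Rightarrow> cpoly" where
  "linear_form A R j = (\<Sum>k\<in>A. pscale (R k j) (Var k))"

lemma central_linear_form: "central (linear_form A R j)"
  unfolding linear_form_def by (intro central_sum central_pscale_Var)

lemma L_act_eq: "L_act A s P = Const s * psubst (linear_form A (\<lambda>k j. bcoeff (cliff_inv s * evec k * s) {j})) P"
  by (simp add: L_act_def linear_form_def[abs_def])

lemma bcoeff_linear_combination:
  assumes "finite A"
  shows "bcoeff (\<Sum>l\<in>A. scalar (c l) * evec l) {j} = (if j \<in> A then c j else 0)"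
proof -
  have "bcoeff (\<Sum>l\<in>A. scalar (c l) * evec l) {j} = (\<Sum>l\<in>A. if l = j then c j else 0)"
    unfolding bcoeff_sum scalar_times_bcoeff blade.rep_eq by (intro sum.cong) auto
  then show ?thesis using assms by simp
qed

text \<open>\<open>R\<close> is the matrix of \<open>x \<mapsto> s^-1 x s\<close> and
  \<open>s'\<close> is the inverse of \<open>s\<close>. The conditions hold for unit vectors and
  pass to products, so they cover the spin group without reference to
  \<open>cliff_inv\<close>.\<close>

locale rotation =
  fixes A :: "nat set" and s s' :: cliff and R :: "nat \<Rightarrow> nat \<Rightarrow> complex"
  assumes finite: "finite A" and Cl: "s \<in> Cl A" and inverse: "s * s' = 1" "s' * s = 1"
    and conj: "\<And>k. k \<in> A \<Longrightarrow> s' * evec k * s = (\<Sum>j\<in>A. scalar (R k j) * evec j)"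
    and orthogonal: "\<And>j l. j \<in> A \<Longrightarrow> l \<in> A \<Longrightarrow> (\<Sum>k\<in>A. R k j * R k l) = (if j = l then 1 else 0)"
begin

lemma cliff_inv_eq: "cliff_inv s = s'"
  unfolding cliff_inv_def
proof (rule the_equality)
  fix b assume "s * b = 1 \<and> b * s = 1"
  then show "b = s'" using inverse by (metis mult.assoc mult_1_left mult_1_right)
qed (use inverse in simp)

definition act :: "cpoly \<Rightarrow> cpoly" where
  "act P = Const s * psubst (linear_form A R) P"

text \<open>The entries \<open>R k j\<close> with \<open>j\<close> outside \<open>A\<close> are
  unconstrained, so the two substitutions are compared only on \<open>polys A\<close>.\<close>

lemma L_act_eq_act: "P \<in> polys A \<Longrightarrow> L_act A s P = act P"
  unfolding L_act_eq act_def
  by (intro arg_cong[of _ _ "(*) _"] psubst_cong)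
    (auto simp: linear_form_def cliff_inv_eq conj finite bcoeff_linear_combination intro!: sum.cong)

lemma linear_form_polys: "linear_form A R j \<in> polys A"
  unfolding linear_form_def by (intro polys_sum polys_pscale polys_Var)

lemma linear_form_homogeneous: "homogeneous 1 (linear_form A R j)"
  unfolding linear_form_def homogeneous_iff
  using deg_in_Var[of mdegree] by (intro deg_in_sum deg_in_pscale additive_mdegree) (simp add: mdegree_single)

lemma act_0 [simp]: "act 0 = 0"
  by (simp add: act_def)

lemma act_add: "act (P + Q) = act P + act Q"
  by (simp add: act_def psubst_add distrib_left)

lemma act_polys: "P \<in> polys A \<Longrightarrow> act P \<in> polys A"
  unfolding act_def
  by (intro polys_mult polys_Const Cl polys_psubst central_linear_form linear_form_polys)

lemma act_homogeneous: "homogeneous k P \<Longrightarrow> homogeneous k (act P)"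
  using homogeneous_psubst[OF _ linear_form_homogeneous]
  by (simp add: act_def homogeneous_iff deg_in_Const_mult)

text \<open>The vector variable transforms by conjugation; in \<open>act\<close> the leading
  \<open>s\<close> cancels \<open>s'\<close>, so multiplication by \<open>x\<close> commutes with
  \<open>act\<close>.\<close>

lemma psubst_vecvar: "psubst (linear_form A R) (vecvar A) = Const s' * vecvar A * Const s"
proof -
  have "psubst (linear_form A R) (vecvar A) = (\<Sum>j\<in>A. \<Sum>k\<in>A. Const (scalar (R k j) * evec j) * Var k)"
    unfolding vecvar_def psubst_sum psubst_mult[OF central_linear_form] psubst_Const psubst_Var
      linear_form_def sum_distrib_left pscale_mult_right
    by (simp add: pscale_def Const_times mult.assoc[symmetric])
  also have "\<dots> = (\<Sum>k\<in>A. Const (s' * evec k * s) * Var k)"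
  proof (subst sum.swap, intro sum.cong refl)
    fix k assume "k \<in> A"
    show "(\<Sum>j\<in>A. Const (scalar (R k j) * evec j) * Var k) = Const (s' * evec k * s) * Var k"
      unfolding sum_distrib_right[symmetric] Const_sum conj[OF \<open>k \<in> A\<close>] ..
  qed
  also have "\<dots> = Const s' * vecvar A * Const s"
    unfolding vecvar_def sum_distrib_left sum_distrib_right
  proof (intro sum.cong refl)
    fix k
    have "Const s' * (Const (evec k) * Var k) * Const s = Const s' * Const (evec k) * (Var k * Const s)"
      by (simp only: mult.assoc)
    also have "\<dots> = Const s' * Const (evec k) * Const s * Var k"
      by (simp only: mult.assoc Var_commute)
    finally show "Const (s' * evec k * s) * Var k = Const s' * (Const (evec k) * Var k) * Const s"
      by (simp only: Const_times)
  qed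
  finally show ?thesis .
qed

lemma act_vecvar_mult: "act (vecvar A * P) = vecvar A * act P"
proof -
  have "act (vecvar A * P) = Const s * Const s' * vecvar A * Const s * psubst (linear_form A R) P"
    by (simp only: act_def psubst_mult[OF central_linear_form] psubst_vecvar mult.assoc)
  then show ?thesis by (simp add: act_def Const_times inverse mult.assoc)
qed

lemma act_vecvar_power_mult: "act (vecvar A ^ n * P) = vecvar A ^ n * act P"
  by (induction n) (simp_all add: mult.assoc act_vecvar_mult)

text \<open>The chain rule for a linear substitution. Both sides satisfy the Leibniz rule along the
  substitution, so constants and variables decide.\<close>

lemma pdiff_psubst:
  assumes "P \<in> polys A" "k \<in> A"
  shows "pdiff k (psubst (linear_form A R) P) = (\<Sum>j\<in>A. pscale (R k j) (psubst (linear_form A R) (pdiff j P)))"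
  using assms(1)
proof (induction rule: polys_ring_induct)
  case (Var l)
  have "pdiff k (linear_form A R l) = (\<Sum>i\<in>A. if i = k then pscale (R k l) 1 else 0)"
    unfolding linear_form_def pdiff_sum pdiff_pscale pdiff_Var by (intro sum.cong) auto
  also have "\<dots> = (\<Sum>j\<in>A. if j = l then pscale (R k l) 1 else 0)"
    using finite Var assms(2) by simp
  also have "\<dots> = (\<Sum>j\<in>A. pscale (R k j) (psubst (linear_form A R) (pdiff j (Var l))))"
    unfolding pdiff_Var by (intro sum.cong) auto
  finally show ?case by simp
next
  case (add P P')
  then show ?case
    by (simp add: psubst_add pdiff_add cpoly.scale_right_distrib sum.distrib)
next
  case (mult P P')
  then show ?case
    by (simp add: psubst_mult[OF central_linear_form] psubst_add pdiff_mult cpoly.scale_right_distrib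
        sum.distrib sum_distrib_left sum_distrib_right pscale_mult_left pscale_mult_right)
qed simp

text \<open>\<open>conj\<close> gives \<open>e_k s = s (\<Sum> R k l e_l)\<close>; orthogonality of
  \<open>R\<close> inverts this. It is the identity that makes \<open>D\<close> commute with
  \<open>act\<close>.\<close>

lemma rotate_back:
  assumes "j \<in> A"
  shows "(\<Sum>k\<in>A. scalar (R k j) * (evec k * s)) = s * evec j"
proof -
  have "(\<Sum>k\<in>A. scalar (R k j) * (evec k * s)) = (\<Sum>k\<in>A. s * (scalar (R k j) * (s' * evec k * s)))"
  proof (intro sum.cong refl)
    fix k
    have "s * (scalar (R k j) * (s' * evec k * s)) = scalar (R k j) * (s * s' * evec k * s)"
      by (metis scalar_commute mult.assoc)
    then show "scalar (R k j) * (evec k * s) = s * (scalar (R k j) * (s' * evec k * s))"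
      by (simp add: inverse)
  qed
  also have "\<dots> = s * (\<Sum>k\<in>A. scalar (R k j) * (s' * evec k * s))"
    by (simp only: sum_distrib_left)
  also have "(\<Sum>k\<in>A. scalar (R k j) * (s' * evec k * s)) = (\<Sum>k\<in>A. \<Sum>l\<in>A. scalar (R k j * R k l) * evec l)"
  proof (intro sum.cong refl)
    fix k assume "k \<in> A"
    show "scalar (R k j) * (s' * evec k * s) = (\<Sum>l\<in>A. scalar (R k j * R k l) * evec l)"
      unfolding conj[OF \<open>k \<in> A\<close>] sum_distrib_left by (simp only: scalar_mult mult.assoc)
  qed
  also have "(\<Sum>k\<in>A. \<Sum>l\<in>A. scalar (R k j * R k l) * evec l) = (\<Sum>l\<in>A. scalar (\<Sum>k\<in>A. R k j * R k l) * evec l)"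
    by (subst sum.swap) (simp add: scalar_sum sum_distrib_right)
  also have "\<dots> = (\<Sum>l\<in>A. if l = j then evec j else 0)"
    using orthogonal assms by (intro sum.cong) auto
  also have "\<dots> = evec j" using finite assms by simp
  finally show ?thesis .
qed

lemma dirac_act:
  assumes "P \<in> polys A"
  shows "dirac A (act P) = act (dirac A P)"
proof -
  let ?S = "psubst (linear_form A R)"
  have "dirac A (act P) = (\<Sum>k\<in>A. \<Sum>j\<in>A. Const (scalar (R k j) * (evec k * s)) * ?S (pdiff j P))"
    unfolding dirac_def act_def pdiff_Const_mult
  proof (intro sum.cong refl)
    fix k assume "k \<in> A"
    show "Const (evec k) * (Const s * pdiff k (?S P)) =
        (\<Sum>j\<in>A. Const (scalar (R k j) * (evec k * s)) * ?S (pdiff j P))"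
      unfolding pdiff_psubst[OF assms \<open>k \<in> A\<close>] sum_distrib_left pscale_mult_right
      by (simp add: pscale_def Const_times mult.assoc[symmetric])
  qed
  \<comment> \<open>After exchanging the sums, the coefficients collected over \<open>k\<close> are
    exactly those of \<open>rotate_back\<close>.\<close>
  also have "\<dots> = (\<Sum>j\<in>A. Const (s * evec j) * ?S (pdiff j P))"
    by (subst sum.swap) (simp add: Const_sum rotate_back flip: sum_distrib_right)
  also have "\<dots> = act (dirac A P)"
    by (simp add: act_def dirac_def psubst_sum psubst_mult[OF central_linear_form] sum_distrib_left
        Const_times mult.assoc[symmetric])
  finally show ?thesis .
qed

lemma act_monogenics: "P \<in> monogenics A \<Longrightarrow> act P \<in> monogenics A"
  by (simp add: monogenics_def act_polys dirac_act)

lemma act_monogenics_deg: "P \<in> monogenics_deg A k \<Longrightarrow> act P \<in> monogenics_deg A k"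
  by (simp add: monogenics_deg_def act_monogenics act_homogeneous)

lemma act_P_M:
  assumes "A \<noteq> {}" "P \<in> polys A"
  shows "act (P_M A P) = P_M A (act P)"
proof -
  obtain Q where Q: "Q \<in> polys A" "P = P_M A P + vecvar A * Q"
    using P_M_decompose(2)[OF finite assms] by blast
  have "act P = act (P_M A P) + vecvar A * act Q"
    by (subst Q(2)) (simp add: act_add act_vecvar_mult)
  then show ?thesis
    using P_M_eqI[OF finite assms(1) act_monogenics[OF P_M_decompose(1)[OF finite assms]] act_polys[OF Q(1)]]
    by simp
qed

end

section \<open>Products of unit vectors act as rotations\<close>

lemma rotation_1: "finite A \<Longrightarrow> rotation A 1 1 (\<lambda>k j. if k = j then 1 else 0)"
proof
  fix k assume "finite A" "k \<in> A"
  have "(\<Sum>j\<in>A. scalar (if k = j then 1 else 0) * evec j) = (\<Sum>j\<in>A. if k = j then evec j else 0)"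
    by (intro sum.cong) auto
  then show "1 * evec k * 1 = (\<Sum>j\<in>A. scalar (if k = j then 1 else 0) * evec j)"
    using \<open>finite A\<close> \<open>k \<in> A\<close> by simp
next
  fix j l assume "finite A" "j \<in> A" "l \<in> A"
  have "(\<Sum>k\<in>A. (if k = j then 1 else 0) * (if k = l then 1 else 0)) =
      (\<Sum>k\<in>A. if k = j then if j = l then 1 else 0 else (0 :: complex))"
    by (intro sum.cong) auto
  then show "(\<Sum>k\<in>A. (if k = j then 1 else 0) * (if k = l then 1 else 0)) = (if j = l then 1 else (0 :: complex))"
    using \<open>finite A\<close> \<open>j \<in> A\<close> by simp
qed auto

text \<open>Conjugation by \<open>s * t\<close> applies \<open>s\<close> first and then
  \<open>t\<close>, whence the matrix product in the order \<open>R\<close>,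
  \<open>T\<close>.\<close>

lemma rotation_mult:
  assumes "rotation A s s' R" "rotation A t t' T"
  shows "rotation A (s * t) (t' * s') (\<lambda>k l. \<Sum>j\<in>A. R k j * T j l)"
proof -
  interpret s: rotation A s s' R by fact
  interpret t: rotation A t t' T by fact
  show ?thesis
  proof
    show "s * t * (t' * s') = 1" "t' * s' * (s * t) = 1"
      using s.inverse t.inverse by (metis mult.assoc mult_1_right)+
    show "s * t \<in> Cl A" by (rule Cl_mult[OF s.Cl t.Cl])
  next
    fix k assume "k \<in> A"
    have "t' * s' * evec k * (s * t) = t' * (s' * evec k * s) * t" by (simp only: mult.assoc)
    also have "\<dots> = (\<Sum>j\<in>A. scalar (R k j) * (t' * evec j * t))"
      unfolding s.conj[OF \<open>k \<in> A\<close>] sum_distrib_left sum_distrib_right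
      by (intro sum.cong refl) (metis scalar_commute mult.assoc)
    also have "\<dots> = (\<Sum>j\<in>A. \<Sum>l\<in>A. scalar (R k j * T j l) * evec l)"
    proof (intro sum.cong refl)
      fix j assume "j \<in> A"
      show "scalar (R k j) * (t' * evec j * t) = (\<Sum>l\<in>A. scalar (R k j * T j l) * evec l)"
        unfolding t.conj[OF \<open>j \<in> A\<close>] sum_distrib_left by (simp only: scalar_mult mult.assoc)
    qed
    also have "\<dots> = (\<Sum>l\<in>A. scalar (\<Sum>j\<in>A. R k j * T j l) * evec l)"
      by (subst sum.swap) (simp add: scalar_sum sum_distrib_right)
    finally show "t' * s' * evec k * (s * t) = (\<Sum>l\<in>A. scalar (\<Sum>j\<in>A. R k j * T j l) * evec l)" .
  next
    fix i l assume il: "i \<in> A" "l \<in> A"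
    have "(\<Sum>k\<in>A. (\<Sum>j\<in>A. R k j * T j i) * (\<Sum>j\<in>A. R k j * T j l)) =
        (\<Sum>k\<in>A. \<Sum>j\<in>A. \<Sum>j'\<in>A. T j i * T j' l * (R k j * R k j'))"
      by (simp add: sum_product mult_ac)
    also have "\<dots> = (\<Sum>j\<in>A. \<Sum>j'\<in>A. T j i * T j' l * (\<Sum>k\<in>A. R k j * R k j'))"
      unfolding sum_distrib_left by (rule trans[OF sum.swap sum.cong[OF refl sum.swap]])
    also have "\<dots> = (\<Sum>j\<in>A. \<Sum>j'\<in>A. if j' = j then T j i * T j l else 0)"
      by (intro sum.cong refl) (auto simp: s.orthogonal)
    also have "\<dots> = (if i = l then 1 else 0)"
      using s.finite t.orthogonal[OF il] by simp
    finally show "(\<Sum>k\<in>A. (\<Sum>j\<in>A. R k j * T j i) * (\<Sum>j\<in>A. R k j * T j l)) = (if i = l then 1 else 0)" .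
  qed (rule s.finite)
qed

text \<open>Including \<open>k\<close> outside \<open>A\<close>, where the right-hand side is 0,
  provides the anticommutation used for \<open>Spin_commute_evec\<close>.\<close>

lemma cvec_evec: "cvec A x * evec k + evec k * cvec A x = scalar (- 2 * (if k \<in> A then x k else 0))" if "finite A"
proof -
  have "cvec A x * evec k + evec k * cvec A x = (\<Sum>j\<in>A. scalar (x j) * (evec j * evec k + evec k * evec j))"
  proof -
    have "evec k * (scalar c * evec j) = scalar c * (evec k * evec j)" for c j
      by (metis scalar_commute mult.assoc)
    then show ?thesis
      by (simp add: cvec_def sum_distrib_left sum_distrib_right distrib_left sum.distrib mult.assoc)
  qed
  also have "\<dots> = (\<Sum>j\<in>A. if j = k then scalar (- 2 * x k) else 0)"
  proof -
    have "(- 2 :: cliff) = scalar (- 2)"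
      by (metis scalar_of_nat scalar_uminus of_nat_numeral)
    then have "scalar c * (- 2) = scalar (- 2 * c)" for c
      by (simp only: scalar_mult) (rule scalar_commute[symmetric])
    then show ?thesis by (intro sum.cong refl) (auto simp: evec_anticommute)
  qed
  also have "\<dots> = scalar (- 2 * (if k \<in> A then x k else 0))" using that by simp
  finally show ?thesis .
qed

lemma cliff_double_cancel:
  assumes "a + a = b + b" shows "a = (b :: cliff)"
proof (rule cliff_eqI)
  fix S
  have "bcoeff (a + a) S = bcoeff (b + b) S" using assms by simp
  then show "bcoeff a S = bcoeff b S" by (simp add: plus_cliff.rep_eq)
qed

text \<open>From \<open>w * w = - 1\<close> the inverse is \<open>- w\<close>, and conjugation sends
  \<open>e_k\<close> to \<open>2 x_k w - e_k\<close>, the negative of the reflection along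
  \<open>w\<close>. Its matrix, twice the rank-one projection minus the identity, is symmetric and
  squares to the identity.\<close>

lemma rotation_unit_vector:
  assumes "finite A" "w \<in> unit_vectors A"
  shows "\<exists>R. rotation A w (- w) R"
proof -
  obtain x0 where x0: "w = cvec A (\<lambda>j. complex_of_real (x0 j))" "(\<Sum>j\<in>A. (x0 j)\<^sup>2) = 1"
    using assms(2) by (auto simp: unit_vectors_def)
  define x where "x j = complex_of_real (x0 j)" for j
  have w: "w = (\<Sum>j\<in>A. scalar (x j) * evec j)" and norm: "(\<Sum>j\<in>A. x j * x j) = 1"
  proof -
    show "w = (\<Sum>j\<in>A. scalar (x j) * evec j)" by (simp add: x0 cvec_def x_def)
    have "(\<Sum>j\<in>A. x j * x j) = complex_of_real (\<Sum>j\<in>A. (x0 j)\<^sup>2)"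
      by (simp add: x_def power2_eq_square)
    then show "(\<Sum>j\<in>A. x j * x j) = 1" by (simp add: x0)
  qed
  have we: "w * evec k = - (evec k * w) - scalar (2 * x k)" if "k \<in> A" for k
    using cvec_evec[OF assms(1), of x k] that w
    by (simp add: cvec_def scalar_uminus eq_neg_iff_add_eq_0 algebra_simps)
  have ww: "w * w = - 1"
  proof -
    \<comment> \<open>Expanding the right factor only and moving \<open>e_k\<close> to the left
      reproduces \<open>w * w\<close> with opposite sign, so the value is found from
      \<open>2 w^2 = - 2\<close>.\<close>
    have "w * w = (\<Sum>k\<in>A. scalar (x k) * (w * evec k))"
    proof -
      have "w * w = w * (\<Sum>k\<in>A. scalar (x k) * evec k)" using w by simp
      also have "\<dots> = (\<Sum>k\<in>A. scalar (x k) * (w * evec k))"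
        unfolding sum_distrib_left by (intro sum.cong refl) (metis scalar_commute mult.assoc)
      finally show ?thesis .
    qed
    also have "\<dots> = (\<Sum>k\<in>A. - (scalar (x k) * evec k * w) - scalar (2 * (x k * x k)))"
    proof (intro sum.cong refl)
      fix k assume "k \<in> A"
      have "scalar (x k) * scalar (2 * x k) = scalar (2 * (x k * x k))"
        unfolding scalar_mult[symmetric] by (simp add: mult_ac)
      then show "scalar (x k) * (w * evec k) = - (scalar (x k) * evec k * w) - scalar (2 * (x k * x k))"
        unfolding we[OF \<open>k \<in> A\<close>] by (simp only: right_diff_distrib mult_minus_right mult.assoc)
    qed
    also have "\<dots> = - ((\<Sum>k\<in>A. scalar (x k) * evec k) * w) - scalar (2 * (\<Sum>k\<in>A. x k * x k))"
      by (simp add: sum_subtractf sum_negf sum_distrib_right sum_distrib_left scalar_sum)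
    also have "\<dots> = - (w * w) - scalar 2" using w norm by simp
    finally have "w * w = - (w * w) - scalar 2" .
    then have "w * w + w * w = w * w + (- (w * w) - scalar 2)" by (rule arg_cong)
    then have "w * w + w * w = - scalar 2" by (simp only: diff_conv_add_uminus add_minus_cancel)
    also have "scalar 2 = 1 + 1" using scalar_add[of 1 1] by simp
    finally have "w * w + w * w = - 1 + - 1" by simp
    then show ?thesis by (rule cliff_double_cancel)
  qed
  show ?thesis
  proof (intro exI[of _ "\<lambda>k j. 2 * (x k * x j) - (if k = j then 1 else 0)"], unfold_locales)
    show "w \<in> Cl A" unfolding w by (intro Cl_sum Cl_mult Cl_scalar Cl_blade) auto
    show "w * - w = 1" "- w * w = 1" by (simp_all add: ww)
  next
    fix k assume "k \<in> A"
    have "- w * evec k * w = (evec k * w + scalar (2 * x k)) * w"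
      using we[OF \<open>k \<in> A\<close>] by (simp add: add.commute)
    also have "\<dots> = evec k * (w * w) + scalar (2 * x k) * w"
      by (simp add: distrib_right mult.assoc)
    also have "\<dots> = scalar (2 * x k) * w - evec k" by (simp add: ww)
    also have "scalar (2 * x k) * w = (\<Sum>j\<in>A. scalar (2 * (x k * x j)) * evec j)"
      by (subst w) (simp add: sum_distrib_left scalar_mult mult.assoc)
    also have "\<dots> - evec k = (\<Sum>j\<in>A. scalar (2 * (x k * x j)) * evec j - (if k = j then evec j else 0))"
      using assms(1) \<open>k \<in> A\<close> by (simp add: sum_subtractf)
    also have "\<dots> = (\<Sum>j\<in>A. scalar (2 * (x k * x j) - (if k = j then 1 else 0)) * evec j)"
    proof -
      have "scalar (c - 1) = scalar c - 1" for c
        using scalar_add[of c "-1"] by (simp add: scalar_uminus)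
      then show ?thesis by (intro sum.cong refl) (auto simp: left_diff_distrib)
    qed
    finally show "- w * evec k * w = (\<Sum>j\<in>A. scalar (2 * (x k * x j) - (if k = j then 1 else 0)) * evec j)" .
  next
    fix j l assume jl: "j \<in> A" "l \<in> A"
    let ?d = "\<lambda>k j. if k = j then 1 else 0 :: complex"
    have "(\<Sum>k\<in>A. (2 * (x k * x j) - ?d k j) * (2 * (x k * x l) - ?d k l)) =
        (\<Sum>k\<in>A. 4 * x j * x l * (x k * x k) - (if k = l then 2 * x j * x l else 0) -
          (if k = j then 2 * x j * x l else 0) + (if k = j then ?d j l else 0))"
      by (intro sum.cong refl) (auto simp: algebra_simps)
    also have "\<dots> = 4 * x j * x l * (\<Sum>k\<in>A. x k * x k) - 2 * x j * x l - 2 * x j * x l + ?d j l"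
      using assms(1) jl by (simp add: sum_subtractf sum.distrib sum_distrib_left)
    also have "\<dots> = ?d j l" by (simp add: norm)
    finally show "(\<Sum>k\<in>A. (2 * (x k * x j) - ?d k j) * (2 * (x k * x l) - ?d k l)) = ?d j l" .
  qed (rule assms(1))
qed

lemma rotation_prod_list:
  assumes "finite A" "set ws \<subseteq> unit_vectors A"
  shows "\<exists>s' R. rotation A (prod_list ws) s' R"
  using assms(2)
proof (induction ws)
  case Nil
  show ?case using rotation_1[OF assms(1)] by auto
next
  case (Cons w ws)
  obtain R where R: "rotation A w (- w) R"
    using rotation_unit_vector[OF assms(1)] Cons.prems by auto
  obtain t' T where T: "rotation A (prod_list ws) t' T" using Cons by auto
  show ?case using rotation_mult[OF R T] by auto
qed

lemma rotation_Spin: "finite A \<Longrightarrow> a \<in> Spin A \<Longrightarrow> \<exists>a' R. rotation A a a' R"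
  unfolding Spin_def using rotation_prod_list by blast

lemma unit_vectors_mono:
  assumes "A \<subseteq> B" "finite B"
  shows "unit_vectors A \<subseteq> unit_vectors B"
proof
  fix w assume "w \<in> unit_vectors A"
  then obtain x where x: "w = cvec A (\<lambda>j. complex_of_real (x j))" "(\<Sum>j\<in>A. (x j)\<^sup>2) = 1"
    by (auto simp: unit_vectors_def)
  let ?y = "\<lambda>j. if j \<in> A then x j else 0"
  have "w = cvec B (\<lambda>j. complex_of_real (?y j))"
    unfolding x(1) cvec_def using assms by (intro sum.mono_neutral_cong_left) auto
  moreover have "(\<Sum>j\<in>B. (?y j)\<^sup>2) = (\<Sum>j\<in>A. (x j)\<^sup>2)"
    using assms by (intro sum.mono_neutral_cong_right) auto
  ultimately show "w \<in> unit_vectors B" unfolding unit_vectors_def using x(2) by auto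
qed

text \<open>Each unit vector of the block anticommutes with \<open>evec j\<close>, and there is an
  even number of them.\<close>

lemma Spin_commute_evec:
  assumes "finite A" "a \<in> Spin A" "j \<notin> A"
  shows "a * evec j = evec j * a"
proof -
  obtain ws where ws: "a = prod_list ws" "even (length ws)" "set ws \<subseteq> unit_vectors A"
    using assms(2) by (auto simp: Spin_def)
  \<comment> \<open>Both parities are covered so that the induction over the list can
    proceed.\<close>
  have "prod_list ws * evec j = (if even (length ws) then evec j * prod_list ws else - (evec j * prod_list ws))"
    using ws(3)
  proof (induction ws)
    case (Cons w ws)
    then obtain x where "w = cvec A x" by (auto simp: unit_vectors_def)
    then have "w * evec j = - (evec j * w)"
      using cvec_evec[OF assms(1), of x j] assms(3) by (simp add: eq_neg_iff_add_eq_0)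
    then have "w * (evec j * prod_list ws) = - (evec j * (w * prod_list ws))"
      by (metis mult.assoc mult_minus_left)
    then show ?case using Cons by (auto simp: mult.assoc)
  qed simp
  then show ?thesis using ws by simp
qed

lemma commute_polys:
  assumes "P \<in> polys A" "\<And>j. j \<in> A \<Longrightarrow> b * evec j = evec j * b"
  shows "Const b * P = P * Const b"
  using assms(1)
  by (induction rule: polys_induct)
    (simp_all add: mult_single commute_Cl[OF _ assms(2)] distrib_left distrib_right)

section \<open>Invariance of the summands under the product of the two spin groups\<close>

context biaxial
begin

text \<open>Conjugation by \<open>a * b\<close> acts on the generators of \<open>U\<close> through
  \<open>a\<close> alone and on those of \<open>V\<close> through \<open>b\<close> alone. The
  substitution therefore splits, and the outcome is the action of \<open>a\<close> on the
  \<open>U\<close>-factor times that of \<open>b\<close> on the \<open>V\<close>-factor.\<close>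

lemma L_act_factors:
  assumes a: "a \<in> Spin U" and b: "b \<in> Spin V" and P: "P \<in> factors (s, k, i)"
  shows "L_act A (a * b) P \<in> factors (s, k, i)"
proof -
  obtain a' Ra where "rotation U a a' Ra"
    using rotation_Spin[OF finite_U a] by blast
  then interpret a: rotation U a a' Ra .
  obtain b' Rb where "rotation V b b' Rb"
    using rotation_Spin[OF finite_V b] by blast
  then interpret b: rotation V b b' Rb .
  have aV: "a * evec j = evec j * a" if "j \<in> V" for j
    using Spin_commute_evec[OF finite_U a] disjoint that by blast
  have bU: "b * evec j = evec j * b" if "j \<in> U" for j
    using Spin_commute_evec[OF finite_V b] disjoint that by blast
  have inv: "cliff_inv (a * b) = b' * a'"
    unfolding cliff_inv_def
  proof (rule the_equality)
    show "a * b * (b' * a') = 1 \<and> b' * a' * (a * b) = 1"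
      using a.inverse b.inverse by (metis mult.assoc mult_1_right)
    fix c assume "a * b * c = 1 \<and> c * (a * b) = 1"
    then show "c = b' * a'"
      using a.inverse b.inverse by (metis mult.assoc mult_1_left mult_1_right)
  qed
  let ?y = "linear_form A (\<lambda>k j. bcoeff (cliff_inv (a * b) * evec k * (a * b)) {j})"
  have conj: "cliff_inv (a * b) * evec k * (a * b) = b' * (a' * evec k * a) * b" for k
    by (simp only: inv mult.assoc)
  have conjU: "cliff_inv (a * b) * evec k * (a * b) = (\<Sum>j\<in>U. scalar (Ra k j) * evec j)" if "k \<in> U" for k
  proof -
    have "b' * (scalar c * evec j) * b = scalar c * evec j" if "j \<in> U" for c j
    proof -
      have "b' * (scalar c * evec j) * b = scalar c * (b' * (evec j * b))"
        by (metis scalar_commute mult.assoc)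
      also have "\<dots> = scalar c * (b' * b * evec j)"
        by (simp only: bU[OF that, symmetric] mult.assoc)
      finally show ?thesis by (simp add: b.inverse)
    qed
    then show ?thesis
      unfolding conj a.conj[OF that] sum_distrib_left sum_distrib_right by (intro sum.cong refl)
  qed
  have conjV: "cliff_inv (a * b) * evec k * (a * b) = (\<Sum>j\<in>V. scalar (Rb k j) * evec j)" if "k \<in> V" for k
  proof -
    have "a' * evec k * a = evec k"
      using aV[OF that] a.inverse by (metis mult.assoc mult_1_left)
    then show ?thesis unfolding conj by (simp add: b.conj[OF that])
  qed
  \<comment> \<open>Conjugates of generators from \<open>V\<close> stay in the span of
    \<open>V\<close>, so they contribute nothing to the coefficient of \<open>e_j\<close> with
    \<open>j\<close> in \<open>U\<close>.\<close>
  have yU: "?y j = linear_form U Ra j" if "j \<in> U" for j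
  proof -
    have "j \<notin> V" using that disjoint by auto
    then show ?thesis
      using that finite_U finite_V disjoint
      by (simp add: linear_form_def sum.union_disjoint conjU conjV bcoeff_linear_combination)
  qed
  have yV: "?y j = linear_form V Rb j" if "j \<in> V" for j
  proof -
    have "j \<notin> U" using that disjoint by auto
    then show ?thesis
      using that finite_U finite_V disjoint
      by (simp add: linear_form_def sum.union_disjoint conjU conjV bcoeff_linear_combination)
  qed
  obtain K G where KG: "P = vecvar U ^ s * K * G" "K \<in> monogenics_deg U k" "G \<in> monogenics_deg V i"
    using P by (rule factorsE)
  have uK: "vecvar U ^ s * K \<in> polys U" and G: "G \<in> polys V"
    using KG by (auto simp: monogenics_deg_def monogenics_def intro!: polys_mult polys_power polys_vecvar)
  let ?K = "psubst (linear_form U Ra) (vecvar U ^ s * K)" and ?G = "psubst (linear_form V Rb) G"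
  \<comment> \<open>This moves \<open>b\<close> past the \<open>U\<close>-factor, to stand directly
    before the \<open>V\<close>-factor on which it acts.\<close>
  have comm: "Const b * ?K = ?K * Const b"
    by (rule commute_polys[OF polys_psubst[OF uK central_linear_form a.linear_form_polys] bU])
  have "psubst ?y P = ?K * ?G"
    unfolding KG(1) psubst_mult[OF central_linear_form, where P = "vecvar U ^ s * K"]
    using psubst_cong[OF uK yU] psubst_cong[OF G yV] by simp
  moreover have "Const (a * b) = Const a * (Const b :: cpoly)" by (simp add: mult_single)
  ultimately have "L_act A (a * b) P = Const a * (Const b * ?K) * ?G"
    unfolding L_act_eq by (simp only: mult.assoc)
  then have "L_act A (a * b) P = a.act (vecvar U ^ s * K) * b.act G"
    unfolding comm a.act_def b.act_def by (simp only: mult.assoc)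
  also have "a.act (vecvar U ^ s * K) = vecvar U ^ s * a.act K"
    by (rule a.act_vecvar_power_mult)
  finally show ?thesis
    using a.act_monogenics_deg[OF KG(2)] b.act_monogenics_deg[OF KG(3)] by (force simp: factors_def)
qed

lemma L_act_summand:
  assumes "a \<in> Spin U" "b \<in> Spin V" "z \<in> summand t"
  shows "L_act A (a * b) z \<in> summand t"
  using assms(3) unfolding summand_def
proof (induction rule: cpoly.span_induct_alt)
  case base
  show ?case by (simp add: L_act_eq cpoly.span_zero)
next
  case (step c P z)
  have "L_act A (a * b) (pscale c P + z) = pscale c (L_act A (a * b) P) + L_act A (a * b) z"
    by (simp add: L_act_eq psubst_add psubst_pscale[OF central_linear_form] distrib_left pscale_mult_right)
  moreover have "L_act A (a * b) P \<in> factors t"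
    using step(1) L_act_factors[OF assms(1,2)] by (cases t) blast
  ultimately show ?case
    using step(2) by (simp add: cpoly.span_add cpoly.span_scale cpoly.span_base)
qed

lemma L_act_P_M_summand:
  assumes "a \<in> Spin U" "b \<in> Spin V"
  shows "L_act A (a * b) ` P_M A ` summand t \<subseteq> P_M A ` summand t"
proof -
  \<comment> \<open>Concatenating the two lists presents \<open>a * b\<close> as a product of unit
    vectors of the whole space, so its action on \<open>polys A\<close> commutes with
    \<open>P_M\<close>.\<close>
  obtain as bs where "a = prod_list as" "set as \<subseteq> unit_vectors U" "b = prod_list bs" "set bs \<subseteq> unit_vectors V"
    using assms by (auto simp: Spin_def)
  then have "a * b = prod_list (as @ bs)" "set (as @ bs) \<subseteq> unit_vectors A"
    using unit_vectors_mono[of _ A] finite_A by auto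
  then obtain s' R where "rotation A (a * b) s' R"
    using rotation_prod_list[OF finite_A] by metis
  then interpret rotation A "a * b" s' R .
  show ?thesis
  proof clarify
    fix z assume z: "z \<in> summand t"
    then have zA: "z \<in> polys A" using summand_props(1) by (cases t) blast
    then have "P_M A z \<in> polys A"
      using P_M_decompose(1)[OF finite_A nonempty_A] by (simp add: monogenics_def)
    then have "L_act A (a * b) (P_M A z) = P_M A (L_act A (a * b) z)"
      using zA by (simp add: L_act_eq_act act_P_M[OF nonempty_A])
    then show "L_act A (a * b) (P_M A z) \<in> P_M A ` summand t"
      using L_act_summand[OF assms z] by simp
  qed
qed

end

theorem corollary13:
  fixes p q n :: nat
  assumes "p \<ge> 1" and "q \<ge> 1"
  shows "direct_sum (monogenics_deg {1..p + q} n) {(s, k, i). s + k + i = n} (tau_summand p q) \<and>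
    (\<forall>a\<in>Spin {1..p}. \<forall>b\<in>Spin {p + 1..p + q}. \<forall>s k i. s + k + i = n \<longrightarrow>
      L_act {1..p + q} (a * b) ` tau_summand p q (s, k, i) \<subseteq> tau_summand p q (s, k, i))"
proof -
  interpret biaxial "{1..p}" "{p + 1..p + q}"
    using assms by unfold_locales auto
  have A: "{1..p} \<union> {p + 1..p + q} = {1..p + q}" by auto
  have tau: "tau_summand p q = (\<lambda>t. P_M {1..p + q} ` summand t)"
    using tau_summand_eq[OF assms] by auto
  show ?thesis
    using monogenic_decomposition[of n] L_act_P_M_summand unfolding A tau by blast
qed

end
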